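(* Consider the linear distributed time-delay system $$\dot{x}(t)=Ax(t)+Bx(t-h)+\int_{-h}^{0}E(\theta)x(t+\theta)\,d\theta+Du(t),\qquad t\ge0,\qquad x_0=\varphi\in \mathrm{PC}([-h,0],\mathbb{R}^n).$$ Let $u_L=u_L(x_t)$, $t\ge 0$, be an admissible linear control for this system, that is, an admissible control of the form $$u_L(x_t)=\Gamma_0x(t)+\int_{-h}^0\Gamma_1(\theta)x(t+\theta)\,d\theta ,$$ and let $\varphi$ be an initial function on $[-h,0]$. Then the functional $$V(\varphi)=J(\varphi,u_L)=\int_0^\infty\left(x^T(t)Qx(t)+u_L^T(t)Ru_L(t)\right)dt ,$$ evaluated along the solution of the closed-loop system with initial function $\varphi$, can be expressed as $$V(\varphi)=\varphi^{T}(0)\Pi_{0}\varphi(0)+2\varphi^{T}(0)\int_{-h}^{0}\Pi_{1}(\theta)\varphi(\theta)\,d\theta+\int_{-h}^{0}\int_{-h}^{0}\varphi^{T}(\xi)\Pi_{2}(\xi,\theta)\varphi(\theta)\,d\xi\,d\theta ,$$ where (the matrices not depending on $\varphi$): (i) $\Pi_0>0$ is a symmetric positive definite $n\times n$ matrix; (ii) $\Pi_1(\theta)$ is an $n\times n$ matrix function defined on $[-h,0]$; (iii) $\Pi_2(\xi,\theta)$ is an $n\times n$ matrix function defined for $\xi,\theta\in[-h,0]$, with $\Pi_2^T(\xi,\theta)=\Pi_2(\theta,\xi)$.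
   Context: Here $h>0$; $A,B\in\mathbb{R}^{n\times n}$ and $D\in\mathbb{R}^{n\times r}$ ($r\le n$) are constant; $E(\theta)\in\mathbb{R}^{n\times n}$ is continuous for $\theta\in[-h,0]$; $Q\in\mathbb{R}^{n\times n}$ and $R\in\mathbb{R}^{r\times r}$ are symmetric positive definite; $\Gamma_0\in\mathbb{R}^{r\times n}$ is constant and $\Gamma_1(\theta)\in\mathbb{R}^{r\times n}$ is a matrix function on $[-h,0]$ (such that the integrals involving it are defined). $\mathrm{PC}([-h,0],\mathbb{R}^n)$ is the space of piecewise continuous functions $[-h,0]\to\mathbb{R}^n$, and $x_t=\{x(t+\theta):\theta\in[-h,0]\}$. A control $u$ is admissible if: (1) $u=u(x_t)$ is a function of the state $x_t$; (2) solutions of the closed-loop system exist and are unique for $t\ge0$ and all initial conditions $\varphi$; (3) the trivial solution of the closed-loop system is asymptotically stable; (4) for all initial conditions $\varphi$ the performance index $J(\varphi,u)=\int_0^\infty(x^TQx+u^TRu)\,dt$ has a finite value. With an admissible linear control of the form $u_L(x_t)=\Gamma_0x(t)+\int_{-h}^0\Gamma_1(\theta)x(t+\theta)\,d\theta$, the closed-loop system is the exponentially stable system $\dot x(t)=A_0x(t)+A_1x(t-h)+\int_{-h}^0G(\theta)x(t+\theta)\,d\theta$, where $A_0=A+D\Gamma_0$, $A_1=B$, $G(\theta)=E(\theta)+D\Gamma_1(\theta)$. *)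

theory Defs
  imports "HOL-Analysis.Analysis"
begin

definition symmetric_pos_def :: "real^'k^'k \<Rightarrow> bool" where
  "symmetric_pos_def M \<longleftrightarrow> transpose M = M \<and> (\<forall>v. v \<noteq> 0 \<longrightarrow> v \<bullet> (M *v v) > 0)"

text \<open>
  Piecewise continuity on a compact interval: finitely many discontinuities, each with finite
  one-sided limits. The value taken at a discontinuity is unrestricted.
\<close>

definition PC :: "real \<Rightarrow> real \<Rightarrow> (real \<Rightarrow> 'a::topological_space) set" where
  "PC a b = {f. \<exists>S. finite S \<and> S \<subseteq> {a..b} \<and> continuous_on ({a..b} - S) f \<and>
      (\<forall>s\<in>S. (a < s \<longrightarrow> (\<exists>l. (f \<longlongrightarrow> l) (at_left s))) \<and>
             (s < b \<longrightarrow> (\<exists>l. (f \<longlongrightarrow> l) (at_right s))))}"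

text \<open>
  A state is a function on \<open>{-h..0}\<close>, represented by a total function whose values outside
  that interval are irrelevant. Controls are functionals of the state.
\<close>

definition state :: "(real \<Rightarrow> 'a) \<Rightarrow> real \<Rightarrow> real \<Rightarrow> 'a" where
  "state x t = (\<lambda>\<theta>. x (t + \<theta>))"

definition delay_rhs ::
  "real \<Rightarrow> real^'n^'n \<Rightarrow> real^'n^'n \<Rightarrow> (real \<Rightarrow> real^'n^'n) \<Rightarrow> real^'r^'n
    \<Rightarrow> ((real \<Rightarrow> real^'n) \<Rightarrow> real^'r) \<Rightarrow> (real \<Rightarrow> real^'n) \<Rightarrow> real^'n" where
  "delay_rhs h A B E D u \<psi> =
     A *v \<psi> 0 + B *v \<psi> (-h) + integral {-h..0} (\<lambda>\<theta>. E \<theta> *v \<psi> \<theta>) + D *v u \<psi>"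

text \<open>
  Since an initial function may jump, the differential equation cannot be required at every
  \<open>t \<ge> 0\<close>: a solution is continuous on \<open>{0..}\<close> and satisfies the equation outside a set having
  only finitely many points in each bounded interval. At \<open>t = 0\<close> the derivative is the right one.
\<close>

definition closed_loop_solution ::
  "real \<Rightarrow> real^'n^'n \<Rightarrow> real^'n^'n \<Rightarrow> (real \<Rightarrow> real^'n^'n) \<Rightarrow> real^'r^'n
    \<Rightarrow> ((real \<Rightarrow> real^'n) \<Rightarrow> real^'r) \<Rightarrow> (real \<Rightarrow> real^'n) \<Rightarrow> (real \<Rightarrow> real^'n) \<Rightarrow> bool" where
  "closed_loop_solution h A B E D u \<phi> x \<longleftrightarrow>
     (\<forall>\<theta>\<in>{-h..0}. x \<theta> = \<phi> \<theta>) \<and>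
     continuous_on {0..} x \<and>
     (\<exists>N. (\<forall>T. finite (N \<inter> {0..T})) \<and>
        (\<forall>t\<in>{0..} - N.
           (x has_vector_derivative delay_rhs h A B E D u (state x t)) (at t within {0..})))"

definition running_cost ::
  "real^'n^'n \<Rightarrow> real^'r^'r \<Rightarrow> ((real \<Rightarrow> real^'n) \<Rightarrow> real^'r) \<Rightarrow> (real \<Rightarrow> real^'n) \<Rightarrow> real \<Rightarrow> real" where
  "running_cost Q R u x t =
     x t \<bullet> (Q *v x t) + u (state x t) \<bullet> (R *v u (state x t))"

text \<open>The performance index along the trajectory \<open>x\<close>.\<close>

definition performance_index ::
  "real^'n^'n \<Rightarrow> real^'r^'r \<Rightarrow> ((real \<Rightarrow> real^'n) \<Rightarrow> real^'r) \<Rightarrow> (real \<Rightarrow> real^'n) \<Rightarrow> real" where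
  "performance_index Q R u x = integral {0..} (running_cost Q R u x)"

definition trivial_solution_asymptotically_stable ::
  "real \<Rightarrow> real^'n^'n \<Rightarrow> real^'n^'n \<Rightarrow> (real \<Rightarrow> real^'n^'n) \<Rightarrow> real^'r^'n
    \<Rightarrow> ((real \<Rightarrow> real^'n) \<Rightarrow> real^'r) \<Rightarrow> bool" where
  "trivial_solution_asymptotically_stable h A B E D u \<longleftrightarrow>
     closed_loop_solution h A B E D u (\<lambda>_. 0) (\<lambda>_. 0) \<and>
     (\<forall>\<epsilon>>0. \<exists>\<delta>>0. \<forall>\<phi>\<in>PC (-h) 0. \<forall>x.
        (\<forall>\<theta>\<in>{-h..0}. norm (\<phi> \<theta>) < \<delta>) \<and> closed_loop_solution h A B E D u \<phi> x
          \<longrightarrow> (\<forall>t\<ge>0. norm (x t) < \<epsilon>)) \<and>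
     (\<exists>\<delta>>0. \<forall>\<phi>\<in>PC (-h) 0. \<forall>x.
        (\<forall>\<theta>\<in>{-h..0}. norm (\<phi> \<theta>) < \<delta>) \<and> closed_loop_solution h A B E D u \<phi> x
          \<longrightarrow> (x \<longlongrightarrow> 0) at_top)"

text \<open>
  In the last conjunct the running cost is nonnegative whenever \<open>Q\<close> and \<open>R\<close> are positive
  definite, so that integrability means that the performance index is finite.
\<close>

definition admissible ::
  "real \<Rightarrow> real^'n^'n \<Rightarrow> real^'n^'n \<Rightarrow> (real \<Rightarrow> real^'n^'n) \<Rightarrow> real^'r^'n
    \<Rightarrow> real^'n^'n \<Rightarrow> real^'r^'r \<Rightarrow> ((real \<Rightarrow> real^'n) \<Rightarrow> real^'r) \<Rightarrow> bool" where
  "admissible h A B E D Q R u \<longleftrightarrow>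
     (\<forall>\<psi> \<psi>'. (\<forall>\<theta>\<in>{-h..0}. \<psi> \<theta> = \<psi>' \<theta>) \<longrightarrow> u \<psi> = u \<psi>') \<and>
     (\<forall>\<phi>\<in>PC (-h) 0. \<exists>x. closed_loop_solution h A B E D u \<phi> x \<and>
        (\<forall>y. closed_loop_solution h A B E D u \<phi> y \<longrightarrow> (\<forall>t\<ge>-h. y t = x t))) \<and>
     trivial_solution_asymptotically_stable h A B E D u \<and>
     (\<forall>\<phi>\<in>PC (-h) 0. \<forall>x. closed_loop_solution h A B E D u \<phi> x
        \<longrightarrow> running_cost Q R u x integrable_on {0..})"

definition linear_control ::
  "real \<Rightarrow> real^'n^'r \<Rightarrow> (real \<Rightarrow> real^'n^'r) \<Rightarrow> (real \<Rightarrow> real^'n) \<Rightarrow> real^'r" where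
  "linear_control h \<Gamma>\<^sub>0 \<Gamma>\<^sub>1 \<psi> = \<Gamma>\<^sub>0 *v \<psi> 0 + integral {-h..0} (\<lambda>\<theta>. \<Gamma>\<^sub>1 \<theta> *v \<psi> \<theta>)"

end

theory Submission imports Defs
begin

text \<open>
  Why the functional is quadratic in the initial function.  Let \<open>K\<close> be the fundamental matrix of the
  closed loop: its columns are the trajectories that start from a unit vector at time \<open>0\<close> and from
  zero before.  Such an initial function has a single jump, hence it is piecewise continuous and
  admissibility applies to it.  As \<open>Q\<close> is positive definite, a finite cost along these trajectories
  says that \<open>K\<close> is square integrable on the half line; this is the decay that makes all integrals
  below converge.

  The variation-of-constants formula (\<open>variation_of_constants\<close>) writes every trajectory as
  \<open>x t = K t *v \<phi> 0 + \<integral> L t \<theta> *v \<phi> \<theta> d\<theta>\<close>, where the kernel \<open>L\<close> is a convolution of \<open>K\<close> with the delayed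
  gains.  The control is again an instantaneous gain plus a convolution applied to the trajectory, so it
  has a representation of the same shape.  All kernels that occur here are square integrable in time after
  their norm has been integrated over \<open>\<theta>\<close>.  This mixed norm is the right one for two reasons: the
  convolution of an integrable with a square integrable function is square integrable
  (\<open>young_L1_L2\<close>), so the class is stable under the operations above; and gains that are merely
  integrable in \<open>\<theta>\<close> produce kernels that are in general not square integrable in \<open>\<theta>\<close>.

  Inserting the representations into the running cost and exchanging the order of integration
  (\<open>quadratic_functional_representation\<close>) gives the three terms, with
  \<open>\<Pi>\<^sub>0 = \<integral> Z\<^sup>T P Z dt\<close>, \<open>\<Pi>\<^sub>1 \<theta> = \<integral> Z\<^sup>T P W(t,\<theta>) dt\<close> and \<open>\<Pi>\<^sub>2 \<xi> \<theta> = \<integral> W(t,\<xi>)\<^sup>T P W(t,\<theta>) dt\<close>, once for the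
  state with \<open>P = Q\<close> and once for the control with \<open>P = R\<close>; the two triples are added.  Symmetry is
  visible in these formulas.  Positive definiteness of \<open>\<Pi>\<^sub>0\<close> is read off from the representation itself: for
  an initial function concentrated at \<open>0\<close> with value \<open>v\<close> the two integral terms vanish, so that
  \<open>v \<bullet> (\<Pi>\<^sub>0 *v v)\<close> is the cost of a trajectory that starts at \<open>v\<close>, which is positive if \<open>v \<noteq> 0\<close>.
\<close>

section \<open>Matrices as a normed algebra\<close>

text \<open>
  The norm of a matrix as a vector of rows is the Frobenius norm.  It is submultiplicative, which makes
  all norm estimates for kernels below hold with constant one.
\<close>

lemma norm_matrix_vector_mult_le:
  fixes A :: "real^'n^'m"
  shows "norm (A *v x) \<le> norm A * norm x"
proof -
  have "norm (A *v x) \<le> L2_set (\<lambda>i. norm (A $ i) * norm x) UNIV"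
    unfolding norm_vec_def[of "A *v x"]
    by (intro L2_set_mono) (simp_all add: matrix_vector_mul_component Cauchy_Schwarz_ineq2)
  also have "\<dots> = norm A * norm x"
    by (simp add: L2_set_left_distrib norm_vec_def[of A])
  finally show ?thesis .
qed

lemma norm_matrix_matrix_mult_le:
  fixes A :: "real^'n^'m" and B :: "real^'k^'n"
  shows "norm (A ** B) \<le> norm A * norm B"
proof -
  have row: "norm ((A ** B) $ i) \<le> norm (A $ i) * norm B" for i
  proof -
    have "(A ** B) $ i = (\<Sum>k\<in>UNIV. (A $ i $ k) *\<^sub>R (B $ k))"
      by (simp add: vec_eq_iff matrix_matrix_mult_def)
    then have "norm ((A ** B) $ i) \<le> (\<Sum>k\<in>UNIV. \<bar>A $ i $ k\<bar> * \<bar>norm (B $ k)\<bar>)"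
      by (simp add: sum_norm_le)
    also have "\<dots> \<le> norm (A $ i) * norm B"
      unfolding norm_vec_def[of "A $ i"] norm_vec_def[of B]
      using L2_set_mult_ineq[of "\<lambda>k. A $ i $ k" "\<lambda>k. norm (B $ k)" UNIV]
      by (simp add: L2_set_def)
    finally show ?thesis .
  qed
  have "norm (A ** B) \<le> L2_set (\<lambda>i. norm (A $ i) * norm B) UNIV"
    unfolding norm_vec_def[of "A ** B"] by (intro L2_set_mono row) simp
  also have "\<dots> = norm A * norm B"
    by (simp add: L2_set_left_distrib norm_vec_def[of A])
  finally show ?thesis .
qed

lemma bounded_bilinear_matrix_vector:
  "bounded_bilinear (\<lambda>(A::real^'n^'m) x. A *v x)"
proof
  show "\<exists>K. \<forall>a b. norm ((a::real^'n^'m) *v b) \<le> norm a * norm b * K"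
    by (rule exI[of _ 1]) (simp add: norm_matrix_vector_mult_le)
qed (simp_all add: vec_eq_iff matrix_vector_mult_def algebra_simps sum.distrib sum_distrib_left)

lemma bounded_bilinear_matrix_matrix:
  "bounded_bilinear (\<lambda>(A::real^'n^'m) (B::real^'k^'n). A ** B)"
proof
  show "\<exists>K. \<forall>a b. norm ((a::real^'n^'m) ** (b::real^'k^'n)) \<le> norm a * norm b * K"
    by (rule exI[of _ 1]) (simp add: norm_matrix_matrix_mult_le)
qed (simp_all add: vec_eq_iff matrix_matrix_mult_def algebra_simps sum.distrib sum_distrib_left)

lemma borel_measurable_matrix_vector [measurable (raw)]:
  fixes f :: "'a \<Rightarrow> real^'n^'m"
  assumes [measurable]: "f \<in> borel_measurable M" "g \<in> borel_measurable M"
  shows "(\<lambda>x. f x *v g x) \<in> borel_measurable M"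
  by (rule borel_measurable_continuous_Pair[of f M g "(*v)"])
    (auto intro!: bounded_bilinear.continuous_on[OF bounded_bilinear_matrix_vector] continuous_intros)

lemma borel_measurable_matrix_matrix [measurable (raw)]:
  fixes f :: "'a \<Rightarrow> real^'n^'m" and g :: "'a \<Rightarrow> real^'k^'n"
  assumes [measurable]: "f \<in> borel_measurable M" "g \<in> borel_measurable M"
  shows "(\<lambda>x. f x ** g x) \<in> borel_measurable M"
  by (rule borel_measurable_continuous_Pair[of f M g "(**)"])
    (auto intro!: bounded_bilinear.continuous_on[OF bounded_bilinear_matrix_matrix] continuous_intros)

lemma bounded_linear_transpose: "bounded_linear (transpose :: real^'n^'m \<Rightarrow> real^'m^'n)"
  by (intro linear_conv_bounded_linear[THEN iffD1] linearI) (simp_all add: vec_eq_iff transpose_def)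

lemma norm_transpose: "norm (transpose (A::real^'n^'m)) = norm A"
proof -
  have "(\<Sum>i\<in>UNIV. \<Sum>j\<in>UNIV. (A $ j $ i)\<^sup>2) = (\<Sum>j\<in>UNIV. \<Sum>i\<in>UNIV. (A $ j $ i)\<^sup>2)"
    by (rule sum.swap)
  then show ?thesis
    by (simp add: norm_vec_def L2_set_def transpose_def sum_nonneg)
qed

lemma borel_measurable_transpose [measurable (raw)]:
  fixes f :: "'a \<Rightarrow> real^'n^'m"
  assumes [measurable]: "f \<in> borel_measurable M"
  shows "(\<lambda>x. transpose (f x)) \<in> borel_measurable M"
proof -
  have "transpose \<in> borel_measurable (borel :: (real^'n^'m) measure)"
    by (intro borel_measurable_continuous_onI linear_continuous_on bounded_linear_transpose)
  from measurable_compose[OF assms this] show ?thesis .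
qed

section \<open>Square integrability and convolution\<close>

lemma ennreal_mult_le_sum_squares: "a * b \<le> a\<^sup>2 + (b::ennreal)\<^sup>2"
proof (cases "a \<le> b")
  case True
  then have "a * b \<le> b\<^sup>2" by (simp add: power2_eq_square mult_right_mono)
  then show ?thesis by (simp add: add_increasing)
next
  case False
  then have "a * b \<le> a\<^sup>2" by (simp add: power2_eq_square mult_left_mono)
  then show ?thesis by (simp add: add_increasing2)
qed

lemma ennreal_sum_squared_le: "(a + b)\<^sup>2 \<le> 4 * (a\<^sup>2 + (b::ennreal)\<^sup>2)"
proof -
  have "a + b \<le> 2 * max a b"
    unfolding mult_2 by (intro add_mono) simp_all
  then have "(a + b)\<^sup>2 \<le> (2 * max a b)\<^sup>2"
    by (intro power_mono) simp_all
  also have "\<dots> = 4 * (max a b)\<^sup>2"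
    by (simp add: power_mult_distrib)
  also have "(max a b)\<^sup>2 \<le> a\<^sup>2 + b\<^sup>2"
    by (simp add: max_def add_increasing add_increasing2)
  finally show ?thesis
    by (simp add: mult_left_mono)
qed

text \<open>
  A form of the Cauchy-Schwarz inequality for the weight \<open>u\<close>: write the square as a double
  integral and estimate the product \<open>w x * w y\<close> by \<open>(w x)\<^sup>2 + (w y)\<^sup>2\<close>.  Both terms contribute the same,
  hence the constant \<open>2\<close>.
\<close>

lemma nn_integral_weighted_square_le:
  fixes u w :: "'a \<Rightarrow> ennreal"
  assumes [measurable]: "u \<in> borel_measurable M" "w \<in> borel_measurable M"
  shows "(\<integral>\<^sup>+x. u x * w x \<partial>M)\<^sup>2 \<le> 2 * ((\<integral>\<^sup>+x. u x \<partial>M) * (\<integral>\<^sup>+x. u x * (w x)\<^sup>2 \<partial>M))"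
proof -
  have "(\<integral>\<^sup>+x. u x * w x \<partial>M)\<^sup>2 = (\<integral>\<^sup>+x. \<integral>\<^sup>+y. (u x * w x) * (u y * w y) \<partial>M \<partial>M)"
    by (simp add: power2_eq_square nn_integral_cmult nn_integral_multc)
  also have "\<dots> \<le> (\<integral>\<^sup>+x. \<integral>\<^sup>+y. (u x * (w x)\<^sup>2) * u y + u x * (u y * (w y)\<^sup>2) \<partial>M \<partial>M)"
  proof (intro nn_integral_mono)
    fix x y
    have "(u x * w x) * (u y * w y) = (u x * u y) * (w x * w y)" by (simp add: ac_simps)
    also have "\<dots> \<le> (u x * u y) * ((w x)\<^sup>2 + (w y)\<^sup>2)"
      by (intro mult_left_mono ennreal_mult_le_sum_squares) simp
    finally show "(u x * w x) * (u y * w y) \<le> (u x * (w x)\<^sup>2) * u y + u x * (u y * (w y)\<^sup>2)"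
      by (simp add: algebra_simps)
  qed
  also have "\<dots> = 2 * ((\<integral>\<^sup>+x. u x \<partial>M) * (\<integral>\<^sup>+x. u x * (w x)\<^sup>2 \<partial>M))"
    by (simp add: nn_integral_add nn_integral_cmult nn_integral_multc mult.commute mult_2)
  finally show ?thesis .
qed

lemma nn_integral_reflect_translate:
  fixes f :: "real \<Rightarrow> ennreal"
  assumes [measurable]: "f \<in> borel_measurable borel"
  shows "(\<integral>\<^sup>+s. f (t - s) \<partial>lborel) = (\<integral>\<^sup>+s. f s \<partial>lborel)"
  using nn_integral_real_affine[of f "-1" t] by simp

lemma nn_integral_translate:
  fixes f :: "real \<Rightarrow> ennreal"
  assumes [measurable]: "f \<in> borel_measurable borel"
  shows "(\<integral>\<^sup>+s. f (s - t) \<partial>lborel) = (\<integral>\<^sup>+s. f s \<partial>lborel)"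
  using nn_integral_real_affine[of f 1 "-t"] by simp

lemma nn_integral_convolution_commute:
  fixes u v :: "real \<Rightarrow> ennreal"
  assumes [measurable]: "u \<in> borel_measurable borel" "v \<in> borel_measurable borel"
  shows "(\<integral>\<^sup>+s. u (t - s) * v s \<partial>lborel) = (\<integral>\<^sup>+s. u s * v (t - s) \<partial>lborel)"
  using nn_integral_reflect_translate[of "\<lambda>s. u s * v (t - s)" t] by simp

text \<open>
  Young's inequality for convolutions, as a statement about finiteness.  The weighted estimate, with the
  first factor as the weight, bounds the square of the convolution by the convolution of \<open>u\<close> with
  \<open>v\<^sup>2\<close>, whose integral is a product by Tonelli's theorem and translation invariance.
\<close>

lemma young_L1_L2:
  fixes u v :: "real \<Rightarrow> ennreal"
  assumes [measurable]: "u \<in> borel_measurable borel" "v \<in> borel_measurable borel"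
    and u: "(\<integral>\<^sup>+s. u s \<partial>lborel) < \<infinity>" and v: "(\<integral>\<^sup>+s. (v s)\<^sup>2 \<partial>lborel) < \<infinity>"
  shows "(\<integral>\<^sup>+t. (\<integral>\<^sup>+s. u (t - s) * v s \<partial>lborel)\<^sup>2 \<partial>lborel) < \<infinity>"
proof -
  have "(\<integral>\<^sup>+t. (\<integral>\<^sup>+s. u (t - s) * v s \<partial>lborel)\<^sup>2 \<partial>lborel)
    \<le> (\<integral>\<^sup>+t. 2 * ((\<integral>\<^sup>+s. u s \<partial>lborel) * (\<integral>\<^sup>+s. u (t - s) * (v s)\<^sup>2 \<partial>lborel)) \<partial>lborel)"
  proof (intro nn_integral_mono)
    fix t
    show "(\<integral>\<^sup>+s. u (t - s) * v s \<partial>lborel)\<^sup>2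
      \<le> 2 * ((\<integral>\<^sup>+s. u s \<partial>lborel) * (\<integral>\<^sup>+s. u (t - s) * (v s)\<^sup>2 \<partial>lborel))"
      using nn_integral_weighted_square_le[of "\<lambda>s. u (t - s)" lborel v]
      by (simp add: nn_integral_reflect_translate)
  qed
  also have "\<dots> = 2 * ((\<integral>\<^sup>+s. u s \<partial>lborel) * (\<integral>\<^sup>+t. \<integral>\<^sup>+s. u (t - s) * (v s)\<^sup>2 \<partial>lborel \<partial>lborel))"
    by (simp add: nn_integral_cmult)
  also have "(\<integral>\<^sup>+t. \<integral>\<^sup>+s. u (t - s) * (v s)\<^sup>2 \<partial>lborel \<partial>lborel)
      = (\<integral>\<^sup>+s. \<integral>\<^sup>+t. u (t - s) * (v s)\<^sup>2 \<partial>lborel \<partial>lborel)"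
    by (rule lborel_pair.Fubini') simp
  also have "\<dots> = (\<integral>\<^sup>+s. u s \<partial>lborel) * (\<integral>\<^sup>+s. (v s)\<^sup>2 \<partial>lborel)"
    by (simp add: nn_integral_multc nn_integral_cmult nn_integral_translate)
  also have "2 * ((\<integral>\<^sup>+s. u s \<partial>lborel) * ((\<integral>\<^sup>+s. u s \<partial>lborel) * (\<integral>\<^sup>+s. (v s)\<^sup>2 \<partial>lborel))) < \<infinity>"
    using u v by (simp add: ennreal_mult_less_top)
  finally show ?thesis .
qed

section \<open>Causal functions and their convolution\<close>

lemma integrable_lborel_prod_bound:
  fixes F :: "real \<times> real \<Rightarrow> 'a::{banach, second_countable_topology}"
  assumes [measurable]: "F \<in> borel_measurable (lborel \<Otimes>\<^sub>M lborel)"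
    and a: "integrable lborel a" and b: "integrable lborel b"
    and le: "\<And>s r. norm (F (s, r)) \<le> a s * b r"
  shows "integrable (lborel \<Otimes>\<^sub>M lborel) F"
proof (rule lborel_pair.Fubini_integrable)
  have [measurable]: "a \<in> borel_measurable borel" "b \<in> borel_measurable borel"
    using a b by auto
  have *: "integrable lborel (\<lambda>r. F (s, r))" for s
    by (rule Bochner_Integration.integrable_bound[where f="\<lambda>r. a s * b r"])
      (auto intro!: b simp: order_trans[OF le abs_ge_self] simp del: abs_mult)
  show "AE s in lborel. integrable lborel (\<lambda>r. F (s, r))"
    using * by simp
  show "integrable lborel (\<lambda>s. LINT r|lborel. norm (F (s, r)))"
  proof (rule Bochner_Integration.integrable_bound[where f="\<lambda>s. a s * (LINT r|lborel. b r)"])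
    show "AE s in lborel. norm (LINT r|lborel. norm (F (s, r))) \<le> norm (a s * (LINT r|lborel. b r))"
    proof (rule AE_I2)
      fix s
      have "(LINT r|lborel. norm (F (s, r))) \<le> (LINT r|lborel. a s * b r)"
        by (intro integral_mono integrable_norm * integrable_mult_right b le)
      then have "(LINT r|lborel. norm (F (s, r))) \<le> a s * (LINT r|lborel. b r)"
        by simp
      moreover have "0 \<le> (LINT r|lborel. norm (F (s, r)))"
        by (intro integral_nonneg_AE) simp
      ultimately show "norm (LINT r|lborel. norm (F (s, r))) \<le> norm (a s * (LINT r|lborel. b r))"
        by (simp del: abs_mult)
    qed
  qed (use a in auto)
qed simp

text \<open>
  For functions that vanish on the negative half line the value of a convolution at \<open>t\<close> depends on the
  factors on \<open>{0..t}\<close> only, so that local bounds make all convolutions exist.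
\<close>

definition locally_bounded_causal :: "(real \<Rightarrow> 'a::{banach, second_countable_topology}) \<Rightarrow> bool" where
  "locally_bounded_causal f \<longleftrightarrow>
     f \<in> borel_measurable borel \<and> (\<forall>t<0. f t = 0) \<and> (\<forall>T. \<exists>M. \<forall>t\<le>T. norm (f t) \<le> M)"

definition locally_integrable_causal :: "(real \<Rightarrow> 'a::{banach, second_countable_topology}) \<Rightarrow> bool" where
  "locally_integrable_causal f \<longleftrightarrow>
     f \<in> borel_measurable borel \<and> (\<forall>t<0. f t = 0) \<and>
     (\<forall>T. integrable lborel (\<lambda>t. indicator {..T} t *\<^sub>R f t))"

lemma locally_bounded_causal_borel: "locally_bounded_causal f \<Longrightarrow> f \<in> borel_measurable borel"
  by (simp add: locally_bounded_causal_def)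

lemma locally_integrable_causal_borel: "locally_integrable_causal f \<Longrightarrow> f \<in> borel_measurable borel"
  by (simp add: locally_integrable_causal_def)

lemma locally_bounded_causal_neg: "locally_bounded_causal f \<Longrightarrow> t < 0 \<Longrightarrow> f t = 0"
  by (simp add: locally_bounded_causal_def)

lemma locally_integrable_causal_neg: "locally_integrable_causal f \<Longrightarrow> t < 0 \<Longrightarrow> f t = 0"
  by (simp add: locally_integrable_causal_def)

lemma locally_bounded_causalE:
  assumes "locally_bounded_causal f"
  obtains M where "M \<ge> 0" "\<And>t. t \<le> T \<Longrightarrow> norm (f t) \<le> M"
proof -
  obtain M where M: "\<forall>t\<le>T. norm (f t) \<le> M"
    using assms unfolding locally_bounded_causal_def by blast
  show thesis
    by (rule that[of M]) (use M norm_ge_zero order_trans in blast)+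
qed

lemma locally_bounded_causal_bound:
  assumes "\<And>t. norm (f t) \<le> M" "f \<in> borel_measurable borel" "\<And>t. t < 0 \<Longrightarrow> f t = 0"
  shows "locally_bounded_causal f"
  using assms unfolding locally_bounded_causal_def by blast

lemma locally_bounded_causal_add:
  assumes "locally_bounded_causal f" "locally_bounded_causal g"
  shows "locally_bounded_causal (\<lambda>t. f t + g t)"
  unfolding locally_bounded_causal_def
proof (intro conjI allI)
  fix T
  obtain M where M: "\<And>t. t \<le> T \<Longrightarrow> norm (f t) \<le> M"
    using locally_bounded_causalE[OF assms(1), of T] by blast
  obtain N where N: "\<And>t. t \<le> T \<Longrightarrow> norm (g t) \<le> N"
    using locally_bounded_causalE[OF assms(2), of T] by blast
  have "norm (f t + g t) \<le> M + N" if "t \<le> T" for t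
    using M[OF that] N[OF that] norm_triangle_ineq[of "f t" "g t"] by linarith
  then show "\<exists>M. \<forall>t\<le>T. norm (f t + g t) \<le> M" by blast
qed (use assms in \<open>auto intro!: borel_measurable_add simp: locally_bounded_causal_borel locally_bounded_causal_neg\<close>)

lemma locally_bounded_causal_bounded_linear:
  assumes L: "bounded_linear L" and f: "locally_bounded_causal f"
  shows "locally_bounded_causal (\<lambda>t. L (f t))"
  unfolding locally_bounded_causal_def
proof (intro conjI allI)
  interpret bounded_linear L by fact
  have [measurable]: "L \<in> borel_measurable borel"
    by (intro borel_measurable_continuous_onI linear_continuous_on L)
  show "(\<lambda>t. L (f t)) \<in> borel_measurable borel"
    using locally_bounded_causal_borel[OF f] by measurable
  show "t < 0 \<longrightarrow> L (f t) = 0" for t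
    using f by (simp add: locally_bounded_causal_def zero)
  fix T
  obtain M where M: "\<And>t. t \<le> T \<Longrightarrow> norm (f t) \<le> M"
    using locally_bounded_causalE[OF f, of T] by blast
  obtain K where K: "\<And>x. norm (L x) \<le> norm x * K" "K \<ge> 0"
    using nonneg_bounded by blast
  have "norm (L (f t)) \<le> M * K" if "t \<le> T" for t
    using order_trans[OF K(1) mult_right_mono[OF M[OF that] K(2)]] .
  then show "\<exists>M. \<forall>t\<le>T. norm (L (f t)) \<le> M" by blast
qed

lemma locally_bounded_causal_shift:
  assumes "locally_bounded_causal f" "h \<ge> 0"
  shows "locally_bounded_causal (\<lambda>t. f (t - h))"
  unfolding locally_bounded_causal_def
proof (intro conjI allI)
  show "(\<lambda>t. f (t - h)) \<in> borel_measurable borel"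
    using locally_bounded_causal_borel[OF assms(1)] by measurable
  fix T
  obtain M where "\<And>t. t \<le> T - h \<Longrightarrow> norm (f t) \<le> M"
    using locally_bounded_causalE[OF assms(1), of "T - h"] by blast
  then show "\<exists>M. \<forall>t\<le>T. norm (f (t - h)) \<le> M"
    by (intro exI[of _ M]) auto
qed (use assms in \<open>simp_all add: locally_bounded_causal_borel locally_bounded_causal_neg\<close>)

lemma locally_integrable_causal_integrable:
  assumes "integrable lborel f" "\<And>t. t < 0 \<Longrightarrow> f t = 0"
  shows "locally_integrable_causal f"
  using assms by (simp add: locally_integrable_causal_def integrable_mult_indicator)

lemma locally_bounded_causal_locally_integrable:
  assumes f: "locally_bounded_causal f"
  shows "locally_integrable_causal f"
  unfolding locally_integrable_causal_def
proof (intro conjI allI)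
  have [measurable]: "f \<in> borel_measurable borel"
    using f by (rule locally_bounded_causal_borel)
  fix T
  obtain M where M: "\<And>t. t \<le> T \<Longrightarrow> norm (f t) \<le> M" "M \<ge> 0"
    using locally_bounded_causalE[OF f, of T] by blast
  show "integrable lborel (\<lambda>t. indicator {..T} t *\<^sub>R f t)"
  proof (rule Bochner_Integration.integrable_bound[where f="\<lambda>t. M * indicator {0..T} t"])
    show "AE t in lborel. norm (indicator {..T} t *\<^sub>R f t) \<le> norm (M * indicator {0..T} t)"
      using M locally_bounded_causal_neg[OF f] by (auto simp: indicator_def not_le)
  qed (auto intro!: integrable_mult_right integrable_real_indicator simp: emeasure_lborel_Icc_eq)
qed (use f in \<open>simp_all add: locally_bounded_causal_borel locally_bounded_causal_neg\<close>)

text \<open>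
  The product is a parameter because gains act on matrix-valued functions (the fundamental matrix) as well as
  on vector-valued ones (a trajectory).
\<close>

definition conv :: "('a \<Rightarrow> 'b \<Rightarrow> 'c::{banach, second_countable_topology}) \<Rightarrow> (real \<Rightarrow> 'a) \<Rightarrow> (real \<Rightarrow> 'b) \<Rightarrow> real \<Rightarrow> 'c" where
  "conv b f g t = (LINT s|lborel. b (f (t - s)) (g s))"

abbreviation vconv :: "(real \<Rightarrow> real^'n^'m) \<Rightarrow> (real \<Rightarrow> real^'n) \<Rightarrow> real \<Rightarrow> real^'m" where
  "vconv \<equiv> conv (*v)"

abbreviation mconv :: "(real \<Rightarrow> real^'n^'m) \<Rightarrow> (real \<Rightarrow> real^'k^'n) \<Rightarrow> real \<Rightarrow> real^'k^'m" where
  "mconv \<equiv> conv (**)"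

lemma locally_integrable_reflect:
  assumes "locally_integrable_causal f"
  shows "integrable lborel (\<lambda>s. indicator {..T} (t - s) *\<^sub>R f (t - s))"
  using assms lborel_integrable_real_affine[of "\<lambda>t. indicator {..T} t *\<^sub>R f t" "-1" t]
  by (auto simp: locally_integrable_causal_def)

text \<open>
  For \<open>t \<le> T\<close> the integrand of the convolution at \<open>t\<close> vanishes unless \<open>0 \<le> s \<le> t\<close>, where the second factor
  is bounded and the argument of the first one is at most \<open>T\<close>.
\<close>

lemma
  fixes b :: "'a::euclidean_space \<Rightarrow> 'b::euclidean_space \<Rightarrow> 'c::euclidean_space"
  assumes b: "bounded_bilinear b"
    and f: "locally_integrable_causal f" and g: "locally_bounded_causal g"
  shows integrable_conv: "integrable lborel (\<lambda>s. b (f (t - s)) (g s))"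
    and locally_bounded_causal_conv: "locally_bounded_causal (conv b f g)"
proof -
  have [measurable]: "f \<in> borel_measurable borel" "g \<in> borel_measurable borel"
    using f g by (simp_all add: locally_bounded_causal_borel locally_integrable_causal_borel)
  have prod_measurable: "(\<lambda>x. b (u x) (v x)) \<in> borel_measurable N"
    if [measurable]: "u \<in> borel_measurable N" "v \<in> borel_measurable N" for N :: "(real \<times> real) measure" and u v
    by (rule borel_measurable_continuous_Pair[of u N v b])
      (auto intro!: bounded_bilinear.continuous_on[OF b] continuous_intros)
  have integrand_measurable: "(\<lambda>s. b (f (t - s)) (g s)) \<in> borel_measurable borel" for t
    by (rule borel_measurable_continuous_Pair[of _ borel _ b])
      (auto intro!: bounded_bilinear.continuous_on[OF b] continuous_intros)
  obtain C where C: "\<And>x y. norm (b x y) \<le> norm x * norm y * C" "C > 0"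
    using bounded_bilinear.pos_bounded[OF b] by blast
  have zero: "b x 0 = 0" "b 0 y = 0" for x y
    using bounded_bilinear.zero_right[OF b] bounded_bilinear.zero_left[OF b] by auto
  let ?f = "\<lambda>T t. indicator {..T} t *\<^sub>R f t"
  \<comment> \<open>One majorant for all times up to the horizon; it gives integrability and the local bound at once.\<close>
  have bound: "norm (b (f (t - s)) (g s)) \<le> norm (?f T (t - s)) * (M * C)"
    if "t \<le> T" "M \<ge> 0" "\<And>s. s \<le> T \<Longrightarrow> norm (g s) \<le> M" for t T M s
  proof (cases "s < 0 \<or> s > t")
    case True
    then have "f (t - s) = 0 \<or> g s = 0"
      using locally_integrable_causal_neg[OF f] locally_bounded_causal_neg[OF g] by auto
    then have "b (f (t - s)) (g s) = 0"
      using zero by metis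
    then show ?thesis
      using that C by simp
  next
    case False
    then have "norm (g s) \<le> M" using that by auto
    then have "norm (f (t - s)) * norm (g s) * C \<le> norm (f (t - s)) * M * C"
      using C by (intro mult_right_mono mult_left_mono) auto
    then show ?thesis
      using False that C(1)[of "f (t - s)" "g s"] by (auto simp: mult.assoc)
  qed
  have int: "integrable lborel (\<lambda>s. norm (?f T (t - s)) * (M * C))" for T M t
    by (intro integrable_mult_left integrable_norm locally_integrable_reflect f)
  show *: "integrable lborel (\<lambda>s. b (f (t - s)) (g s))" for t
  proof -
    obtain M where M: "M \<ge> 0" "\<And>s. s \<le> t \<Longrightarrow> norm (g s) \<le> M"
      using locally_bounded_causalE[OF g] by blast
    show ?thesis
      by (rule Bochner_Integration.integrable_bound[OF int[of t t M]])
         (use bound[OF order_refl M] integrand_measurable C(2) M(1) in \<open>auto simp: abs_mult intro!: AE_I2\<close>)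
  qed
  show "locally_bounded_causal (conv b f g)"
    unfolding locally_bounded_causal_def
  proof (intro conjI allI impI)
    have "(\<lambda>(t, s). b (f (t - s)) (g s)) \<in> borel_measurable (borel \<Otimes>\<^sub>M lborel)"
      unfolding split_beta by (rule prod_measurable) measurable
    from lborel.borel_measurable_lebesgue_integral[OF this]
    show "conv b f g \<in> borel_measurable borel"
      unfolding conv_def[abs_def] by simp
  next
    fix t :: real assume "t < 0"
    then have "f (t - s) = 0 \<or> g s = 0" for s
      using locally_integrable_causal_neg[OF f] locally_bounded_causal_neg[OF g] by (cases "s < 0") auto
    then have "b (f (t - s)) (g s) = 0" for s
      using zero by metis
    then show "conv b f g t = 0"
      by (simp add: conv_def)
  next
    fix T :: real
    obtain M where M: "M \<ge> 0" "\<And>s. s \<le> T \<Longrightarrow> norm (g s) \<le> M"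
      using locally_bounded_causalE[OF g] by blast
    have "norm (conv b f g t) \<le> (LINT s|lborel. norm (?f T s)) * (M * C)" if "t \<le> T" for t
    proof -
      have "norm (conv b f g t) \<le> (LINT s|lborel. norm (?f T (t - s)) * (M * C))"
        unfolding conv_def
        by (rule order_trans[OF integral_norm_bound
              integral_mono[OF integrable_norm[OF *] int bound[OF that M]]])
      also have "\<dots> = (LINT s|lborel. norm (?f T (t - s))) * (M * C)"
        by simp
      also have "(LINT s|lborel. norm (?f T (t - s))) = (LINT s|lborel. norm (?f T s))"
        using lborel_integral_real_affine[of "-1" "\<lambda>s. norm (?f T s)" t] by simp
      finally show ?thesis .
    qed
    then show "\<exists>M. \<forall>t\<le>T. norm (conv b f g t) \<le> M" by blast
  qed
qed

lemma integral_matrix_vector_right: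
  fixes A :: "real^'n^'m" and f :: "'a \<Rightarrow> real^'n"
  assumes "integrable M f"
  shows "(LINT x|M. A *v f x) = A *v (LINT x|M. f x)"
  by (rule integral_bounded_linear[OF bounded_bilinear.bounded_linear_right[OF bounded_bilinear_matrix_vector] assms])

lemma integral_matrix_vector_left:
  fixes A :: "'a \<Rightarrow> real^'n^'m"
  assumes "integrable M A"
  shows "(LINT x|M. A x *v v) = (LINT x|M. A x) *v v"
  using integral_bounded_linear[OF bounded_bilinear.bounded_linear_left[OF bounded_bilinear_matrix_vector] assms] .

lemmas integrable_vconv = integrable_conv[OF bounded_bilinear_matrix_vector]
lemmas integrable_mconv = integrable_conv[OF bounded_bilinear_matrix_matrix]
lemmas locally_bounded_causal_vconv = locally_bounded_causal_conv[OF bounded_bilinear_matrix_vector]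
lemmas locally_bounded_causal_mconv = locally_bounded_causal_conv[OF bounded_bilinear_matrix_matrix]

text \<open>
  Associativity is Fubini's theorem on the triangle \<open>0 \<le> r \<le> s \<le> t\<close>.
\<close>

lemma vconv_assoc:
  fixes f :: "real \<Rightarrow> real^'n^'m" and g :: "real \<Rightarrow> real^'k^'n" and k :: "real \<Rightarrow> real^'k"
  assumes f: "locally_integrable_causal f" and g: "locally_bounded_causal g" and k: "locally_bounded_causal k"
  shows "vconv f (vconv g k) t = vconv (mconv f g) k t"
proof -
  have [measurable]: "f \<in> borel_measurable borel" "g \<in> borel_measurable borel" "k \<in> borel_measurable borel"
    using f g k by (simp_all add: locally_bounded_causal_borel locally_integrable_causal_borel)
  obtain M where M: "M \<ge> 0" "\<And>s. s \<le> t \<Longrightarrow> norm (g s) \<le> M"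
    using locally_bounded_causalE[OF g] by blast
  define F where "F = (\<lambda>(s, r). f (t - s) *v (g (s - r) *v k r))"
  let ?f = "\<lambda>s. indicator {..t} (t - s) *\<^sub>R f (t - s)" and ?k = "\<lambda>r. indicator {..t} r *\<^sub>R k r"
  have F: "integrable (lborel \<Otimes>\<^sub>M lborel) F"
  proof (rule integrable_lborel_prod_bound)
    show "F \<in> borel_measurable (lborel \<Otimes>\<^sub>M lborel)"
      unfolding F_def by measurable
    show "integrable lborel (\<lambda>s. norm (?f s) * M)"
      by (intro integrable_mult_left integrable_norm locally_integrable_reflect f)
    show "integrable lborel (\<lambda>r. norm (?k r))"
      using locally_bounded_causal_locally_integrable[OF k]
      by (intro integrable_norm) (simp add: locally_integrable_causal_def)
    fix s r
    show "norm (F (s, r)) \<le> norm (?f s) * M * norm (?k r)"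
    proof (cases "0 \<le> r \<and> r \<le> s \<and> s \<le> t")
      case True
      have "norm (F (s, r)) \<le> norm (f (t - s)) * norm (g (s - r) *v k r)"
        by (simp add: F_def norm_matrix_vector_mult_le)
      also have "\<dots> \<le> norm (f (t - s)) * (norm (g (s - r)) * norm (k r))"
        by (simp add: norm_matrix_vector_mult_le mult_left_mono)
      also have "\<dots> \<le> norm (f (t - s)) * (M * norm (k r))"
        using M True by (intro mult_left_mono mult_right_mono) auto
      finally show ?thesis
        using True by (simp add: mult.assoc)
    next
      case False
      then have "k r = 0 \<or> g (s - r) = 0 \<or> f (t - s) = 0"
        using locally_integrable_causal_neg[OF f, of "t - s"] locally_bounded_causal_neg[OF g, of "s - r"]
          locally_bounded_causal_neg[OF k, of r] by auto
      then have "F (s, r) = 0"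
        by (auto simp: F_def)
      then show ?thesis using M by simp
    qed
  qed
  have "vconv f (vconv g k) t = (LINT s|lborel. LINT r|lborel. F (s, r))"
    unfolding F_def conv_def by (simp add: integral_matrix_vector_right integrable_vconv
        locally_bounded_causal_locally_integrable g k)
  also have "\<dots> = (LINT r|lborel. LINT s|lborel. F (s, r))"
    using lborel_pair.Fubini_integral[of "\<lambda>s r. F (s, r)"] F by simp
  also have "\<dots> = vconv (mconv f g) k t"
    unfolding conv_def
  proof (rule Bochner_Integration.integral_cong[OF refl])
    fix r
    have "(LINT s|lborel. F (s, r)) = (LINT s|lborel. (f (t - r - s) ** g s) *v k r)"
      unfolding F_def using lborel_integral_real_affine[of 1 "\<lambda>s. f (t - s) *v (g (s - r) *v k r)" r]
      by (simp add: matrix_vector_mul_assoc algebra_simps)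
    also have "\<dots> = (LINT s|lborel. f (t - r - s) ** g s) *v k r"
      by (intro integral_matrix_vector_left integrable_mconv f g)
    finally show "(LINT s|lborel. F (s, r)) = (LINT s|lborel. f (t - r - s) ** g s) *v k r" .
  qed
  finally show ?thesis .
qed

text \<open>
  The constant \<open>2 * C\<close> in the exponential weight makes a Volterra operator with constant \<open>C\<close> a contraction with
  factor \<open>1/2\<close> on the whole interval, so that repeated use of the estimate forces \<open>w\<close> to vanish.
\<close>

lemma volterra_uniqueness:
  fixes w :: "real \<Rightarrow> 'a::real_normed_vector"
  assumes bounded: "\<And>t. t \<in> {0..T} \<Longrightarrow> norm (w t) \<le> M"
    and C: "C > 0"
    and step: "\<And>S t. S \<ge> 0 \<Longrightarrow> t \<in> {0..T} \<Longrightarrow> (\<And>s. s \<in> {0..t} \<Longrightarrow> norm (w s) \<le> S * exp (2 * C * s))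
      \<Longrightarrow> norm (w t) \<le> C * (S * ((exp (2 * C * t) - 1) / (2 * C)))"
    and t: "t \<in> {0..T}"
  shows "w t = 0"
proof -
  have "\<forall>t\<in>{0..T}. norm (w t) \<le> \<bar>M\<bar> / 2 ^ n * exp (2 * C * t)" for n
  proof (induction n)
    case 0
    have "norm (w t) \<le> \<bar>M\<bar> * exp (2 * C * t)" if "t \<in> {0..T}" for t
    proof -
      have "\<bar>M\<bar> * 1 \<le> \<bar>M\<bar> * exp (2 * C * t)"
        using that C by (intro mult_left_mono) auto
      then show ?thesis using bounded[OF that] by linarith
    qed
    then show ?case by simp
  next
    case (Suc n)
    show ?case
    proof
      fix t assume t: "t \<in> {0..T}"
      have "norm (w t) \<le> C * (\<bar>M\<bar> / 2 ^ n * ((exp (2 * C * t) - 1) / (2 * C)))"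
        using Suc t by (intro step) auto
      also have "\<dots> = \<bar>M\<bar> / 2 ^ Suc n * (exp (2 * C * t) - 1)"
        using C by (simp add: field_simps)
      also have "\<dots> \<le> \<bar>M\<bar> / 2 ^ Suc n * exp (2 * C * t)"
        by (intro mult_left_mono) auto
      finally show "norm (w t) \<le> \<bar>M\<bar> / 2 ^ Suc n * exp (2 * C * t)" .
    qed
  qed
  then have "\<forall>n. norm (w t) \<le> \<bar>M\<bar> / 2 ^ n * exp (2 * C * t)"
    using t by blast
  moreover have "(\<lambda>n. \<bar>M\<bar> / 2 ^ n * exp (2 * C * t)) \<longlonglongrightarrow> 0"
    by (intro tendsto_mult_left_zero LIMSEQ_divide_realpow_zero) auto
  ultimately have "norm (w t) \<le> 0"
    by (intro LIMSEQ_le_const) auto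
  then show ?thesis by simp
qed

section \<open>Square integrable kernels\<close>

text \<open>
  A function that is not Bochner integrable has integral \<open>0\<close>, and then the estimate is trivial.
\<close>

lemma norm_integral_le_nn_integral:
  fixes f :: "'a \<Rightarrow> 'b::{banach, second_countable_topology}"
  shows "ennreal (norm (integral\<^sup>L M f)) \<le> (\<integral>\<^sup>+x. norm (f x) \<partial>M)"
  by (cases "integrable M f") (simp_all add: integral_norm_bound_ennreal not_integrable_integral_eq)

definition kernel_mass :: "(real \<Rightarrow> real \<Rightarrow> real^'n^'m) \<Rightarrow> real \<Rightarrow> ennreal" where
  "kernel_mass M t = (\<integral>\<^sup>+\<theta>. norm (M t \<theta>) \<partial>lborel)"

text \<open>
  The mixed norm: integrate the norm over \<open>\<theta>\<close> first, then the square over \<open>t\<close>.  A kernel in this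
  class maps bounded functions of \<open>\<theta>\<close> to square integrable functions of \<open>t\<close>, and translates such as
  \<open>\<gamma> (t - \<theta>)\<close> of an integrable function \<open>\<gamma>\<close>, cut off to a bounded range of \<open>\<theta>\<close>, belong to it.
\<close>

definition square_integrable_kernel :: "(real \<Rightarrow> real \<Rightarrow> real^'n^'m) \<Rightarrow> bool" where
  "square_integrable_kernel M \<longleftrightarrow> case_prod M \<in> borel_measurable (borel \<Otimes>\<^sub>M borel) \<and>
     (\<integral>\<^sup>+t. (kernel_mass M t)\<^sup>2 \<partial>lborel) < \<infinity>"

lemma borel_measurable_kernel_mass [measurable]:
  assumes [measurable]: "case_prod M \<in> borel_measurable (borel \<Otimes>\<^sub>M borel)"
  shows "kernel_mass M \<in> borel_measurable borel"
  unfolding kernel_mass_def[abs_def] by measurable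

lemma square_integrable_kernel_bound:
  assumes "case_prod M \<in> borel_measurable (borel \<Otimes>\<^sub>M borel)"
    and "\<And>t. kernel_mass M t \<le> m t" and "(\<integral>\<^sup>+t. (m t)\<^sup>2 \<partial>lborel) < \<infinity>"
  shows "square_integrable_kernel M"
proof -
  have "(\<integral>\<^sup>+t. (kernel_mass M t)\<^sup>2 \<partial>lborel) \<le> (\<integral>\<^sup>+t. (m t)\<^sup>2 \<partial>lborel)"
    using assms(2) by (intro nn_integral_mono power_mono) auto
  with assms(1,3) show ?thesis
    by (auto simp: square_integrable_kernel_def intro: le_less_trans)
qed

lemma nn_integral_sum_squared_finite:
  fixes a b :: "real \<Rightarrow> ennreal"
  assumes [measurable]: "a \<in> borel_measurable borel" "b \<in> borel_measurable borel"
    and "(\<integral>\<^sup>+t. (a t)\<^sup>2 \<partial>lborel) < \<infinity>" "(\<integral>\<^sup>+t. (b t)\<^sup>2 \<partial>lborel) < \<infinity>"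
  shows "(\<integral>\<^sup>+t. (a t + b t)\<^sup>2 \<partial>lborel) < \<infinity>"
proof -
  have "(\<integral>\<^sup>+t. (a t + b t)\<^sup>2 \<partial>lborel) \<le> (\<integral>\<^sup>+t. 4 * ((a t)\<^sup>2 + (b t)\<^sup>2) \<partial>lborel)"
    by (intro nn_integral_mono ennreal_sum_squared_le)
  also have "\<dots> = 4 * ((\<integral>\<^sup>+t. (a t)\<^sup>2 \<partial>lborel) + (\<integral>\<^sup>+t. (b t)\<^sup>2 \<partial>lborel))"
    by (simp add: nn_integral_cmult nn_integral_add)
  also have "\<dots> < \<infinity>"
    using assms by (simp add: ennreal_mult_less_top)
  finally show ?thesis .
qed

lemma square_integrable_kernel_add:
  assumes "square_integrable_kernel M" "square_integrable_kernel N"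
  shows "square_integrable_kernel (\<lambda>t \<theta>. M t \<theta> + N t \<theta>)"
proof (rule square_integrable_kernel_bound)
  have [measurable]: "case_prod M \<in> borel_measurable (borel \<Otimes>\<^sub>M borel)"
    "case_prod N \<in> borel_measurable (borel \<Otimes>\<^sub>M borel)"
    using assms by (simp_all add: square_integrable_kernel_def)
  show "(\<lambda>(t, \<theta>). M t \<theta> + N t \<theta>) \<in> borel_measurable (borel \<Otimes>\<^sub>M borel)"
    by measurable
  show "(\<integral>\<^sup>+t. (kernel_mass M t + kernel_mass N t)\<^sup>2 \<partial>lborel) < \<infinity>"
    using assms by (intro nn_integral_sum_squared_finite) (simp_all add: square_integrable_kernel_def)
  fix t
  have "kernel_mass (\<lambda>t \<theta>. M t \<theta> + N t \<theta>) t \<le> (\<integral>\<^sup>+\<theta>. ennreal (norm (M t \<theta>)) + ennreal (norm (N t \<theta>)) \<partial>lborel)"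
    unfolding kernel_mass_def
    by (intro nn_integral_mono) (simp add: norm_triangle_ineq flip: ennreal_plus)
  then show "kernel_mass (\<lambda>t \<theta>. M t \<theta> + N t \<theta>) t \<le> kernel_mass M t + kernel_mass N t"
    by (simp add: kernel_mass_def nn_integral_add)
qed

lemma square_integrable_kernel_mult_left:
  fixes C :: "real^'m^'k"
  assumes "square_integrable_kernel M"
  shows "square_integrable_kernel (\<lambda>t \<theta>. C ** M t \<theta>)"
proof (rule square_integrable_kernel_bound)
  have [measurable]: "case_prod M \<in> borel_measurable (borel \<Otimes>\<^sub>M borel)"
    using assms by (simp add: square_integrable_kernel_def)
  show "(\<lambda>(t, \<theta>). C ** M t \<theta>) \<in> borel_measurable (borel \<Otimes>\<^sub>M borel)"
    by measurable
  show "(\<integral>\<^sup>+t. (ennreal (norm C) * kernel_mass M t)\<^sup>2 \<partial>lborel) < \<infinity>"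
    using assms by (simp add: power_mult_distrib nn_integral_cmult square_integrable_kernel_def
        ennreal_mult_less_top ennreal_power)
  fix t
  have "kernel_mass (\<lambda>t \<theta>. C ** M t \<theta>) t \<le> (\<integral>\<^sup>+\<theta>. ennreal (norm C) * ennreal (norm (M t \<theta>)) \<partial>lborel)"
    unfolding kernel_mass_def
    by (intro nn_integral_mono) (simp add: norm_matrix_matrix_mult_le flip: ennreal_mult)
  then show "kernel_mass (\<lambda>t \<theta>. C ** M t \<theta>) t \<le> ennreal (norm C) * kernel_mass M t"
    by (simp add: kernel_mass_def nn_integral_cmult)
qed

lemma square_integrable_kernel_restrict:
  assumes "square_integrable_kernel M" "A \<in> sets borel"
  shows "square_integrable_kernel (\<lambda>t \<theta>. indicator A t *\<^sub>R M t \<theta>)"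
proof (rule square_integrable_kernel_bound)
  have [measurable]: "case_prod M \<in> borel_measurable (borel \<Otimes>\<^sub>M borel)" "A \<in> sets borel"
    using assms by (simp_all add: square_integrable_kernel_def)
  show "(\<lambda>(t, \<theta>). indicator A t *\<^sub>R M t \<theta>) \<in> borel_measurable (borel \<Otimes>\<^sub>M borel)"
    by measurable
  show "(\<integral>\<^sup>+t. (kernel_mass M t)\<^sup>2 \<partial>lborel) < \<infinity>"
    using assms by (simp add: square_integrable_kernel_def)
  show "kernel_mass (\<lambda>t \<theta>. indicator A t *\<^sub>R M t \<theta>) t \<le> kernel_mass M t" for t
    unfolding kernel_mass_def by (intro nn_integral_mono) (simp add: indicator_def)
qed

lemma square_integrable_kernel_AE_integrable:
  assumes "square_integrable_kernel M"
  shows "AE t in lborel. integrable lborel (M t)"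
proof -
  have [measurable]: "case_prod M \<in> borel_measurable (borel \<Otimes>\<^sub>M borel)"
    using assms by (simp add: square_integrable_kernel_def)
  have "AE t in lborel. (kernel_mass M t)\<^sup>2 \<noteq> \<infinity>"
    using assms by (intro nn_integral_PInf_AE) (auto simp: square_integrable_kernel_def)
  then show ?thesis
  proof (rule AE_mp, intro AE_I2 impI)
    fix t assume "(kernel_mass M t)\<^sup>2 \<noteq> \<infinity>"
    then have "kernel_mass M t < \<infinity>"
      by (auto simp: less_top power2_eq_square ennreal_mult_eq_top_iff)
    then show "integrable lborel (M t)"
      by (intro integrableI_bounded) (simp_all add: kernel_mass_def)
  qed
qed

lemma integrable_matrix_vector_bounded:
  fixes f :: "'a \<Rightarrow> real^'n^'m"
  assumes f: "integrable M f" and g: "g \<in> borel_measurable M" and c: "\<And>x. norm (g x) \<le> c"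
  shows "integrable M (\<lambda>x. f x *v g x)"
proof (rule Bochner_Integration.integrable_bound[where f="\<lambda>x. c * norm (f x)"])
  have [measurable]: "f \<in> borel_measurable M" using f by simp
  show "(\<lambda>x. f x *v g x) \<in> borel_measurable M"
    using g by measurable
  show "AE x in M. norm (f x *v g x) \<le> norm (c * norm (f x))"
  proof (rule AE_I2)
    fix x
    have "norm (f x *v g x) \<le> norm (f x) * norm (g x)" by (rule norm_matrix_vector_mult_le)
    also have "\<dots> \<le> norm (f x) * c" using c by (intro mult_left_mono) auto
    also have "\<dots> \<le> norm (c * norm (f x))" by (simp add: mult.commute)
    finally show "norm (f x *v g x) \<le> norm (c * norm (f x))" .
  qed
qed (use f in auto)

text \<open>
  Convolving in time commutes with integrating a kernel against a function of \<open>\<theta>\<close>.  The hypothesis is exactly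
  what makes the double integral over \<open>(s, \<theta>)\<close> absolutely convergent for almost every \<open>t\<close>.  Stated
  like this, it covers both cases of Young's inequality: \<open>g\<close> integrable and the masses of \<open>M\<close> square integrable,
  or the other way round.
\<close>

lemma
  fixes g :: "real \<Rightarrow> real^'m^'k" and M :: "real \<Rightarrow> real \<Rightarrow> real^'n^'m"
  assumes g[measurable]: "g \<in> borel_measurable borel"
    and M[measurable]: "case_prod M \<in> borel_measurable (borel \<Otimes>\<^sub>M borel)"
    and fin: "(\<integral>\<^sup>+t. (\<integral>\<^sup>+s. norm (g (t - s)) * kernel_mass M s \<partial>lborel)\<^sup>2 \<partial>lborel) < \<infinity>"
  defines "N \<equiv> \<lambda>t \<theta>. LINT s|lborel. g (t - s) ** M s \<theta>"
  shows square_integrable_kernel_compose: "square_integrable_kernel N"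
    and compose_kernel_apply: "\<Phi> \<in> borel_measurable borel \<Longrightarrow> (\<And>\<theta>. norm (\<Phi> \<theta>) \<le> c) \<Longrightarrow> AE t in lborel.
      (LINT \<theta>|lborel. N t \<theta> *v \<Phi> \<theta>) = (LINT s|lborel. g (t - s) *v (LINT \<theta>|lborel. M s \<theta> *v \<Phi> \<theta>))"
proof -
  define a where "a t = (\<integral>\<^sup>+s. norm (g (t - s)) * kernel_mass M s \<partial>lborel)" for t
  have F_meas[measurable]: "(\<lambda>(s, \<theta>). g (t - s) ** M s \<theta>) \<in> borel_measurable (lborel \<Otimes>\<^sub>M lborel)" for t
    by measurable
  have mass: "(\<integral>\<^sup>+s. \<integral>\<^sup>+\<theta>. norm (g (t - s) ** M s \<theta>) \<partial>lborel \<partial>lborel) \<le> a t" for t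
  proof -
    have "(\<integral>\<^sup>+s. \<integral>\<^sup>+\<theta>. norm (g (t - s) ** M s \<theta>) \<partial>lborel \<partial>lborel)
      \<le> (\<integral>\<^sup>+s. \<integral>\<^sup>+\<theta>. ennreal (norm (g (t - s))) * ennreal (norm (M s \<theta>)) \<partial>lborel \<partial>lborel)"
      by (intro nn_integral_mono) (simp add: norm_matrix_matrix_mult_le flip: ennreal_mult)
    also have "\<dots> = a t"
      by (simp add: a_def kernel_mass_def nn_integral_cmult)
    finally show ?thesis .
  qed
  show "square_integrable_kernel N"
  proof (rule square_integrable_kernel_bound)
    show "case_prod N \<in> borel_measurable (borel \<Otimes>\<^sub>M borel)"
      unfolding N_def by measurable
    show "(\<integral>\<^sup>+t. (a t)\<^sup>2 \<partial>lborel) < \<infinity>"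
      using fin by (simp add: a_def)
    fix t
    have "kernel_mass N t \<le> (\<integral>\<^sup>+\<theta>. \<integral>\<^sup>+s. norm (g (t - s) ** M s \<theta>) \<partial>lborel \<partial>lborel)"
      unfolding kernel_mass_def N_def by (intro nn_integral_mono norm_integral_le_nn_integral)
    also have "\<dots> = (\<integral>\<^sup>+s. \<integral>\<^sup>+\<theta>. norm (g (t - s) ** M s \<theta>) \<partial>lborel \<partial>lborel)"
      by (rule lborel_pair.Fubini') measurable
    also note mass
    finally show "kernel_mass N t \<le> a t" .
  qed
  have [measurable]: "a \<in> borel_measurable borel"
    unfolding a_def[abs_def] by measurable
  have a_fin: "AE t in lborel. (a t)\<^sup>2 \<noteq> \<infinity>"
    using fin by (intro nn_integral_PInf_AE) (auto simp: a_def)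
  assume \<Phi>[measurable]: "\<Phi> \<in> borel_measurable borel" and c: "\<And>\<theta>. norm (\<Phi> \<theta>) \<le> c"
  show "AE t in lborel.
      (LINT \<theta>|lborel. N t \<theta> *v \<Phi> \<theta>) = (LINT s|lborel. g (t - s) *v (LINT \<theta>|lborel. M s \<theta> *v \<Phi> \<theta>))"
  proof (rule AE_mp[OF a_fin], intro AE_I2 impI)
    fix t
    assume "(a t)\<^sup>2 \<noteq> \<infinity>"
    then have fin_t: "a t < \<infinity>"
      by (auto simp: less_top power2_eq_square ennreal_mult_eq_top_iff)
    define F where "F = (\<lambda>(s, \<theta>). g (t - s) ** M s \<theta>)"
    have F_int: "integrable (lborel \<Otimes>\<^sub>M lborel) F"
    proof (rule integrableI_bounded)
      show "F \<in> borel_measurable (lborel \<Otimes>\<^sub>M lborel)"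
        unfolding F_def by measurable
      have "(\<integral>\<^sup>+x. norm (F x) \<partial>(lborel \<Otimes>\<^sub>M lborel)) = (\<integral>\<^sup>+s. \<integral>\<^sup>+\<theta>. norm (F (s, \<theta>)) \<partial>lborel \<partial>lborel)"
        by (subst lborel.nn_integral_fst[symmetric]) (simp_all add: F_def)
      also have "\<dots> \<le> a t"
        using mass[of t] by (simp add: F_def)
      finally show "(\<integral>\<^sup>+x. norm (F x) \<partial>(lborel \<Otimes>\<^sub>M lborel)) < \<infinity>"
        using fin_t by (rule le_less_trans)
    qed
    have F\<Phi>_int: "integrable (lborel \<Otimes>\<^sub>M lborel) (\<lambda>x. F x *v \<Phi> (snd x))"
      by (rule integrable_matrix_vector_bounded[OF F_int, of _ c]) (use c in auto)
    have "(LINT \<theta>|lborel. N t \<theta> *v \<Phi> \<theta>) = (LINT \<theta>|lborel. LINT s|lborel. F (s, \<theta>) *v \<Phi> \<theta>)"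
    proof (rule integral_cong_AE)
      show "AE \<theta> in lborel. N t \<theta> *v \<Phi> \<theta> = (LINT s|lborel. F (s, \<theta>) *v \<Phi> \<theta>)"
        using lborel_pair.AE_integrable_snd[OF F_int[unfolded F_def]]
        by eventually_elim (simp add: integral_matrix_vector_left N_def F_def)
    qed (unfold N_def F_def, measurable)
    also have "\<dots> = (LINT s|lborel. LINT \<theta>|lborel. F (s, \<theta>) *v \<Phi> \<theta>)"
      using F\<Phi>_int by (intro lborel_pair.Fubini_integral) (simp add: split_beta')
    also have "\<dots> = (LINT s|lborel. g (t - s) *v (LINT \<theta>|lborel. M s \<theta> *v \<Phi> \<theta>))"
    proof (rule integral_cong_AE)
      have "AE s in lborel. ennreal (norm (g (t - s))) * kernel_mass M s \<noteq> \<infinity>"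
        using fin_t by (intro nn_integral_PInf_AE) (auto simp: a_def)
      then show "AE s in lborel. (LINT \<theta>|lborel. F (s, \<theta>) *v \<Phi> \<theta>) = g (t - s) *v (LINT \<theta>|lborel. M s \<theta> *v \<Phi> \<theta>)"
      proof (rule AE_mp, intro AE_I2 impI)
        fix s assume s: "ennreal (norm (g (t - s))) * kernel_mass M s \<noteq> \<infinity>"
        show "(LINT \<theta>|lborel. F (s, \<theta>) *v \<Phi> \<theta>) = g (t - s) *v (LINT \<theta>|lborel. M s \<theta> *v \<Phi> \<theta>)"
        \<comment> \<open>Where the factor is nonzero, the mass of the kernel is finite; elsewhere both sides vanish.\<close>
        proof (cases "g (t - s) = 0")
          case False
          then have "kernel_mass M s < \<infinity>"
            using s by (auto simp: less_top ennreal_mult_eq_top_iff)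
          then have "integrable lborel (M s)"
            by (intro integrableI_bounded) (simp_all add: kernel_mass_def)
          then have "integrable lborel (\<lambda>\<theta>. M s \<theta> *v \<Phi> \<theta>)"
            by (rule integrable_matrix_vector_bounded[of _ _ _ c]) (use c in auto)
          then show ?thesis
            by (simp add: F_def integral_matrix_vector_right flip: matrix_vector_mul_assoc)
        qed (simp add: F_def)
      qed
    qed (unfold F_def, measurable)
    finally show "(LINT \<theta>|lborel. N t \<theta> *v \<Phi> \<theta>) = (LINT s|lborel. g (t - s) *v (LINT \<theta>|lborel. M s \<theta> *v \<Phi> \<theta>))" .
  qed
qed

section \<open>Quadratic functionals of kernels\<close>

text \<open>
  The pairing of two kernel outputs is a bilinear form in the inputs, and its kernel \<open>G\<close> is the time integral of
  \<open>M1\<^sup>T P M2\<close>.  The triple integral converges absolutely because the product of the two masses is bounded by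
  the sum of their squares.  The measures \<open>\<nu>1\<close> and \<open>\<nu>2\<close> are arbitrary so that the point value \<open>\<phi> 0\<close> and the
  history \<open>\<phi> \<theta>\<close> are handled by the same lemma: counting measure on a point for the former, Lebesgue measure for
  the latter.
\<close>

lemma
  fixes M1 :: "real \<Rightarrow> 'a \<Rightarrow> real^'n^'m" and M2 :: "real \<Rightarrow> 'b \<Rightarrow> real^'k^'m" and P :: "real^'m^'m"
  assumes "sigma_finite_measure \<nu>1" "sigma_finite_measure \<nu>2"
    and M1[measurable]: "case_prod M1 \<in> borel_measurable (lborel \<Otimes>\<^sub>M \<nu>1)"
    and M2[measurable]: "case_prod M2 \<in> borel_measurable (lborel \<Otimes>\<^sub>M \<nu>2)"
    and fin1: "(\<integral>\<^sup>+t. (\<integral>\<^sup>+x. norm (M1 t x) \<partial>\<nu>1)\<^sup>2 \<partial>lborel) < \<infinity>"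
    and fin2: "(\<integral>\<^sup>+t. (\<integral>\<^sup>+y. norm (M2 t y) \<partial>\<nu>2)\<^sup>2 \<partial>lborel) < \<infinity>"
    and \<Phi>1[measurable]: "\<Phi>1 \<in> borel_measurable \<nu>1" and c1: "\<And>x. norm (\<Phi>1 x) \<le> c1"
    and \<Phi>2[measurable]: "\<Phi>2 \<in> borel_measurable \<nu>2" and c2: "\<And>y. norm (\<Phi>2 y) \<le> c2"
  defines "G \<equiv> \<lambda>x y. LINT t|lborel. transpose (M1 t x) ** P ** M2 t y"
    and "z \<equiv> \<lambda>t. (LINT x|\<nu>1. M1 t x *v \<Phi>1 x) \<bullet> (P *v (LINT y|\<nu>2. M2 t y *v \<Phi>2 y))"
  shows integrable_gram_kernel: "integrable (\<nu>1 \<Otimes>\<^sub>M \<nu>2) (\<lambda>(x, y). G x y)"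
    and integrable_gram_form: "integrable (\<nu>1 \<Otimes>\<^sub>M \<nu>2) (\<lambda>(x, y). \<Phi>1 x \<bullet> (G x y *v \<Phi>2 y))"
    and integrable_gram_pairing: "integrable lborel z"
    and integral_gram_pairing: "(LINT t|lborel. z t) = (LINT (x, y)|(\<nu>1 \<Otimes>\<^sub>M \<nu>2). \<Phi>1 x \<bullet> (G x y *v \<Phi>2 y))"
proof -
  interpret \<nu>1: sigma_finite_measure \<nu>1 by fact
  interpret \<nu>2: sigma_finite_measure \<nu>2 by fact
  interpret \<nu>: pair_sigma_finite \<nu>1 \<nu>2 ..
  interpret T: pair_sigma_finite lborel "\<nu>1 \<Otimes>\<^sub>M \<nu>2" ..
  define m1 m2 where "m1 t = (\<integral>\<^sup>+x. norm (M1 t x) \<partial>\<nu>1)" and "m2 t = (\<integral>\<^sup>+y. norm (M2 t y) \<partial>\<nu>2)" for t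
  have m_meas[measurable]: "m1 \<in> borel_measurable lborel" "m2 \<in> borel_measurable lborel"
    unfolding m1_def[abs_def] m2_def[abs_def] by measurable
  have m_fin: "(\<integral>\<^sup>+t. (m1 t)\<^sup>2 \<partial>lborel) < \<infinity>" "(\<integral>\<^sup>+t. (m2 t)\<^sup>2 \<partial>lborel) < \<infinity>"
    using fin1 fin2 by (simp_all add: m1_def m2_def)
  define F where "F t xy = transpose (M1 t (fst xy)) ** P ** M2 t (snd xy)" for t xy
  have F_meas[measurable]: "(\<lambda>(t, xy). F t xy) \<in> borel_measurable (lborel \<Otimes>\<^sub>M (\<nu>1 \<Otimes>\<^sub>M \<nu>2))"
    unfolding F_def by measurable
  have norm_F: "norm (F t (x, y)) \<le> norm P * (norm (M1 t x) * norm (M2 t y))" for t x y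
  proof -
    have "norm (F t (x, y)) \<le> norm (transpose (M1 t x) ** P) * norm (M2 t y)"
      unfolding F_def fst_conv snd_conv by (rule norm_matrix_matrix_mult_le)
    also have "\<dots> \<le> (norm (transpose (M1 t x)) * norm P) * norm (M2 t y)"
      by (intro mult_right_mono norm_matrix_matrix_mult_le) simp
    finally show ?thesis by (simp add: norm_transpose ac_simps)
  qed
  have F_int: "integrable (lborel \<Otimes>\<^sub>M (\<nu>1 \<Otimes>\<^sub>M \<nu>2)) (\<lambda>(t, xy). F t xy)"
  proof (rule integrableI_bounded)
    have inner: "(\<integral>\<^sup>+xy. norm (F t xy) \<partial>(\<nu>1 \<Otimes>\<^sub>M \<nu>2)) \<le> norm P * ((m1 t)\<^sup>2 + (m2 t)\<^sup>2)" for t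
    proof -
      have "(\<integral>\<^sup>+xy. norm (F t xy) \<partial>(\<nu>1 \<Otimes>\<^sub>M \<nu>2))
          = (\<integral>\<^sup>+x. \<integral>\<^sup>+y. norm (F t (x, y)) \<partial>\<nu>2 \<partial>\<nu>1)"
        by (subst \<nu>2.nn_integral_fst[symmetric]) simp_all
      also have "\<dots> \<le> (\<integral>\<^sup>+x. \<integral>\<^sup>+y. ennreal (norm P) * (ennreal (norm (M1 t x)) * ennreal (norm (M2 t y))) \<partial>\<nu>2 \<partial>\<nu>1)"
        by (intro nn_integral_mono) (simp add: norm_F flip: ennreal_mult)
      also have "\<dots> = norm P * (m1 t * m2 t)"
        by (simp add: m1_def m2_def nn_integral_cmult nn_integral_multc)
      also have "\<dots> \<le> norm P * ((m1 t)\<^sup>2 + (m2 t)\<^sup>2)"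
        by (intro mult_left_mono ennreal_mult_le_sum_squares) simp
      finally show ?thesis .
    qed
    have "(\<integral>\<^sup>+x. norm (case x of (t, xy) \<Rightarrow> F t xy) \<partial>(lborel \<Otimes>\<^sub>M (\<nu>1 \<Otimes>\<^sub>M \<nu>2)))
        = (\<integral>\<^sup>+t. \<integral>\<^sup>+xy. norm (F t xy) \<partial>(\<nu>1 \<Otimes>\<^sub>M \<nu>2) \<partial>lborel)"
      by (subst \<nu>.P.nn_integral_fst[symmetric]) simp_all
    also have "\<dots> \<le> (\<integral>\<^sup>+t. norm P * ((m1 t)\<^sup>2 + (m2 t)\<^sup>2) \<partial>lborel)"
      by (intro nn_integral_mono inner)
    also have "\<dots> = norm P * ((\<integral>\<^sup>+t. (m1 t)\<^sup>2 \<partial>lborel) + (\<integral>\<^sup>+t. (m2 t)\<^sup>2 \<partial>lborel))"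
      by (simp add: nn_integral_cmult nn_integral_add)
    also have "\<dots> < \<infinity>"
      using m_fin by (simp add: ennreal_mult_less_top)
    finally show "(\<integral>\<^sup>+x. norm (case x of (t, xy) \<Rightarrow> F t xy) \<partial>(lborel \<Otimes>\<^sub>M (\<nu>1 \<Otimes>\<^sub>M \<nu>2))) < \<infinity>" .
  qed simp
  show "integrable (\<nu>1 \<Otimes>\<^sub>M \<nu>2) (\<lambda>(x, y). G x y)"
    using T.integrable_snd[OF F_int] by (simp add: split_beta' G_def F_def)
  define f where "f t xy = \<Phi>1 (fst xy) \<bullet> (F t xy *v \<Phi>2 (snd xy))" for t xy
  have f_int: "integrable (lborel \<Otimes>\<^sub>M (\<nu>1 \<Otimes>\<^sub>M \<nu>2)) (\<lambda>(t, xy). f t xy)"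
  proof (rule Bochner_Integration.integrable_bound)
    show "integrable (lborel \<Otimes>\<^sub>M (\<nu>1 \<Otimes>\<^sub>M \<nu>2)) (\<lambda>p. c1 * c2 * norm (case p of (t, xy) \<Rightarrow> F t xy))"
      by (intro integrable_mult_right integrable_norm F_int)
    show "(\<lambda>(t, xy). f t xy) \<in> borel_measurable (lborel \<Otimes>\<^sub>M (\<nu>1 \<Otimes>\<^sub>M \<nu>2))"
      unfolding f_def by measurable
    have "norm (f t xy) \<le> c1 * c2 * norm (F t xy)" for t xy
    proof -
      have "norm (f t xy) \<le> norm (\<Phi>1 (fst xy)) * norm (F t xy *v \<Phi>2 (snd xy))"
        unfolding f_def real_norm_def by (rule Cauchy_Schwarz_ineq2)
      also have "\<dots> \<le> c1 * (norm (F t xy) * c2)"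
        by (intro mult_mono c1 order_trans[OF norm_matrix_vector_mult_le] mult_left_mono c2)
          (auto intro: order_trans[OF norm_ge_zero c1])
      finally show ?thesis by (simp add: ac_simps)
    qed
    then show "AE p in lborel \<Otimes>\<^sub>M (\<nu>1 \<Otimes>\<^sub>M \<nu>2). norm (case p of (t, xy) \<Rightarrow> f t xy)
        \<le> norm (c1 * c2 * norm (case p of (t, xy) \<Rightarrow> F t xy))"
      by (intro AE_I2) (auto simp: split_beta' simp del: abs_mult intro: order_trans[OF _ abs_ge_self])
  qed
  have G_meas[measurable]: "(\<lambda>(x, y). G x y) \<in> borel_measurable (\<nu>1 \<Otimes>\<^sub>M \<nu>2)"
    using \<open>integrable (\<nu>1 \<Otimes>\<^sub>M \<nu>2) (\<lambda>(x, y). G x y)\<close> by simp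
  have f_G: "AE xy in \<nu>1 \<Otimes>\<^sub>M \<nu>2. (LINT t|lborel. f t xy) = \<Phi>1 (fst xy) \<bullet> (G (fst xy) (snd xy) *v \<Phi>2 (snd xy))"
  proof (rule AE_mp[OF T.AE_integrable_snd[OF F_int]], intro AE_I2 impI)
    fix xy
    assume int: "integrable lborel (\<lambda>t. F t xy)"
    then show "(LINT t|lborel. f t xy) = \<Phi>1 (fst xy) \<bullet> (G (fst xy) (snd xy) *v \<Phi>2 (snd xy))"
    proof -
      let ?x = "fst xy" and ?y = "snd xy"
      have L: "bounded_linear (\<lambda>A :: real^'k^'n. \<Phi>1 ?x \<bullet> (A *v \<Phi>2 ?y))"
        by (rule bounded_linear_compose[OF bounded_linear_inner_right
              bounded_bilinear.bounded_linear_left[OF bounded_bilinear_matrix_vector]])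
      show ?thesis
        using integral_bounded_linear[OF L int] by (simp add: f_def G_def F_def)
    qed
  qed
  have f_snd: "integrable (\<nu>1 \<Otimes>\<^sub>M \<nu>2) (\<lambda>xy. LINT t|lborel. f t xy)"
    using T.integrable_snd[OF f_int] by simp
  have f_snd_meas[measurable]: "(\<lambda>xy. LINT t|lborel. f t xy) \<in> borel_measurable (\<nu>1 \<Otimes>\<^sub>M \<nu>2)"
    using f_snd by simp
  show "integrable (\<nu>1 \<Otimes>\<^sub>M \<nu>2) (\<lambda>(x, y). \<Phi>1 x \<bullet> (G x y *v \<Phi>2 y))"
    unfolding split_beta'
    by (rule integrable_cong_AE_imp[OF f_snd]) (measurable, use f_G in \<open>auto simp: eq_commute\<close>)
  have z_meas[measurable]: "z \<in> borel_measurable lborel"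
    unfolding z_def by measurable
  have fin_AE: "AE t in lborel. m t < \<infinity>"
    if [measurable]: "m \<in> borel_measurable lborel" and "(\<integral>\<^sup>+t. (m t)\<^sup>2 \<partial>lborel) < \<infinity>" for m
  proof -
    have "AE t in lborel. (m t)\<^sup>2 \<noteq> \<infinity>"
      using that by (intro nn_integral_PInf_AE) auto
    then show ?thesis
      by eventually_elim (auto simp: less_top power2_eq_square ennreal_mult_eq_top_iff)
  qed
  have z_f: "AE t in lborel. (LINT xy|(\<nu>1 \<Otimes>\<^sub>M \<nu>2). f t xy) = z t"
    using fin_AE[OF m_meas(1) m_fin(1)] fin_AE[OF m_meas(2) m_fin(2)] T.AE_integrable_fst[OF f_int]
  proof eventually_elim
    case (elim t)
    have "integrable \<nu>1 (M1 t)" "integrable \<nu>2 (M2 t)"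
      using elim by (auto intro!: integrableI_bounded simp: m1_def m2_def)
    then have int: "integrable \<nu>1 (\<lambda>x. M1 t x *v \<Phi>1 x)" "integrable \<nu>2 (\<lambda>y. M2 t y *v \<Phi>2 y)"
      by (auto intro!: integrable_matrix_vector_bounded c1 c2)
    have f_eq: "f t (x, y) = (M1 t x *v \<Phi>1 x) \<bullet> (P *v (M2 t y *v \<Phi>2 y))" for x y
      by (simp add: f_def F_def transpose_matrix_vector flip: matrix_vector_mul_assoc)
        (metis dot_lmul_matrix inner_commute)
    have "(LINT xy|(\<nu>1 \<Otimes>\<^sub>M \<nu>2). f t xy) = (LINT x|\<nu>1. LINT y|\<nu>2. f t (x, y))"
      using \<nu>.integral_fst'[of "f t"] elim by simp
    also have "\<dots> = (LINT x|\<nu>1. (M1 t x *v \<Phi>1 x) \<bullet> (P *v (LINT y|\<nu>2. M2 t y *v \<Phi>2 y)))"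
      using int(2) by (simp add: f_eq integral_matrix_vector_right
          integrable_bounded_linear[OF bounded_bilinear.bounded_linear_right[OF bounded_bilinear_matrix_vector]])
    also have "\<dots> = z t"
      using int(1) by (simp add: z_def)
    finally show ?case .
  qed
  have f_fst: "integrable lborel (\<lambda>t. LINT xy|(\<nu>1 \<Otimes>\<^sub>M \<nu>2). f t xy)"
    using T.integrable_fst[OF f_int] by simp
  show "integrable lborel z"
    by (rule integrable_cong_AE_imp[OF f_fst]) (measurable, use z_f in \<open>auto simp: eq_commute\<close>)
  have "(LINT t|lborel. z t) = (LINT t|lborel. LINT xy|(\<nu>1 \<Otimes>\<^sub>M \<nu>2). f t xy)"
    using z_f f_fst by (intro integral_cong_AE) (auto simp: eq_commute)
  also have "\<dots> = (LINT xy|(\<nu>1 \<Otimes>\<^sub>M \<nu>2). LINT t|lborel. f t xy)"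
    using T.Fubini_integral[OF f_int] by simp
  also have "\<dots> = (LINT xy|(\<nu>1 \<Otimes>\<^sub>M \<nu>2). \<Phi>1 (fst xy) \<bullet> (G (fst xy) (snd xy) *v \<Phi>2 (snd xy)))"
    using f_G by (intro integral_cong_AE) auto
  finally show "(LINT t|lborel. z t) = (LINT (x, y)|(\<nu>1 \<Otimes>\<^sub>M \<nu>2). \<Phi>1 x \<bullet> (G x y *v \<Phi>2 y))"
    by (simp add: split_beta')
qed

text \<open>
  The square of \<open>Z t *v v + \<integral> W t \<theta> *v \<Phi> \<theta> d\<theta>\<close> with respect to \<open>P\<close> splits into three pairings.  By the symmetry
  of \<open>P\<close> the two mixed ones agree, which accounts for the factor \<open>2\<close>.
\<close>

lemma quadratic_functional_representation:
  fixes Z :: "real \<Rightarrow> real^'n^'m" and W :: "real \<Rightarrow> real \<Rightarrow> real^'n^'m" and P :: "real^'m^'m"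
  assumes P: "transpose P = P"
    and Z[measurable]: "Z \<in> borel_measurable borel" and Z2: "(\<integral>\<^sup>+t. (ennreal (norm (Z t)))\<^sup>2 \<partial>lborel) < \<infinity>"
    and W: "square_integrable_kernel W"
  obtains \<Pi>0 :: "real^'n^'n" and \<Pi>1 :: "real \<Rightarrow> real^'n^'n" and \<Pi>2 :: "real \<Rightarrow> real \<Rightarrow> real^'n^'n"
  where "transpose \<Pi>0 = \<Pi>0" "integrable lborel \<Pi>1"
    "integrable (lborel \<Otimes>\<^sub>M lborel) (\<lambda>(\<xi>, \<theta>). \<Pi>2 \<xi> \<theta>)"
    "\<And>\<xi> \<theta>. transpose (\<Pi>2 \<xi> \<theta>) = \<Pi>2 \<theta> \<xi>"
    "\<And>v \<Phi> c z. \<Phi> \<in> borel_measurable borel \<Longrightarrow> (\<And>\<theta>. norm (\<Phi> \<theta>) \<le> c) \<Longrightarrow> z \<in> borel_measurable borel \<Longrightarrow>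
      (AE t in lborel. z t = Z t *v v + (LINT \<theta>|lborel. W t \<theta> *v \<Phi> \<theta>)) \<Longrightarrow>
      integrable lborel (\<lambda>t. z t \<bullet> (P *v z t)) \<and>
      (LINT t|lborel. z t \<bullet> (P *v z t)) = v \<bullet> (\<Pi>0 *v v) + 2 * (v \<bullet> (LINT \<theta>|lborel. \<Pi>1 \<theta> *v \<Phi> \<theta>))
        + (LINT (\<xi>, \<theta>)|(lborel \<Otimes>\<^sub>M lborel). \<Phi> \<xi> \<bullet> (\<Pi>2 \<xi> \<theta> *v \<Phi> \<theta>))"
proof -
  \<comment> \<open>The matrix-valued function \<open>Z\<close> is a kernel over a one-point space.\<close>
  let ?\<delta> = "count_space (UNIV :: unit set)"
  define Y where "Y = (\<lambda>t (u::unit). Z t)"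
  have sf: "sigma_finite_measure ?\<delta>" "sigma_finite_measure (lborel :: real measure)"
    by (auto intro: sigma_finite_measure_count_space_finite lborel.sigma_finite_measure_axioms)
  interpret \<delta>: pair_sigma_finite ?\<delta> "lborel :: real measure"
    using sf by (simp add: pair_sigma_finite_def)
  interpret \<delta>\<delta>: pair_sigma_finite ?\<delta> ?\<delta>
    using sf by (simp add: pair_sigma_finite_def)
  have \<delta>_int: "(LINT u|?\<delta>. f u) = f ()" for f :: "unit \<Rightarrow> 'z::{banach, second_countable_topology}"
    by (simp add: lebesgue_integral_count_space_finite UNIV_unit)
  have W_meas[measurable]: "case_prod W \<in> borel_measurable (borel \<Otimes>\<^sub>M borel)"
    and W2: "(\<integral>\<^sup>+t. (\<integral>\<^sup>+\<theta>. norm (W t \<theta>) \<partial>lborel)\<^sup>2 \<partial>lborel) < \<infinity>"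
    using W by (simp_all add: square_integrable_kernel_def kernel_mass_def)
  have W_meas': "case_prod W \<in> borel_measurable (lborel \<Otimes>\<^sub>M lborel)"
    using W_meas by measurable
  have Y_meas: "case_prod Y \<in> borel_measurable (lborel \<Otimes>\<^sub>M ?\<delta>)"
    unfolding Y_def by measurable
  have Y2: "(\<integral>\<^sup>+t. (\<integral>\<^sup>+u. norm (Y t u) \<partial>?\<delta>)\<^sup>2 \<partial>lborel) < \<infinity>"
    using Z2 by (simp add: Y_def nn_integral_count_space_finite UNIV_unit)
  define \<Pi>0 where "\<Pi>0 = (LINT t|lborel. transpose (Z t) ** P ** Z t)"
  define \<Pi>1 where "\<Pi>1 \<theta> = (LINT t|lborel. transpose (Z t) ** P ** W t \<theta>)" for \<theta>
  define \<Pi>2 where "\<Pi>2 \<xi> \<theta> = (LINT t|lborel. transpose (W t \<xi>) ** P ** W t \<theta>)" for \<xi> \<theta>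
  have transpose_integral: "transpose (integral\<^sup>L lborel f) = (LINT t|lborel. transpose (f t))"
    for f :: "real \<Rightarrow> real^'n^'n"
    by (rule integral_bounded_linear'[OF bounded_linear_transpose bounded_linear_transpose, symmetric]) simp
  have transpose_gram: "transpose (transpose A ** P ** B) = transpose B ** P ** A" for A B :: "real^'n^'m"
    by (simp add: matrix_transpose_mul P matrix_mul_assoc)
  show thesis
  proof
    show "transpose \<Pi>0 = \<Pi>0" "\<And>\<xi> \<theta>. transpose (\<Pi>2 \<xi> \<theta>) = \<Pi>2 \<theta> \<xi>"
      by (simp_all add: \<Pi>0_def \<Pi>2_def transpose_integral transpose_gram)
    have zero: "(\<lambda>_. 0::real^'n) \<in> borel_measurable lborel" "(\<lambda>_. 0::real^'n) \<in> borel_measurable ?\<delta>"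
      by auto
    note zero_le = order_refl[of "norm (0::real^'n)"]
    show "integrable (lborel \<Otimes>\<^sub>M lborel) (\<lambda>(\<xi>, \<theta>). \<Pi>2 \<xi> \<theta>)"
      unfolding \<Pi>2_def
      by (rule integrable_gram_kernel[OF sf(2,2) W_meas' W_meas' W2 W2 zero(1) zero_le zero(1) zero_le])
    have "integrable (?\<delta> \<Otimes>\<^sub>M lborel) (\<lambda>(u, \<theta>). \<Pi>1 \<theta>)"
      unfolding \<Pi>1_def
      by (rule integrable_gram_kernel[OF sf Y_meas W_meas' Y2 W2 zero(2) zero_le zero(1) zero_le, unfolded Y_def])
    from \<delta>.AE_integrable_fst[OF this] show "integrable lborel \<Pi>1"
      by (simp add: AE_count_space)
    fix v \<Phi> c z
    assume \<Phi>[measurable]: "\<Phi> \<in> borel_measurable borel" and c: "\<And>\<theta>. norm (\<Phi> \<theta>) \<le> c"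
      and z[measurable]: "z \<in> borel_measurable borel"
      and z_eq: "AE t in lborel. z t = Z t *v v + (LINT \<theta>|lborel. W t \<theta> *v \<Phi> \<theta>)"
    define b where "b t = (LINT \<theta>|lborel. W t \<theta> *v \<Phi> \<theta>)" for t
    have b_meas[measurable]: "b \<in> borel_measurable borel"
      unfolding b_def[abs_def] by measurable
    have \<Phi>': "\<Phi> \<in> borel_measurable lborel" by simp
    have v': "(\<lambda>_. v) \<in> borel_measurable ?\<delta>" by simp
    note R = order_refl[of "norm v"]
    have Zb: "integrable lborel (\<lambda>t. (Z t *v v) \<bullet> (P *v b t))"
      using integrable_gram_pairing[OF sf Y_meas W_meas' Y2 W2 v' R \<Phi>' c]
      by (simp add: \<delta>_int Y_def b_def)
    have ZZ: "integrable lborel (\<lambda>t. (Z t *v v) \<bullet> (P *v (Z t *v v)))"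
      using integrable_gram_pairing[OF sf(1,1) Y_meas Y_meas Y2 Y2 v' R v' R]
      by (simp add: \<delta>_int Y_def)
    have bb: "integrable lborel (\<lambda>t. b t \<bullet> (P *v b t))"
      using integrable_gram_pairing[OF sf(2,2) W_meas' W_meas' W2 W2 \<Phi>' c \<Phi>' c]
      by (simp add: b_def)
    have Zb_eq: "(LINT t|lborel. (Z t *v v) \<bullet> (P *v b t)) = v \<bullet> (LINT \<theta>|lborel. \<Pi>1 \<theta> *v \<Phi> \<theta>)"
    proof -
      have "(LINT t|lborel. (Z t *v v) \<bullet> (P *v b t)) = (LINT (u, \<theta>)|(?\<delta> \<Otimes>\<^sub>M lborel). v \<bullet> (\<Pi>1 \<theta> *v \<Phi> \<theta>))"
        using integral_gram_pairing[OF sf Y_meas W_meas' Y2 W2 v' R \<Phi>' c]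
        by (simp add: \<delta>_int Y_def b_def \<Pi>1_def)
      also have "\<dots> = (LINT u|?\<delta>. LINT \<theta>|lborel. v \<bullet> (\<Pi>1 \<theta> *v \<Phi> \<theta>))"
        using integrable_gram_form[OF sf Y_meas W_meas' Y2 W2 v' R \<Phi>' c]
        by (intro \<delta>.integral_fst[symmetric]) (simp add: Y_def \<Pi>1_def)
      also have "\<dots> = v \<bullet> (LINT \<theta>|lborel. \<Pi>1 \<theta> *v \<Phi> \<theta>)"
        using integrable_matrix_vector_bounded[OF \<open>integrable lborel \<Pi>1\<close> \<Phi>' c] by (simp add: \<delta>_int)
      finally show ?thesis .
    qed
    have ZZ_eq: "(LINT t|lborel. (Z t *v v) \<bullet> (P *v (Z t *v v))) = v \<bullet> (\<Pi>0 *v v)"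
    proof -
      have "(LINT t|lborel. (Z t *v v) \<bullet> (P *v (Z t *v v))) = (LINT (u, u')|(?\<delta> \<Otimes>\<^sub>M ?\<delta>). v \<bullet> (\<Pi>0 *v v))"
        using integral_gram_pairing[OF sf(1,1) Y_meas Y_meas Y2 Y2 v' R v' R]
        by (simp add: \<delta>_int Y_def \<Pi>0_def)
      also have "\<dots> = (LINT u|?\<delta>. LINT u'|?\<delta>. v \<bullet> (\<Pi>0 *v v))"
        using integrable_gram_form[OF sf(1,1) Y_meas Y_meas Y2 Y2 v' R v' R]
        by (intro \<delta>\<delta>.integral_fst[symmetric]) (simp add: Y_def \<Pi>0_def)
      finally show ?thesis by (simp add: \<delta>_int)
    qed
    have bb_eq: "(LINT t|lborel. b t \<bullet> (P *v b t)) = (LINT (\<xi>, \<theta>)|(lborel \<Otimes>\<^sub>M lborel). \<Phi> \<xi> \<bullet> (\<Pi>2 \<xi> \<theta> *v \<Phi> \<theta>))"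
      using integral_gram_pairing[OF sf(2,2) W_meas' W_meas' W2 W2 \<Phi>' c \<Phi>' c]
      by (simp add: b_def \<Pi>2_def)
    have sym: "x \<bullet> (P *v y) = y \<bullet> (P *v x)" for x y
      using dot_lmul_matrix[of x P y] P by (metis inner_commute transpose_matrix_vector)
    define q where "q t = (Z t *v v) \<bullet> (P *v (Z t *v v)) + 2 * ((Z t *v v) \<bullet> (P *v b t)) + b t \<bullet> (P *v b t)" for t
    have z_q: "AE t in lborel. q t = z t \<bullet> (P *v z t)"
      using z_eq
    proof eventually_elim
      case (elim t)
      then have "z t = Z t *v v + b t" by (simp add: b_def)
      then show ?case
        using sym[of "b t" "Z t *v v"] by (simp add: q_def matrix_vector_right_distrib inner_add_left inner_add_right)
    qed
    have q_int: "integrable lborel q"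
      unfolding q_def[abs_def] using ZZ Zb bb by simp
    have "integrable lborel (\<lambda>t. z t \<bullet> (P *v z t))"
      by (rule integrable_cong_AE_imp[OF q_int _ z_q]) measurable
    moreover have "(LINT t|lborel. z t \<bullet> (P *v z t)) = (LINT t|lborel. q t)"
      using z_q q_int by (intro integral_cong_AE) (auto simp: eq_commute)
    moreover have "(LINT t|lborel. q t) = v \<bullet> (\<Pi>0 *v v) + 2 * (v \<bullet> (LINT \<theta>|lborel. \<Pi>1 \<theta> *v \<Phi> \<theta>))
        + (LINT (\<xi>, \<theta>)|(lborel \<Otimes>\<^sub>M lborel). \<Phi> \<xi> \<bullet> (\<Pi>2 \<xi> \<theta> *v \<Phi> \<theta>))"
      unfolding q_def using ZZ Zb bb by (simp add: ZZ_eq Zb_eq bb_eq)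
    ultimately show "integrable lborel (\<lambda>t. z t \<bullet> (P *v z t)) \<and>
      (LINT t|lborel. z t \<bullet> (P *v z t)) = v \<bullet> (\<Pi>0 *v v) + 2 * (v \<bullet> (LINT \<theta>|lborel. \<Pi>1 \<theta> *v \<Phi> \<theta>))
        + (LINT (\<xi>, \<theta>)|(lborel \<Otimes>\<^sub>M lborel). \<Phi> \<xi> \<bullet> (\<Pi>2 \<xi> \<theta> *v \<Phi> \<theta>))"
      by simp
  qed
qed

section \<open>Variation of constants for delay equations\<close>

text \<open>
  Convolution with this function is integration from \<open>0\<close> to \<open>t\<close>; in this form the integrated differential
  equation takes part in the algebra of convolutions.
\<close>

definition heaviside :: "real \<Rightarrow> real^'n^'n" where
  "heaviside t = (if t \<ge> 0 then mat 1 else 0)"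

lemma heaviside_simps [simp]:
  "t \<ge> 0 \<Longrightarrow> heaviside t = mat 1" "t < 0 \<Longrightarrow> heaviside t = 0"
  by (simp_all add: heaviside_def)

lemma locally_bounded_causal_heaviside: "locally_bounded_causal (heaviside :: real \<Rightarrow> real^'n^'n)"
  by (rule locally_bounded_causal_bound[of _ "norm (mat 1 :: real^'n^'n)"])
    (auto simp: heaviside_def[abs_def])

lemmas locally_bounded_causal_matrix_left = locally_bounded_causal_bounded_linear[OF bounded_bilinear.bounded_linear_right[OF bounded_bilinear_matrix_matrix]]
lemmas locally_bounded_causal_vector_left = locally_bounded_causal_bounded_linear[OF bounded_bilinear.bounded_linear_right[OF bounded_bilinear_matrix_vector]]
lemmas locally_bounded_causal_apply = locally_bounded_causal_bounded_linear[OF bounded_bilinear.bounded_linear_left[OF bounded_bilinear_matrix_vector]]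

lemma vconv_add_right:
  assumes "locally_integrable_causal f" "locally_bounded_causal a" "locally_bounded_causal b"
  shows "vconv f (\<lambda>s. a s + b s) t = vconv f a t + vconv f b t"
  unfolding conv_def using assms by (simp add: matrix_vector_right_distrib integrable_vconv)

lemma vconv_add_left:
  assumes "locally_bounded_causal f" "locally_bounded_causal g" "locally_bounded_causal a"
  shows "vconv (\<lambda>s. f s + g s) a t = vconv f a t + vconv g a t"
  unfolding conv_def using assms
  by (simp add: matrix_vector_mult_add_rdistrib integrable_vconv locally_bounded_causal_locally_integrable)

lemma mconv_apply:
  assumes "locally_integrable_causal f" "locally_bounded_causal a"
  shows "vconv f (\<lambda>s. a s *v v) t = mconv f a t *v v"
  unfolding conv_def using assms
  by (simp add: integrable_mconv matrix_vector_mul_assoc flip: integral_matrix_vector_left)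

lemma matrix_vconv:
  assumes "locally_bounded_causal f" "locally_bounded_causal a"
  shows "A *v vconv f a t = vconv (\<lambda>s. A ** f s) a t"
  unfolding conv_def using assms
  by (simp add: integrable_vconv locally_bounded_causal_locally_integrable flip: integral_matrix_vector_right matrix_vector_mul_assoc)

text \<open>
  The delay equation \<open>x' t = A0 *v x t + B *v x (t - h) + \<integral> g s *v x (t - s) ds\<close>.  The variable of the
  distributed delay is the age \<open>s \<ge> 0\<close> instead of \<open>\<theta> = - s\<close>, which turns the delay term into a causal
  convolution.
\<close>

locale delay_system =
  fixes h :: real and A0 B :: "real^'n^'n" and g :: "real \<Rightarrow> real^'n^'n"
  assumes h_pos: "h > 0" and g_integrable: "integrable lborel g" and g_neg: "\<And>t. t < 0 \<Longrightarrow> g t = 0"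
begin

lemma g_borel [measurable]: "g \<in> borel_measurable borel"
  using g_integrable by simp

lemma g_lic: "locally_integrable_causal g"
  using g_integrable g_neg by (rule locally_integrable_causal_integrable)

definition delay_op :: "(real \<Rightarrow> real^'n) \<Rightarrow> real \<Rightarrow> real^'n" where
  "delay_op y s = A0 *v y s + B *v y (s - h) + vconv g y s"

definition delay_op_matrix :: "(real \<Rightarrow> real^'n^'n) \<Rightarrow> real \<Rightarrow> real^'n^'n" where
  "delay_op_matrix Y s = A0 ** Y s + B ** Y (s - h) + mconv g Y s"

text \<open>
  The integrated equation on the half line with initial value \<open>v\<close>.  The history is not part of \<open>x\<close>, which is
  zero before time \<open>0\<close>; it enters through the forcing term \<open>f\<close>.
\<close>

definition mild_solution :: "real^'n \<Rightarrow> (real \<Rightarrow> real^'n) \<Rightarrow> (real \<Rightarrow> real^'n) \<Rightarrow> bool" where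
  "mild_solution v f x \<longleftrightarrow> locally_bounded_causal x \<and>
     (\<forall>t. x t = heaviside t *v v + vconv heaviside (\<lambda>s. delay_op x s + f s) t)"

definition fundamental_matrix :: "(real \<Rightarrow> real^'n^'n) \<Rightarrow> bool" where
  "fundamental_matrix K \<longleftrightarrow> locally_bounded_causal K \<and>
     (\<forall>t. K t = heaviside t + mconv heaviside (delay_op_matrix K) t)"

lemma locally_bounded_causal_delay_op: "locally_bounded_causal y \<Longrightarrow> locally_bounded_causal (delay_op y)"
  unfolding delay_op_def[abs_def] using h_pos
  by (intro locally_bounded_causal_add locally_bounded_causal_vector_left locally_bounded_causal_vconv g_lic
      locally_bounded_causal_shift) auto

lemma locally_bounded_causal_delay_op_matrix: "locally_bounded_causal Y \<Longrightarrow> locally_bounded_causal (delay_op_matrix Y)"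
  unfolding delay_op_matrix_def[abs_def] using h_pos
  by (intro locally_bounded_causal_add locally_bounded_causal_matrix_left locally_bounded_causal_mconv g_lic
      locally_bounded_causal_shift) auto

lemma delay_op_add:
  assumes "locally_bounded_causal x" "locally_bounded_causal y"
  shows "delay_op (\<lambda>s. x s + y s) t = delay_op x t + delay_op y t"
  using assms by (simp add: delay_op_def matrix_vector_right_distrib vconv_add_right g_lic algebra_simps)

lemma delay_op_apply:
  assumes "locally_bounded_causal K"
  shows "delay_op (\<lambda>s. K s *v v) t = delay_op_matrix K t *v v"
  using assms by (simp add: delay_op_def delay_op_matrix_def mconv_apply g_lic matrix_vector_mul_assoc
      matrix_vector_mult_add_rdistrib)

lemma delay_op_vconv:
  assumes K: "locally_bounded_causal K" and f: "locally_bounded_causal f"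
  shows "delay_op (vconv K f) t = vconv (delay_op_matrix K) f t"
proof -
  have lbc: "locally_bounded_causal (\<lambda>s. A0 ** K s)" "locally_bounded_causal (\<lambda>s. B ** K (s - h))"
    "locally_bounded_causal (mconv g K)"
    using K h_pos by (auto intro: locally_bounded_causal_matrix_left locally_bounded_causal_shift locally_bounded_causal_mconv g_lic)
  have shift: "vconv K f (t - h) = vconv (\<lambda>s. K (s - h)) f t"
    by (simp add: conv_def algebra_simps)
  have "vconv (delay_op_matrix K) f t
      = vconv (\<lambda>s. A0 ** K s) f t + vconv (\<lambda>s. B ** K (s - h)) f t + vconv (mconv g K) f t"
    unfolding delay_op_matrix_def[abs_def] using lbc f
    by (simp add: vconv_add_left locally_bounded_causal_add)
  then show ?thesis
    using K f h_pos
    by (simp add: delay_op_def shift matrix_vconv vconv_assoc g_lic locally_bounded_causal_shift)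
qed

lemma norm_delay_op_le:
  assumes y: "locally_bounded_causal y" and S: "S \<ge> 0" "a \<ge> 0"
    and bound: "\<And>s. s \<in> {0..t} \<Longrightarrow> norm (y s) \<le> S * exp (a * s)"
  shows "norm (delay_op y t) \<le> (norm A0 + norm B + (LINT s|lborel. norm (g s))) * (S * exp (a * t))"
proof -
  have le: "norm (y s) \<le> S * exp (a * t)" if "s \<le> t" for s
  proof (cases "s < 0")
    case False
    then have "norm (y s) \<le> S * exp (a * s)" using bound that by auto
    also have "\<dots> \<le> S * exp (a * t)" using S that by (intro mult_left_mono) (auto intro: mult_left_mono)
    finally show ?thesis .
  qed (use S locally_bounded_causal_neg[OF y, of s] in simp)
  have g_refl: "integrable lborel (\<lambda>s. norm (g (t - s)))"
    using lborel_integrable_real_affine[OF g_integrable, of "-1" t] by (intro integrable_norm) simp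
  have "norm (vconv g y t) \<le> (LINT s|lborel. norm (g (t - s)) * (S * exp (a * t)))"
    unfolding conv_def
  proof (rule order_trans[OF integral_norm_bound integral_mono])
    show "integrable lborel (\<lambda>s. norm (g (t - s) *v y s))"
      by (intro integrable_norm integrable_vconv g_lic y)
    show "integrable lborel (\<lambda>s. norm (g (t - s)) * (S * exp (a * t)))"
      by (intro integrable_mult_left g_refl)
    fix s
    show "norm (g (t - s) *v y s) \<le> norm (g (t - s)) * (S * exp (a * t))"
    proof (cases "s \<le> t")
      case True
      then show ?thesis
        by (intro order_trans[OF norm_matrix_vector_mult_le] mult_left_mono le) auto
    qed (simp add: g_neg)
  qed
  also have "\<dots> = (LINT s|lborel. norm (g (t - s))) * (S * exp (a * t))"
    by (rule integral_mult_left_zero)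
  also have "(LINT s|lborel. norm (g (t - s))) = (LINT s|lborel. norm (g s))"
    using lborel_integral_real_affine[of "-1" "\<lambda>s. norm (g s)" t] by simp
  finally have 3: "norm (vconv g y t) \<le> (LINT s|lborel. norm (g s)) * (S * exp (a * t))" .
  have 1: "norm (A0 *v y t) \<le> norm A0 * (S * exp (a * t))"
    by (intro order_trans[OF norm_matrix_vector_mult_le] mult_left_mono le) auto
  have 2: "norm (B *v y (t - h)) \<le> norm B * (S * exp (a * t))"
    using h_pos by (intro order_trans[OF norm_matrix_vector_mult_le] mult_left_mono le) auto
  have "norm (delay_op y t) \<le> norm (A0 *v y t) + norm (B *v y (t - h)) + norm (vconv g y t)"
    unfolding delay_op_def by (intro norm_triangle_le add_right_mono norm_triangle_ineq)
  with 1 2 3 show ?thesis by (simp add: distrib_right)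
qed

text \<open>
  The operator \<open>delay_op\<close> looks only into the past, where the exponential weight is smaller, so its
  constant in the Volterra estimate is the sum of the norms of \<open>A0\<close>, \<open>B\<close> and \<open>g\<close>.
\<close>

lemma homogeneous_mild_solution_zero:
  assumes w: "locally_bounded_causal w" and eq: "\<And>t. w t = vconv heaviside (delay_op w) t"
  shows "w t = 0"
proof (cases "t < 0")
  case False
  \<comment> \<open>Adding one keeps the constant positive, as the estimate divides by it.\<close>
  define C where "C = norm A0 + norm B + (LINT s|lborel. norm (g s)) + 1"
  have "0 \<le> (LINT s|lborel. norm (g s))" by (intro integral_nonneg_AE) simp
  then have C: "C > 0"
    unfolding C_def using norm_ge_zero[of A0] norm_ge_zero[of B] by linarith
  obtain M where M: "\<And>s. s \<le> t \<Longrightarrow> norm (w s) \<le> M"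
    using locally_bounded_causalE[OF w, of t] by blast
  show ?thesis
  proof (rule volterra_uniqueness[of t w M C t])
    fix S s assume S: "S \<ge> 0" and s: "s \<in> {0..t}"
      and bound: "\<And>r. r \<in> {0..s} \<Longrightarrow> norm (w r) \<le> S * exp (2 * C * r)"
    have exp_int: "has_bochner_integral lborel (\<lambda>r. exp (2 * C * r) * indicator {0..s} r) (exp (2 * C * s) / (2 * C) - 1 / (2 * C))"
    proof -
      have "((\<lambda>r. exp (2 * C * r) / (2 * C)) has_real_derivative exp (2 * C * r)) (at r)" for r
        using C by (auto intro!: derivative_eq_intros)
      from has_bochner_integral_FTC_Icc_real[OF _ this, of 0 s] show ?thesis
        using s by simp
    qed
    have "norm (w s) \<le> (LINT r|lborel. C * S * (exp (2 * C * r) * indicator {0..s} r))"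
      unfolding eq[of s] conv_def
    proof (rule order_trans[OF integral_norm_bound integral_mono])
      show "integrable lborel (\<lambda>r. norm (heaviside (s - r) *v delay_op w r))"
        by (intro integrable_norm integrable_vconv locally_bounded_causal_locally_integrable
            locally_bounded_causal_heaviside locally_bounded_causal_delay_op w)
      show "integrable lborel (\<lambda>r. C * S * (exp (2 * C * r) * indicator {0..s} r))"
        using exp_int by (intro integrable_mult_right) (auto simp: has_bochner_integral_iff)
      fix r
      show "norm (heaviside (s - r) *v delay_op w r) \<le> C * S * (exp (2 * C * r) * indicator {0..s} r)"
      proof (cases "r \<in> {0..s}")
        case True
        have "norm (delay_op w r) \<le> (C - 1) * (S * exp (2 * C * r))"
          using norm_delay_op_le[OF w S, of "2 * C" r] bound True C by (auto simp: C_def)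
        also have "\<dots> \<le> C * (S * exp (2 * C * r))"
          using S by (intro mult_right_mono) auto
        finally show ?thesis using True by (simp add: mult.assoc)
      next
        case False
        then have "heaviside (s - r) *v delay_op w r = 0"
          using locally_bounded_causal_neg[OF locally_bounded_causal_delay_op[OF w], of r] by (cases "r < 0") auto
        then show ?thesis using False by auto
      qed
    qed
    also have "\<dots> = C * S * (exp (2 * C * s) / (2 * C) - 1 / (2 * C))"
      using exp_int by (simp add: has_bochner_integral_iff)
    finally show "norm (w s) \<le> C * (S * ((exp (2 * C * s) - 1) / (2 * C)))"
      by (simp add: diff_divide_distrib mult.assoc)
  qed (use M C False in auto)
qed (use w locally_bounded_causal_neg in auto)

lemma locally_bounded_causal_variation:
  assumes "locally_bounded_causal K" "locally_bounded_causal f"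
  shows "locally_bounded_causal (\<lambda>t. K t *v v + vconv K f t)"
  using assms by (intro locally_bounded_causal_add locally_bounded_causal_apply locally_bounded_causal_vconv
      locally_bounded_causal_locally_integrable)

text \<open>
  The right-hand side satisfies the integrated equation: both \<open>delay_op\<close> and integration act by convolution from
  the left, so they pass through the convolution with \<open>f\<close> from the right and act on \<open>K\<close>, for which the
  equation is known.  The difference to \<open>x\<close> solves the homogeneous equation and vanishes.
\<close>

lemma variation_of_constants:
  assumes K: "fundamental_matrix K" and f: "locally_bounded_causal f" and x: "mild_solution v f x"
  shows "x t = K t *v v + vconv K f t"
proof -
  note lic = locally_bounded_causal_locally_integrable
  have K_lbc: "locally_bounded_causal K"
    and K_eq: "\<And>t. mconv heaviside (delay_op_matrix K) t = K t - heaviside t"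
    using K by (simp_all add: fundamental_matrix_def)
  have x_lbc: "locally_bounded_causal x"
    and x_eq: "\<And>t. x t = heaviside t *v v + vconv heaviside (\<lambda>s. delay_op x s + f s) t"
    using x by (simp_all add: mild_solution_def)
  define y where "y t = K t *v v + vconv K f t" for t
  have y_lbc: "locally_bounded_causal y"
    unfolding y_def[abs_def] by (rule locally_bounded_causal_variation[OF K_lbc f])
  have H: "locally_bounded_causal (heaviside :: real \<Rightarrow> real^'n^'n)"
    by (rule locally_bounded_causal_heaviside)
  have y_eq: "vconv heaviside (delay_op y) t = y t - heaviside t *v v - vconv heaviside f t" for t
  proof -
    have "delay_op y = (\<lambda>s. delay_op_matrix K s *v v + vconv (delay_op_matrix K) f s)"
      unfolding y_def[abs_def]
      by (intro ext) (simp add: delay_op_add delay_op_apply delay_op_vconv K_lbc f locally_bounded_causal_apply locally_bounded_causal_vconv lic)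
    then have "vconv heaviside (delay_op y) t
        = vconv heaviside (\<lambda>s. delay_op_matrix K s *v v) t + vconv heaviside (vconv (delay_op_matrix K) f) t"
      by (simp add: vconv_add_right lic H locally_bounded_causal_apply locally_bounded_causal_delay_op_matrix K_lbc locally_bounded_causal_vconv f)
    also have "\<dots> = mconv heaviside (delay_op_matrix K) t *v v + vconv (mconv heaviside (delay_op_matrix K)) f t"
      by (simp add: mconv_apply vconv_assoc lic H locally_bounded_causal_delay_op_matrix K_lbc f)
    also have "vconv (mconv heaviside (delay_op_matrix K)) f t = vconv K f t - vconv heaviside f t"
      unfolding K_eq[abs_def] conv_def[of _ _ f] using K_lbc H f
      by (simp add: bounded_bilinear.diff_left[OF bounded_bilinear_matrix_vector] integrable_vconv lic)
    finally show ?thesis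
      by (simp add: K_eq y_def[abs_def] bounded_bilinear.diff_left[OF bounded_bilinear_matrix_vector])
  qed
  have "x t - y t = 0"
  proof (rule homogeneous_mild_solution_zero[of "\<lambda>t. x t - y t"])
    have neg: "locally_bounded_causal (\<lambda>t. - y t)"
      using y_lbc by (rule locally_bounded_causal_bounded_linear[OF bounded_linear_minus[OF bounded_linear_ident]])
    show diff: "locally_bounded_causal (\<lambda>t. x t - y t)"
      using locally_bounded_causal_add[OF x_lbc neg] by simp
    fix t
    have "delay_op x s = delay_op (\<lambda>t. x t - y t) s + delay_op y s" for s
      using delay_op_add[OF diff y_lbc, of s] by simp
    then have "vconv heaviside (\<lambda>s. delay_op x s + f s) t
        = vconv heaviside (delay_op (\<lambda>t. x t - y t)) t + vconv heaviside (delay_op y) t + vconv heaviside f t"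
      by (simp add: vconv_add_right lic H locally_bounded_causal_delay_op diff y_lbc f locally_bounded_causal_add)
    then show "x t - y t = vconv heaviside (delay_op (\<lambda>t. x t - y t)) t"
      using x_eq[of t] y_eq[of t] by simp
  qed
  then show ?thesis by (simp add: y_def)
qed

section \<open>Kernels of the state and of linear outputs\<close>

text \<open>
  The contribution of the history to the right-hand side of the delay equation at time \<open>t\<close>.
\<close>

definition initial_forcing :: "(real \<Rightarrow> real^'n) \<Rightarrow> real \<Rightarrow> real^'n" where
  "initial_forcing \<Phi> t = indicator {0..} t *\<^sub>R (B *v \<Phi> (t - h) + vconv g \<Phi> t)"

definition initial_segment :: "(real \<Rightarrow> real^'n) \<Rightarrow> bool" where
  "initial_segment \<Phi> \<longleftrightarrow> \<Phi> \<in> borel_measurable borel \<and> (\<exists>c. \<forall>\<theta>. norm (\<Phi> \<theta>) \<le> c) \<and> (\<forall>\<theta>. \<theta> \<notin> {-h..0} \<longrightarrow> \<Phi> \<theta> = 0)"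

definition delayed_gain :: "real \<Rightarrow> real \<Rightarrow> real^'n^'n" where
  "delayed_gain s \<theta> = indicator {0..} s *\<^sub>R indicator {-h..0} \<theta> *\<^sub>R g (s - \<theta>)"

text \<open>
  The kernel of the Cauchy formula, i.e. the effect at time \<open>t\<close> of the value of the history at \<open>\<theta>\<close>: it enters
  through the point delay at time \<open>h + \<theta>\<close>, and through the distributed delay at each time \<open>s \<ge> 0\<close> with the gain
  \<open>g (s - \<theta>)\<close>.
\<close>

definition state_kernel :: "(real \<Rightarrow> real^'n^'n) \<Rightarrow> real \<Rightarrow> real \<Rightarrow> real^'n^'n" where
  "state_kernel K t \<theta> = indicator {-h..0} \<theta> *\<^sub>R (K (t - h - \<theta>) ** B)
     + (LINT s|lborel. K (t - s) ** delayed_gain s \<theta>)"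

lemma integrable_conv_initial:
  fixes f :: "real \<Rightarrow> real^'n^'m"
  assumes "integrable lborel f" "initial_segment \<Phi>"
  shows "integrable lborel (\<lambda>s. f (t - s) *v \<Phi> s)"
proof -
  obtain c where "\<And>\<theta>. norm (\<Phi> \<theta>) \<le> c"
    using assms(2) by (auto simp: initial_segment_def)
  moreover have "integrable lborel (\<lambda>s. f (t - s))"
    using lborel_integrable_real_affine[OF assms(1), of "-1" t] by simp
  ultimately show ?thesis
    using assms(2) by (intro integrable_matrix_vector_bounded) (auto simp: initial_segment_def)
qed

text \<open>
  A convolution of an integrable function with a bounded one is bounded.
\<close>

lemma locally_bounded_causal_initial_forcing:
  assumes \<Phi>: "initial_segment \<Phi>"
  shows "locally_bounded_causal (initial_forcing \<Phi>)"
proof -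
  obtain c where c: "\<And>\<theta>. norm (\<Phi> \<theta>) \<le> c"
    using \<Phi> by (auto simp: initial_segment_def)
  have c0: "c \<ge> 0" using c norm_ge_zero order_trans by blast
  have [measurable]: "\<Phi> \<in> borel_measurable borel"
    using \<Phi> by (simp add: initial_segment_def)
  have g_refl: "integrable lborel (\<lambda>s. norm (g (t - s)))" for t
    using lborel_integrable_real_affine[OF g_integrable, of "-1" t] by (intro integrable_norm) simp
  have conv_le: "norm (vconv g \<Phi> t) \<le> (LINT s|lborel. norm (g s)) * c" for t
  proof -
    have "norm (vconv g \<Phi> t) \<le> (LINT s|lborel. norm (g (t - s)) * c)"
      unfolding conv_def
      by (rule order_trans[OF integral_norm_bound integral_mono])
        (auto intro!: integrable_norm integrable_conv_initial g_integrable \<Phi> integrable_mult_left g_refl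
          order_trans[OF norm_matrix_vector_mult_le] mult_left_mono c)
    also have "\<dots> = (LINT s|lborel. norm (g (t - s))) * c"
      by (rule integral_mult_left_zero)
    also have "(LINT s|lborel. norm (g (t - s))) = (LINT s|lborel. norm (g s))"
      using lborel_integral_real_affine[of "-1" "\<lambda>s. norm (g s)" t] by simp
    finally show ?thesis .
  qed
  have g_nonneg: "0 \<le> (LINT s|lborel. norm (g s))" by (intro integral_nonneg_AE) simp
  show ?thesis
  proof (rule locally_bounded_causal_bound[of _ "norm B * c + (LINT s|lborel. norm (g s)) * c"])
    fix t
    have "norm (B *v \<Phi> (t - h) + vconv g \<Phi> t) \<le> norm B * c + (LINT s|lborel. norm (g s)) * c"
      by (intro norm_triangle_le add_mono conv_le order_trans[OF norm_matrix_vector_mult_le] mult_left_mono c) simp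
    moreover have "0 \<le> norm B * c + (LINT s|lborel. norm (g s)) * c"
      using c0 g_nonneg by simp
    ultimately show "norm (initial_forcing \<Phi> t) \<le> norm B * c + (LINT s|lborel. norm (g s)) * c"
      by (simp add: initial_forcing_def indicator_def)
  next
    show "initial_forcing \<Phi> \<in> borel_measurable borel"
      unfolding initial_forcing_def[abs_def] conv_def by measurable
  qed (simp add: initial_forcing_def)
qed

lemma delayed_gain_borel [measurable]: "case_prod delayed_gain \<in> borel_measurable (borel \<Otimes>\<^sub>M borel)"
  unfolding delayed_gain_def by measurable

lemma nn_integral_kernel_mass_delayed_gain: "(\<integral>\<^sup>+s. kernel_mass delayed_gain s \<partial>lborel) < \<infinity>"
proof -
  have "(\<integral>\<^sup>+s. kernel_mass delayed_gain s \<partial>lborel)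
      \<le> (\<integral>\<^sup>+s. \<integral>\<^sup>+\<theta>. indicator {-h..0} \<theta> * ennreal (norm (g (s - \<theta>))) \<partial>lborel \<partial>lborel)"
    unfolding kernel_mass_def by (intro nn_integral_mono) (simp add: delayed_gain_def indicator_def)
  also have "\<dots> = (\<integral>\<^sup>+\<theta>. \<integral>\<^sup>+s. indicator {-h..0} \<theta> * ennreal (norm (g (s - \<theta>))) \<partial>lborel \<partial>lborel)"
    by (rule lborel_pair.Fubini') measurable
  also have "\<dots> = emeasure lborel {-h..0} * (\<integral>\<^sup>+s. norm (g s) \<partial>lborel)"
    by (simp add: nn_integral_cmult nn_integral_multc nn_integral_translate[of "\<lambda>s. ennreal (norm (g s))"])
  also have "\<dots> < \<infinity>"
    using g_integrable h_pos by (simp add: integrable_iff_bounded ennreal_mult_less_top emeasure_lborel_Icc_eq)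
  finally show ?thesis .
qed

text \<open>
  The forcing consists of a point delay and a distributed delay.  In the first part the kernel results from a shift of
  variables, in the second one from Fubini's theorem; both are square integrable by Young's inequality, with
  \<open>K\<close> as the square integrable factor.
\<close>

lemma
  assumes K: "fundamental_matrix K" and K_L2: "(\<integral>\<^sup>+t. (ennreal (norm (K t)))\<^sup>2 \<partial>lborel) < \<infinity>"
  shows square_integrable_state_kernel: "square_integrable_kernel (state_kernel K)"
    and state_kernel_representation: "initial_segment \<Phi> \<Longrightarrow> mild_solution v (initial_forcing \<Phi>) x \<Longrightarrow>
      AE t in lborel. x t = K t *v v + (LINT \<theta>|lborel. state_kernel K t \<theta> *v \<Phi> \<theta>)"
proof -
  have K_lbc: "locally_bounded_causal K" using K by (simp add: fundamental_matrix_def)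
  then have [measurable]: "K \<in> borel_measurable borel" by (rule locally_bounded_causal_borel)
  define K1 where "K1 t \<theta> = indicator {-h..0} \<theta> *\<^sub>R (K (t - h - \<theta>) ** B)" for t \<theta> :: real
  define K2 where "K2 t \<theta> = (LINT s|lborel. K (t - s) ** delayed_gain s \<theta>)" for t \<theta> :: real
  have split: "state_kernel K = (\<lambda>t \<theta>. K1 t \<theta> + K2 t \<theta>)"
    by (simp add: state_kernel_def[abs_def] K1_def K2_def)
  have K1: "square_integrable_kernel K1"
  proof (rule square_integrable_kernel_bound)
    show "case_prod K1 \<in> borel_measurable (borel \<Otimes>\<^sub>M borel)"
      unfolding K1_def by measurable
    let ?m = "\<lambda>t. norm B * (\<integral>\<^sup>+s. indicator {0..h} (t - s) * ennreal (norm (K s)) \<partial>lborel)"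
    have "(\<integral>\<^sup>+t. (\<integral>\<^sup>+s. indicator {0..h} (t - s) * ennreal (norm (K s)) \<partial>lborel)\<^sup>2 \<partial>lborel) < \<infinity>"
      using h_pos K_L2 by (intro young_L1_L2[of "indicator {0..h}"]) (simp_all add: emeasure_lborel_Icc_eq)
    then show "(\<integral>\<^sup>+t. (?m t)\<^sup>2 \<partial>lborel) < \<infinity>"
      by (simp add: power_mult_distrib nn_integral_cmult ennreal_mult_less_top ennreal_power)
    fix t
    have "kernel_mass K1 t \<le> (\<integral>\<^sup>+\<theta>. norm B * (indicator {-h..0} \<theta> * ennreal (norm (K (t - h - \<theta>)))) \<partial>lborel)"
      unfolding kernel_mass_def K1_def
      by (intro nn_integral_mono)
        (simp add: indicator_def norm_matrix_matrix_mult_le mult.commute[of "norm B"] flip: ennreal_mult)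
    also have "\<dots> = norm B * (\<integral>\<^sup>+\<theta>. indicator {-h..0} \<theta> * ennreal (norm (K (t - h - \<theta>))) \<partial>lborel)"
      by (simp add: nn_integral_cmult)
    also have "(\<integral>\<^sup>+\<theta>. indicator {-h..0} \<theta> * ennreal (norm (K (t - h - \<theta>))) \<partial>lborel)
        = (\<integral>\<^sup>+s. indicator {0..h} (t - s) * ennreal (norm (K s)) \<partial>lborel)"
      by (subst nn_integral_reflect_translate[symmetric, of _ "t - h"])
        (auto intro!: nn_integral_cong simp: indicator_def algebra_simps)
    finally show "kernel_mass K1 t \<le> ?m t" .
  qed
  have fin: "(\<integral>\<^sup>+t. (\<integral>\<^sup>+s. norm (K (t - s)) * kernel_mass delayed_gain s \<partial>lborel)\<^sup>2 \<partial>lborel) < \<infinity>"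
  proof -
    have "(\<integral>\<^sup>+s. norm (K (t - s)) * kernel_mass delayed_gain s \<partial>lborel)
        = (\<integral>\<^sup>+s. kernel_mass delayed_gain (t - s) * ennreal (norm (K s)) \<partial>lborel)" for t
      by (subst nn_integral_convolution_commute) (simp_all add: mult.commute)
    then show ?thesis
      using young_L1_L2[of "kernel_mass delayed_gain" "\<lambda>s. ennreal (norm (K s))"] K_L2
        nn_integral_kernel_mass_delayed_gain by simp
  qed
  have K2: "square_integrable_kernel K2"
    unfolding K2_def by (rule square_integrable_kernel_compose[OF _ delayed_gain_borel fin]) measurable
  show "square_integrable_kernel (state_kernel K)"
    unfolding split by (intro square_integrable_kernel_add K1 K2)
  assume \<Phi>: "initial_segment \<Phi>" and x: "mild_solution v (initial_forcing \<Phi>) x"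
  have [measurable]: "\<Phi> \<in> borel_measurable borel" and \<Phi>_zero: "\<And>\<theta>. \<theta> \<notin> {-h..0} \<Longrightarrow> \<Phi> \<theta> = 0"
    using \<Phi> by (auto simp: initial_segment_def)
  obtain c where c: "\<And>\<theta>. norm (\<Phi> \<theta>) \<le> c"
    using \<Phi> by (auto simp: initial_segment_def)
  define f1 where "f1 t = indicator {0..} t *\<^sub>R (B *v \<Phi> (t - h))" for t :: real
  define f2 where "f2 t = indicator {0..} t *\<^sub>R vconv g \<Phi> t" for t :: real
  have f_split: "initial_forcing \<Phi> = (\<lambda>t. f1 t + f2 t)"
    by (auto simp: initial_forcing_def f1_def f2_def scaleR_add_right)
  have f1: "locally_bounded_causal f1"
  proof (rule locally_bounded_causal_bound[of _ "norm B * c"])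
    fix t
    have "0 \<le> norm B * c" using order_trans[OF norm_ge_zero c] by simp
    moreover have "norm (B *v \<Phi> (t - h)) \<le> norm B * c"
      by (rule order_trans[OF norm_matrix_vector_mult_le mult_left_mono[OF c norm_ge_zero]])
    ultimately show "norm (f1 t) \<le> norm B * c"
      by (simp add: f1_def indicator_def)
  qed (auto simp: f1_def[abs_def])
  have "locally_bounded_causal (\<lambda>t. - f1 t)"
    using f1 by (rule locally_bounded_causal_bounded_linear[OF bounded_linear_minus[OF bounded_linear_ident]])
  from locally_bounded_causal_add[OF locally_bounded_causal_initial_forcing[OF \<Phi>] this]
  have f2: "locally_bounded_causal f2"
    by (simp add: f_split)
  have x_eq: "x t = K t *v v + (vconv K f1 t + vconv K f2 t)" for t
    using variation_of_constants[OF K locally_bounded_causal_initial_forcing[OF \<Phi>] x, of t]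
    by (simp add: f_split vconv_add_right f1 f2 K_lbc locally_bounded_causal_locally_integrable)
  have conv1: "vconv K f1 t = (LINT \<theta>|lborel. K1 t \<theta> *v \<Phi> \<theta>)" for t
  proof -
    have "vconv K f1 t = (LINT \<theta>|lborel. K (t - (h + \<theta>)) *v f1 (h + \<theta>))"
      unfolding conv_def using lborel_integral_real_affine[of 1 "\<lambda>s. K (t - s) *v f1 s" h] by simp
    also have "\<dots> = (LINT \<theta>|lborel. K1 t \<theta> *v \<Phi> \<theta>)"
    proof (intro Bochner_Integration.integral_cong refl)
      fix \<theta>
      show "K (t - (h + \<theta>)) *v f1 (h + \<theta>) = K1 t \<theta> *v \<Phi> \<theta>"
        using \<Phi>_zero[of \<theta>] by (cases "\<theta> \<in> {-h..0}")
          (simp_all add: f1_def K1_def indicator_def matrix_vector_mul_assoc diff_diff_eq)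
    qed
    finally show ?thesis .
  qed
  have gain: "(LINT \<theta>|lborel. delayed_gain s \<theta> *v \<Phi> \<theta>) = f2 s" for s
  proof -
    have "delayed_gain s \<theta> *v \<Phi> \<theta> = indicator {0..} s *\<^sub>R (g (s - \<theta>) *v \<Phi> \<theta>)" for \<theta>
      using \<Phi>_zero[of \<theta>] by (cases "\<theta> \<in> {-h..0}") (auto simp: delayed_gain_def indicator_def)
    then show ?thesis by (simp add: f2_def conv_def)
  qed
  have conv2: "AE t in lborel. (LINT \<theta>|lborel. K2 t \<theta> *v \<Phi> \<theta>) = vconv K f2 t"
    using compose_kernel_apply[OF _ delayed_gain_borel fin, of \<Phi> c] c by (simp add: K2_def gain conv_def)
  show "AE t in lborel. x t = K t *v v + (LINT \<theta>|lborel. state_kernel K t \<theta> *v \<Phi> \<theta>)"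
    using conv2 square_integrable_kernel_AE_integrable[OF K1] square_integrable_kernel_AE_integrable[OF K2]
  proof eventually_elim
    case (elim t)
    have "integrable lborel (\<lambda>\<theta>. K1 t \<theta> *v \<Phi> \<theta>)" "integrable lborel (\<lambda>\<theta>. K2 t \<theta> *v \<Phi> \<theta>)"
      using elim by (auto intro!: integrable_matrix_vector_bounded[OF _ _ c])
    then show ?case
      using elim(1) by (simp add: x_eq split conv1 matrix_vector_mult_add_rdistrib)
  qed
qed

definition output_matrix :: "(real \<Rightarrow> real^'n^'n) \<Rightarrow> real^'n^'m \<Rightarrow> (real \<Rightarrow> real^'n^'m) \<Rightarrow> real \<Rightarrow> real^'n^'m" where
  "output_matrix K C \<gamma> t = C ** K t + mconv \<gamma> K t"

definition output_kernel :: "(real \<Rightarrow> real^'n^'n) \<Rightarrow> real^'n^'m \<Rightarrow> (real \<Rightarrow> real^'n^'m) \<Rightarrow> real \<Rightarrow> real \<Rightarrow> real^'n^'m" where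
  "output_kernel K C \<gamma> t \<theta> = C ** state_kernel K t \<theta> + (LINT s|lborel. \<gamma> (t - s) ** state_kernel K s \<theta>)
     + indicator {-h..0} \<theta> *\<^sub>R \<gamma> (t - \<theta>)"

text \<open>
  An instantaneous gain \<open>C\<close> and a distributed gain \<open>\<gamma>\<close> applied to the whole trajectory, which is \<open>\<Phi>\<close> before time
  \<open>0\<close> and \<open>x\<close> afterwards.  Both the state itself and the linear control are of this form.
\<close>

definition measured_output :: "real^'n^'m \<Rightarrow> (real \<Rightarrow> real^'n^'m) \<Rightarrow> (real \<Rightarrow> real^'n) \<Rightarrow> (real \<Rightarrow> real^'n) \<Rightarrow> real \<Rightarrow> real^'m" where
  "measured_output C \<gamma> \<Phi> x t = C *v x t + vconv \<gamma> x t + vconv \<gamma> \<Phi> t"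

text \<open>
  Substitute the representation of the state.  The history also enters directly, through the last term of
  \<open>output_kernel\<close>; for this term the square integrable factor in Young's inequality is the indicator of
  the delay interval.
\<close>

lemma
  fixes C :: "real^'n^'m"
  assumes K: "fundamental_matrix K" and K_L2: "(\<integral>\<^sup>+t. (ennreal (norm (K t)))\<^sup>2 \<partial>lborel) < \<infinity>"
    and \<gamma>: "integrable lborel \<gamma>" and \<gamma>_neg: "\<And>t. t < 0 \<Longrightarrow> \<gamma> t = 0"
  shows output_matrix_square_integrable:
      "output_matrix K C \<gamma> \<in> borel_measurable borel"
      "(\<integral>\<^sup>+t. (ennreal (norm (output_matrix K C \<gamma> t)))\<^sup>2 \<partial>lborel) < \<infinity>"
    and square_integrable_output_kernel: "square_integrable_kernel (output_kernel K C \<gamma>)"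
    and output_representation: "initial_segment \<Phi> \<Longrightarrow> mild_solution v (initial_forcing \<Phi>) x \<Longrightarrow>
      AE t in lborel. measured_output C \<gamma> \<Phi> x t
        = output_matrix K C \<gamma> t *v v + (LINT \<theta>|lborel. output_kernel K C \<gamma> t \<theta> *v \<Phi> \<theta>)"
proof -
  have K_lbc: "locally_bounded_causal K" using K by (simp add: fundamental_matrix_def)
  then have [measurable]: "K \<in> borel_measurable borel" by (rule locally_bounded_causal_borel)
  have [measurable]: "\<gamma> \<in> borel_measurable borel" using \<gamma> by simp
  have \<gamma>_lic: "locally_integrable_causal \<gamma>" using \<gamma> \<gamma>_neg by (rule locally_integrable_causal_integrable)
  have \<gamma>_fin: "(\<integral>\<^sup>+t. norm (\<gamma> t) \<partial>lborel) < \<infinity>" using \<gamma> by (simp add: integrable_iff_bounded)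
  have CK: "locally_bounded_causal (\<lambda>t. C ** K t)" "locally_bounded_causal (mconv \<gamma> K)"
    by (intro locally_bounded_causal_matrix_left K_lbc locally_bounded_causal_mconv \<gamma>_lic)+
  have [measurable]: "mconv \<gamma> K \<in> borel_measurable borel"
    using CK(2) by (rule locally_bounded_causal_borel)
  show "output_matrix K C \<gamma> \<in> borel_measurable borel"
    unfolding output_matrix_def[abs_def] by measurable
  let ?a = "\<lambda>t. ennreal (norm C) * ennreal (norm (K t))"
  let ?b = "\<lambda>t. \<integral>\<^sup>+s. norm (\<gamma> (t - s)) * ennreal (norm (K s)) \<partial>lborel"
  have "(\<integral>\<^sup>+t. (?a t + ?b t)\<^sup>2 \<partial>lborel) < \<infinity>"
  proof (rule nn_integral_sum_squared_finite)
    show "(\<integral>\<^sup>+t. (?a t)\<^sup>2 \<partial>lborel) < \<infinity>"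
      using K_L2 by (simp add: power_mult_distrib nn_integral_cmult ennreal_mult_less_top ennreal_power)
    show "(\<integral>\<^sup>+t. (?b t)\<^sup>2 \<partial>lborel) < \<infinity>"
      using young_L1_L2[of "\<lambda>s. ennreal (norm (\<gamma> s))" "\<lambda>s. ennreal (norm (K s))"] K_L2 \<gamma>_fin by simp
  qed measurable
  moreover have "(ennreal (norm (output_matrix K C \<gamma> t)))\<^sup>2 \<le> (?a t + ?b t)\<^sup>2" for t
  proof (intro power_mono)
    have "ennreal (norm (output_matrix K C \<gamma> t)) \<le> ennreal (norm (C ** K t)) + ennreal (norm (mconv \<gamma> K t))"
      by (simp add: output_matrix_def norm_triangle_ineq flip: ennreal_plus)
    also have "\<dots> \<le> ?a t + ?b t"
    proof (rule add_mono)
      show "ennreal (norm (C ** K t)) \<le> ?a t"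
        by (simp add: norm_matrix_matrix_mult_le flip: ennreal_mult)
      have "ennreal (norm (mconv \<gamma> K t)) \<le> (\<integral>\<^sup>+s. norm (\<gamma> (t - s) ** K s) \<partial>lborel)"
        unfolding conv_def by (rule norm_integral_le_nn_integral)
      also have "\<dots> \<le> ?b t"
        by (intro nn_integral_mono) (simp add: norm_matrix_matrix_mult_le flip: ennreal_mult)
      finally show "ennreal (norm (mconv \<gamma> K t)) \<le> ?b t" .
    qed
    finally show "ennreal (norm (output_matrix K C \<gamma> t)) \<le> ?a t + ?b t" .
  qed simp
  ultimately show "(\<integral>\<^sup>+t. (ennreal (norm (output_matrix K C \<gamma> t)))\<^sup>2 \<partial>lborel) < \<infinity>"
    by (rule le_less_trans[OF nn_integral_mono, rotated])
  define L where "L = state_kernel K"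
  have L: "square_integrable_kernel L"
    unfolding L_def by (rule square_integrable_state_kernel[OF K K_L2])
  then have [measurable]: "case_prod L \<in> borel_measurable (borel \<Otimes>\<^sub>M borel)"
    by (simp add: square_integrable_kernel_def)
  define W1 where "W1 t \<theta> = C ** L t \<theta>" for t \<theta>
  define W2 where "W2 t \<theta> = (LINT s|lborel. \<gamma> (t - s) ** L s \<theta>)" for t \<theta>
  define W3 where "W3 t \<theta> = indicator {-h..0} \<theta> *\<^sub>R \<gamma> (t - \<theta>)" for t \<theta> :: real
  have W_eq: "output_kernel K C \<gamma> = (\<lambda>t \<theta>. W1 t \<theta> + W2 t \<theta> + W3 t \<theta>)"
    by (simp add: output_kernel_def[abs_def] W1_def W2_def W3_def L_def)
  have W1: "square_integrable_kernel W1"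
    unfolding W1_def by (rule square_integrable_kernel_mult_left[OF L])
  have fin: "(\<integral>\<^sup>+t. (\<integral>\<^sup>+s. norm (\<gamma> (t - s)) * kernel_mass L s \<partial>lborel)\<^sup>2 \<partial>lborel) < \<infinity>"
    using young_L1_L2[of "\<lambda>s. ennreal (norm (\<gamma> s))" "kernel_mass L"] \<gamma>_fin L
    by (simp add: square_integrable_kernel_def)
  have W2: "square_integrable_kernel W2"
    unfolding W2_def by (rule square_integrable_kernel_compose[OF _ _ fin]) measurable
  have W3: "square_integrable_kernel W3"
  proof (rule square_integrable_kernel_bound)
    show "case_prod W3 \<in> borel_measurable (borel \<Otimes>\<^sub>M borel)"
      unfolding W3_def by measurable
    have sq: "(indicator {-h..0} s :: ennreal)\<^sup>2 = indicator {-h..0} s" for s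
      by (simp add: indicator_def)
    show "(\<integral>\<^sup>+t. (\<integral>\<^sup>+s. ennreal (norm (\<gamma> (t - s))) * indicator {-h..0} s \<partial>lborel)\<^sup>2 \<partial>lborel) < \<infinity>"
      using h_pos \<gamma>_fin by (intro young_L1_L2[of "\<lambda>s. ennreal (norm (\<gamma> s))"]) (simp_all add: sq emeasure_lborel_Icc_eq)
    show "kernel_mass W3 t \<le> (\<integral>\<^sup>+s. ennreal (norm (\<gamma> (t - s))) * indicator {-h..0} s \<partial>lborel)" for t
      unfolding kernel_mass_def W3_def by (intro nn_integral_mono) (simp add: indicator_def)
  qed
  show "square_integrable_kernel (output_kernel K C \<gamma>)"
    unfolding W_eq by (intro square_integrable_kernel_add W1 W2 W3)
  assume \<Phi>: "initial_segment \<Phi>" and x: "mild_solution v (initial_forcing \<Phi>) x"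
  have x_lbc: "locally_bounded_causal x" using x by (simp add: mild_solution_def)
  have [measurable]: "x \<in> borel_measurable borel" using x_lbc by (rule locally_bounded_causal_borel)
  have [measurable]: "\<Phi> \<in> borel_measurable borel" and \<Phi>_zero: "\<And>\<theta>. \<theta> \<notin> {-h..0} \<Longrightarrow> \<Phi> \<theta> = 0"
    using \<Phi> by (auto simp: initial_segment_def)
  obtain c where c: "\<And>\<theta>. norm (\<Phi> \<theta>) \<le> c"
    using \<Phi> by (auto simp: initial_segment_def)
  define b where "b s = (LINT \<theta>|lborel. L s \<theta> *v \<Phi> \<theta>)" for s
  have [measurable]: "b \<in> borel_measurable borel"
    unfolding b_def[abs_def] by measurable
  have x_eq: "AE t in lborel. x t = K t *v v + b t"
    unfolding b_def L_def by (rule state_kernel_representation[OF K K_L2 \<Phi> x])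
  \<comment> \<open>The representation of the state holds almost everywhere, which is enough below an integral.\<close>
  have conv_x: "vconv \<gamma> x t = mconv \<gamma> K t *v v + (LINT s|lborel. \<gamma> (t - s) *v b s)" for t
  proof -
    have int: "integrable lborel (\<lambda>s. \<gamma> (t - s) *v x s)" "integrable lborel (\<lambda>s. \<gamma> (t - s) *v (K s *v v))"
      by (intro integrable_vconv \<gamma>_lic x_lbc locally_bounded_causal_apply K_lbc)+
    have "(LINT s|lborel. \<gamma> (t - s) *v b s) = (LINT s|lborel. \<gamma> (t - s) *v x s - \<gamma> (t - s) *v (K s *v v))"
      by (rule integral_cong_AE)
        (measurable, use x_eq in \<open>eventually_elim, simp add: matrix_vector_right_distrib\<close>)
    also have "\<dots> = vconv \<gamma> x t - vconv \<gamma> (\<lambda>s. K s *v v) t"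
      using int by (simp add: conv_def)
    finally show ?thesis
      by (simp add: mconv_apply \<gamma>_lic K_lbc)
  qed
  have conv2: "AE t in lborel. (LINT \<theta>|lborel. W2 t \<theta> *v \<Phi> \<theta>) = (LINT s|lborel. \<gamma> (t - s) *v b s)"
    using compose_kernel_apply[OF _ _ fin, of \<Phi> c] c by (simp add: W2_def b_def)
  have conv3: "(LINT \<theta>|lborel. W3 t \<theta> *v \<Phi> \<theta>) = vconv \<gamma> \<Phi> t" for t
    unfolding conv_def
  proof (intro Bochner_Integration.integral_cong refl)
    show "W3 t \<theta> *v \<Phi> \<theta> = \<gamma> (t - \<theta>) *v \<Phi> \<theta>" for \<theta>
      using \<Phi>_zero[of \<theta>] by (cases "\<theta> \<in> {-h..0}") (simp_all add: W3_def)
  qed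
  show "AE t in lborel. measured_output C \<gamma> \<Phi> x t
      = output_matrix K C \<gamma> t *v v + (LINT \<theta>|lborel. output_kernel K C \<gamma> t \<theta> *v \<Phi> \<theta>)"
    using x_eq conv2 square_integrable_kernel_AE_integrable[OF L] square_integrable_kernel_AE_integrable[OF W1]
      square_integrable_kernel_AE_integrable[OF W2] square_integrable_kernel_AE_integrable[OF W3]
  proof eventually_elim
    case (elim t)
    have int: "integrable lborel (\<lambda>\<theta>. L t \<theta> *v \<Phi> \<theta>)" "integrable lborel (\<lambda>\<theta>. W1 t \<theta> *v \<Phi> \<theta>)"
        "integrable lborel (\<lambda>\<theta>. W2 t \<theta> *v \<Phi> \<theta>)" "integrable lborel (\<lambda>\<theta>. W3 t \<theta> *v \<Phi> \<theta>)"
      using elim by (auto intro!: integrable_matrix_vector_bounded[OF _ _ c])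
    have "(LINT \<theta>|lborel. W1 t \<theta> *v \<Phi> \<theta>) = C *v b t"
      using int(1) by (simp add: W1_def b_def integral_matrix_vector_right flip: matrix_vector_mul_assoc)
    then have "(LINT \<theta>|lborel. output_kernel K C \<gamma> t \<theta> *v \<Phi> \<theta>)
        = C *v b t + (LINT s|lborel. \<gamma> (t - s) *v b s) + vconv \<gamma> \<Phi> t"
      using int elim(2) by (simp add: W_eq matrix_vector_mult_add_rdistrib conv3)
    then show ?case
      using elim(1) by (simp add: measured_output_def output_matrix_def conv_x matrix_vector_mult_add_rdistrib
          matrix_vector_right_distrib matrix_vector_mul_assoc)
  qed
qed

end

section \<open>Gains and piecewise continuous histories\<close>

lemma completion_ex_borel_measurable_euclidean:
  fixes f :: "'a \<Rightarrow> 'b::euclidean_space"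
  assumes f: "f \<in> borel_measurable (completion M)"
  shows "\<exists>f'\<in>borel_measurable M. AE x in M. f x = f' x"
proof -
  have "\<exists>f'\<in>borel_measurable M. AE x in M. f x \<bullet> b = f' x" for b
    by (rule completion_ex_borel_measurable_real) (use f in measurable)
  then obtain f' where f'[measurable]: "\<And>b. f' b \<in> borel_measurable M"
    and ae: "\<And>b. AE x in M. f x \<bullet> b = f' b x"
    by metis
  have "AE x in M. \<forall>b\<in>Basis. f x \<bullet> b = f' b x"
    using ae by (simp add: AE_finite_all)
  then have "AE x in M. f x = (\<Sum>b\<in>Basis. f' b x *\<^sub>R b)"
  proof eventually_elim
    case (elim x)
    then show ?case
      using euclidean_representation[of "f x"] by simp
  qed
  then show ?thesis
    by (intro bexI[of _ "\<lambda>x. \<Sum>b\<in>Basis. f' b x *\<^sub>R b"]) measurable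
qed

text \<open>
  The passage from a distributed gain on \<open>{-h..0}\<close> to the age \<open>- \<theta>\<close>.  The density agrees with the gain only almost
  everywhere, because it is chosen Borel measurable: the theorems on products of Lebesgue measure require Borel
  measurability, while an absolutely integrable function is merely Lebesgue measurable.
\<close>

definition delay_density :: "real \<Rightarrow> (real \<Rightarrow> 'a::euclidean_space) \<Rightarrow> (real \<Rightarrow> 'a) \<Rightarrow> bool" where
  "delay_density h f \<gamma> \<longleftrightarrow> integrable lborel \<gamma> \<and> (\<forall>t. t \<notin> {0..h} \<longrightarrow> \<gamma> t = 0) \<and>
     (AE \<theta> in lborel. \<theta> \<in> {-h..0} \<longrightarrow> \<gamma> (-\<theta>) = f \<theta>)"

lemma delay_density_exists:
  fixes f :: "real \<Rightarrow> 'a::euclidean_space"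
  assumes f: "f absolutely_integrable_on {-h..0}"
  shows "\<exists>\<gamma>. delay_density h f \<gamma>"
proof -
  let ?F = "\<lambda>\<theta>. indicator {-h..0} \<theta> *\<^sub>R f \<theta>"
  have F: "integrable lebesgue ?F"
    using f by (simp add: set_integrable_def)
  then obtain F' where F'[measurable]: "F' \<in> borel_measurable lborel" and ae: "AE \<theta> in lborel. ?F \<theta> = F' \<theta>"
    using completion_ex_borel_measurable_euclidean[of ?F lborel] by auto
  have "integrable lebesgue F'"
    by (rule integrable_cong_AE_imp[OF F measurable_completion[OF F'] AE_completion[OF ae]])
  then have "integrable lborel F'"
    using F' by (simp add: integrable_completion)
  from lborel_integrable_real_affine[OF this, of "-1" 0]
  have "integrable lborel (\<lambda>t. indicator {0..h} t *\<^sub>R F' (-t))"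
    by (intro integrable_mult_indicator) auto
  moreover have "AE \<theta> in lborel. \<theta> \<in> {-h..0} \<longrightarrow> indicator {0..h} (-\<theta>) *\<^sub>R F' (-(-\<theta>)) = f \<theta>"
    using ae by eventually_elim (auto simp: indicator_def)
  ultimately show ?thesis
    by (intro exI[of _ "\<lambda>t. indicator {0..h} t *\<^sub>R F' (-t)"]) (auto simp: delay_density_def)
qed

text \<open>
  At a discontinuity each one-sided limit, where the side lies in the interval, bounds the function on that side; at every
  other point the function is continuous relative to the interval, as the discontinuities are isolated.
\<close>

lemma PC_locally_bounded:
  fixes f :: "real \<Rightarrow> 'a::real_normed_vector"
  assumes f: "f \<in> PC a b" and p: "p \<in> {a..b}"
  shows "\<exists>M. \<forall>\<^sub>F y in at p within {a..b}. norm (f y) \<le> M"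
proof -
  obtain S where S: "finite S" "S \<subseteq> {a..b}" "continuous_on ({a..b} - S) f"
    and left: "\<And>s. s \<in> S \<Longrightarrow> a < s \<Longrightarrow> \<exists>l. (f \<longlongrightarrow> l) (at_left s)"
    and right: "\<And>s. s \<in> S \<Longrightarrow> s < b \<Longrightarrow> \<exists>l. (f \<longlongrightarrow> l) (at_right s)"
    using f unfolding PC_def by blast
  have lim_bound: "\<exists>M. \<forall>\<^sub>F y in F. norm (f y) \<le> M" if "(f \<longlongrightarrow> l) F" for l and F :: "real filter"
  proof -
    have "((\<lambda>y. norm (f y)) \<longlongrightarrow> norm l) F"
      using that by (rule tendsto_norm)
    then have "\<forall>\<^sub>F y in F. norm (f y) < norm l + 1"
      by (rule order_tendstoD) simp
    then show ?thesis
      by (intro exI[of _ "norm l + 1"]) (auto elim: eventually_mono)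
  qed
  show ?thesis
  proof (cases "p \<in> S")
    case True
    have "\<exists>M. \<forall>\<^sub>F y in at_left p. y \<in> {a..b} \<longrightarrow> norm (f y) \<le> M"
    proof (cases "a < p")
      case True
      then obtain M where "\<forall>\<^sub>F y in at_left p. norm (f y) \<le> M"
        using left[OF \<open>p \<in> S\<close>] lim_bound by blast
      then show ?thesis by (intro exI[of _ M]) (auto elim: eventually_mono)
    next
      case False
      have "\<forall>\<^sub>F y in at_left p. y < p" by (simp add: eventually_at_filter)
      then show ?thesis using False by (intro exI[of _ 0]) (auto elim: eventually_mono)
    qed
    then obtain M where M: "\<forall>\<^sub>F y in at_left p. y \<in> {a..b} \<longrightarrow> norm (f y) \<le> M" by blast
    have "\<exists>M. \<forall>\<^sub>F y in at_right p. y \<in> {a..b} \<longrightarrow> norm (f y) \<le> M"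
    proof (cases "p < b")
      case True
      then obtain M where "\<forall>\<^sub>F y in at_right p. norm (f y) \<le> M"
        using right[OF \<open>p \<in> S\<close>] lim_bound by blast
      then show ?thesis by (intro exI[of _ M]) (auto elim: eventually_mono)
    next
      case False
      have "\<forall>\<^sub>F y in at_right p. y > p" by (simp add: eventually_at_filter)
      then show ?thesis using False by (intro exI[of _ 0]) (auto elim: eventually_mono)
    qed
    then obtain N where N: "\<forall>\<^sub>F y in at_right p. y \<in> {a..b} \<longrightarrow> norm (f y) \<le> N" by blast
    have "\<forall>\<^sub>F y in at p. y \<in> {a..b} \<longrightarrow> norm (f y) \<le> max M N"
      unfolding eventually_at_split
      using M N by (auto elim!: eventually_mono)
    then show ?thesis
      by (intro exI[of _ "max M N"]) (auto simp: eventually_at_filter elim: eventually_mono)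
  next
    case False
    have "open (- S)" using S(1) by (simp add: finite_imp_closed open_Compl)
    then have "at p within {a..b} = at p within ({a..b} - S)"
      using False by (intro at_within_nhd[of p "- S"]) auto
    moreover have "(f \<longlongrightarrow> f p) (at p within ({a..b} - S))"
      using S(3) False p by (auto simp: continuous_on)
    ultimately show ?thesis using lim_bound by metis
  qed
qed

lemma PC_bounded:
  fixes f :: "real \<Rightarrow> 'a::real_normed_vector"
  assumes f: "f \<in> PC a b"
  shows "\<exists>c\<ge>0. \<forall>\<theta>\<in>{a..b}. norm (f \<theta>) \<le> c"
proof -
  have "\<exists>U M. open U \<and> p \<in> U \<and> (\<forall>y\<in>U \<inter> {a..b}. norm (f y) \<le> M)" if p: "p \<in> {a..b}" for p
  proof -
    obtain M where "\<forall>\<^sub>F y in at p within {a..b}. norm (f y) \<le> M"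
      using PC_locally_bounded[OF f p] by blast
    then obtain U where U: "open U" "p \<in> U" "\<forall>y\<in>U. y \<noteq> p \<longrightarrow> y \<in> {a..b} \<longrightarrow> norm (f y) \<le> M"
      unfolding eventually_at_topological by blast
    have "norm (f y) \<le> max M (norm (f p))" if "y \<in> U \<inter> {a..b}" for y
      using U(3) that by (cases "y = p") auto
    with U show ?thesis by blast
  qed
  then obtain U M where U: "\<And>p. p \<in> {a..b} \<Longrightarrow> open (U p)" "\<And>p. p \<in> {a..b} \<Longrightarrow> p \<in> U p"
    and M: "\<And>p y. p \<in> {a..b} \<Longrightarrow> y \<in> U p \<inter> {a..b} \<Longrightarrow> norm (f y) \<le> M p"
    by metis
  obtain P where P: "P \<subseteq> {a..b}" "finite P" "{a..b} \<subseteq> (\<Union>p\<in>P. U p)"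
    by (rule compactE_image[of "{a..b}" "{a..b}" U]) (use U in auto)
  have "norm (f y) \<le> (\<Sum>p\<in>P. \<bar>M p\<bar>)" if y: "y \<in> {a..b}" for y
  proof -
    obtain p where p: "p \<in> P" "y \<in> U p" using P y by blast
    have "norm (f y) \<le> \<bar>M p\<bar>" using M[of p y] p y P by fastforce
    also have "\<dots> \<le> (\<Sum>p\<in>P. \<bar>M p\<bar>)"
      using P(2) p(1) by (intro member_le_sum) auto
    finally show ?thesis .
  qed
  then show ?thesis by (intro exI[of _ "\<Sum>p\<in>P. \<bar>M p\<bar>"]) (auto intro: sum_nonneg)
qed

lemma PC_borel_measurable:
  fixes f :: "real \<Rightarrow> 'a::euclidean_space"
  assumes f: "f \<in> PC a b"
  shows "(\<lambda>\<theta>. indicator {a..<b} \<theta> *\<^sub>R f \<theta>) \<in> borel_measurable borel"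
proof -
  obtain S where S: "finite S" "continuous_on ({a..b} - S) f"
    using f unfolding PC_def by blast
  have "(\<lambda>\<theta>. indicator ({a..b} - S) \<theta> *\<^sub>R f \<theta>) \<in> borel_measurable borel"
    by (rule borel_measurable_continuous_on_indicator[OF _ S(2)])
      (use S(1) in \<open>auto intro: finite_imp_closed borel_closed\<close>)
  then show ?thesis
    by (rule measurable_discrete_difference[where X="insert b S"])
      (use S(1) in \<open>auto simp: indicator_def intro: countable_finite\<close>)
qed

text \<open>
  The constant is the minimum of the quadratic form on the unit sphere.
\<close>

lemma symmetric_pos_def_lower_bound:
  fixes Q :: "real^'n^'n"
  assumes "symmetric_pos_def Q"
  shows "\<exists>c>0. \<forall>v. c * (norm v)\<^sup>2 \<le> v \<bullet> (Q *v v)"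
proof -
  have ne: "sphere (0::real^'n) 1 \<noteq> {}" by simp
  have "continuous_on (sphere 0 1) (\<lambda>v. v \<bullet> (Q *v v))"
    by (intro continuous_intros linear_continuous_on matrix_vector_mul_bounded_linear)
  then obtain u where u: "u \<in> sphere 0 1" and min: "\<And>v. v \<in> sphere 0 1 \<Longrightarrow> u \<bullet> (Q *v u) \<le> v \<bullet> (Q *v v)"
    using continuous_attains_inf[OF compact_sphere ne] by blast
  have "u \<bullet> (Q *v u) * (norm v)\<^sup>2 \<le> v \<bullet> (Q *v v)" for v
  proof (cases "v = 0")
    case False
    let ?w = "inverse (norm v) *\<^sub>R v"
    have "u \<bullet> (Q *v u) \<le> ?w \<bullet> (Q *v ?w)"
      using False by (intro min) simp
    also have "\<dots> = (v \<bullet> (Q *v v)) / (norm v)\<^sup>2"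
      by (simp add: matrix_vector_mult_scaleR power2_eq_square field_simps)
    finally show ?thesis using False by (simp add: field_simps)
  qed simp
  moreover have "u \<bullet> (Q *v u) > 0"
  proof -
    have "u \<noteq> 0" using u by auto
    then show ?thesis using assms by (simp add: symmetric_pos_def_def)
  qed
  ultimately show ?thesis by blast
qed

section \<open>The cost of a linear output\<close>

context delay_system
begin

text \<open>
  The cost only counts times \<open>t \<ge> 0\<close>, whereas the kernel of the output does not vanish for negative times; hence the
  cut-off.
\<close>

lemma output_cost_representation:
  fixes C :: "real^'n^'m" and P :: "real^'m^'m"
  assumes K: "fundamental_matrix K" and K_L2: "(\<integral>\<^sup>+t. (ennreal (norm (K t)))\<^sup>2 \<partial>lborel) < \<infinity>"
    and \<gamma>: "integrable lborel \<gamma>" and \<gamma>_neg: "\<And>t. t < 0 \<Longrightarrow> \<gamma> t = 0"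
    and P: "transpose P = P"
  obtains \<Pi>0 :: "real^'n^'n" and \<Pi>1 :: "real \<Rightarrow> real^'n^'n" and \<Pi>2 :: "real \<Rightarrow> real \<Rightarrow> real^'n^'n"
  where "transpose \<Pi>0 = \<Pi>0" "integrable lborel \<Pi>1"
    "integrable (lborel \<Otimes>\<^sub>M lborel) (\<lambda>(\<xi>, \<theta>). \<Pi>2 \<xi> \<theta>)"
    "\<And>\<xi> \<theta>. transpose (\<Pi>2 \<xi> \<theta>) = \<Pi>2 \<theta> \<xi>"
    "\<And>v \<Phi> x. initial_segment \<Phi> \<Longrightarrow> mild_solution v (initial_forcing \<Phi>) x \<Longrightarrow>
      integrable lborel (\<lambda>t. indicator {0..} t * (measured_output C \<gamma> \<Phi> x t \<bullet> (P *v measured_output C \<gamma> \<Phi> x t))) \<and>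
      (LINT t|lborel. indicator {0..} t * (measured_output C \<gamma> \<Phi> x t \<bullet> (P *v measured_output C \<gamma> \<Phi> x t)))
        = v \<bullet> (\<Pi>0 *v v) + 2 * (v \<bullet> (LINT \<theta>|lborel. \<Pi>1 \<theta> *v \<Phi> \<theta>))
        + (LINT (\<xi>, \<theta>)|(lborel \<Otimes>\<^sub>M lborel). \<Phi> \<xi> \<bullet> (\<Pi>2 \<xi> \<theta> *v \<Phi> \<theta>))"
proof -
  define I where "I = (indicator {0..} :: real \<Rightarrow> real)"
  define Z where "Z t = I t *\<^sub>R output_matrix K C \<gamma> t" for t
  define W where "W t \<theta> = I t *\<^sub>R output_kernel K C \<gamma> t \<theta>" for t \<theta>
  note out = output_matrix_square_integrable[OF K K_L2 \<gamma> \<gamma>_neg] square_integrable_output_kernel[OF K K_L2 \<gamma> \<gamma>_neg]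
  have [measurable]: "output_matrix K C \<gamma> \<in> borel_measurable borel" by (rule out(1))
  have Z: "Z \<in> borel_measurable borel"
    unfolding Z_def[abs_def] I_def by measurable
  have "(\<integral>\<^sup>+t. (ennreal (norm (Z t)))\<^sup>2 \<partial>lborel) \<le> (\<integral>\<^sup>+t. (ennreal (norm (output_matrix K C \<gamma> t)))\<^sup>2 \<partial>lborel)"
    by (intro nn_integral_mono power_mono) (simp_all add: Z_def I_def indicator_def)
  then have Z2: "(\<integral>\<^sup>+t. (ennreal (norm (Z t)))\<^sup>2 \<partial>lborel) < \<infinity>"
    using out(2) by (rule le_less_trans)
  have W: "square_integrable_kernel W"
    unfolding W_def I_def by (rule square_integrable_kernel_restrict[OF out(3) borel_closed[OF closed_atLeast]])
  show thesis
  proof (rule quadratic_functional_representation[OF P Z Z2 W])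
    fix \<Pi>0 :: "real^'n^'n" and \<Pi>1 :: "real \<Rightarrow> real^'n^'n" and \<Pi>2 :: "real \<Rightarrow> real \<Rightarrow> real^'n^'n"
    assume rep: "transpose \<Pi>0 = \<Pi>0" "integrable lborel \<Pi>1"
      "integrable (lborel \<Otimes>\<^sub>M lborel) (\<lambda>(\<xi>, \<theta>). \<Pi>2 \<xi> \<theta>)"
      "\<And>\<xi> \<theta>. transpose (\<Pi>2 \<xi> \<theta>) = \<Pi>2 \<theta> \<xi>"
      and form: "\<And>v \<Phi> c z. \<Phi> \<in> borel_measurable borel \<Longrightarrow> (\<And>\<theta>. norm (\<Phi> \<theta>) \<le> c) \<Longrightarrow> z \<in> borel_measurable borel \<Longrightarrow>
      (AE t in lborel. z t = Z t *v v + (LINT \<theta>|lborel. W t \<theta> *v \<Phi> \<theta>)) \<Longrightarrow>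
      integrable lborel (\<lambda>t. z t \<bullet> (P *v z t)) \<and>
      (LINT t|lborel. z t \<bullet> (P *v z t)) = v \<bullet> (\<Pi>0 *v v) + 2 * (v \<bullet> (LINT \<theta>|lborel. \<Pi>1 \<theta> *v \<Phi> \<theta>))
        + (LINT (\<xi>, \<theta>)|(lborel \<Otimes>\<^sub>M lborel). \<Phi> \<xi> \<bullet> (\<Pi>2 \<xi> \<theta> *v \<Phi> \<theta>))"
    show thesis
    proof (rule that[OF rep])
      fix v \<Phi> x
      assume \<Phi>: "initial_segment \<Phi>" and x: "mild_solution v (initial_forcing \<Phi>) x"
      have [measurable]: "\<Phi> \<in> borel_measurable borel" using \<Phi> by (simp add: initial_segment_def)
      obtain c where c: "\<And>\<theta>. norm (\<Phi> \<theta>) \<le> c" using \<Phi> by (auto simp: initial_segment_def)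
      have [measurable]: "x \<in> borel_measurable borel"
        using x unfolding mild_solution_def by (blast intro: locally_bounded_causal_borel)
      have [measurable]: "\<gamma> \<in> borel_measurable borel" using \<gamma> by simp
      let ?y = "measured_output C \<gamma> \<Phi> x"
      define z where "z t = I t *\<^sub>R ?y t" for t
      have z: "z \<in> borel_measurable borel"
        unfolding z_def[abs_def] I_def measured_output_def conv_def by measurable
      have rep_y: "AE t in lborel. ?y t = output_matrix K C \<gamma> t *v v + (LINT \<theta>|lborel. output_kernel K C \<gamma> t \<theta> *v \<Phi> \<theta>)"
        by (rule output_representation[OF K K_L2 \<gamma> _ \<Phi> x]) (rule \<gamma>_neg)
      have z_eq: "AE t in lborel. z t = Z t *v v + (LINT \<theta>|lborel. W t \<theta> *v \<Phi> \<theta>)"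
        using rep_y
      proof eventually_elim
        case (elim t)
        then show ?case
          by (simp add: z_def Z_def W_def scaleR_matrix_vector_assoc[symmetric] scaleR_add_right)
      qed
      have "z t \<bullet> (P *v z t) = indicator {0..} t * (?y t \<bullet> (P *v ?y t))" for t
        by (simp add: z_def I_def indicator_def)
      with form[OF _ c z z_eq]
      show "integrable lborel (\<lambda>t. indicator {0..} t * (?y t \<bullet> (P *v ?y t))) \<and>
        (LINT t|lborel. indicator {0..} t * (?y t \<bullet> (P *v ?y t)))
          = v \<bullet> (\<Pi>0 *v v) + 2 * (v \<bullet> (LINT \<theta>|lborel. \<Pi>1 \<theta> *v \<Phi> \<theta>))
          + (LINT (\<xi>, \<theta>)|(lborel \<Otimes>\<^sub>M lborel). \<Phi> \<xi> \<bullet> (\<Pi>2 \<xi> \<theta> *v \<Phi> \<theta>))"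
        by simp
    qed
  qed
qed

end

section \<open>The closed-loop system as a delay system\<close>

text \<open>
  A trajectory is split at time \<open>0\<close> into its causal part and its history.  The time \<open>0\<close> belongs to the causal part,
  since the value there is the initial value of the differential equation.
\<close>

definition causal_part :: "(real \<Rightarrow> 'a::real_vector) \<Rightarrow> real \<Rightarrow> 'a" where
  "causal_part x t = indicator {0..} t *\<^sub>R x t"

definition initial_part :: "real \<Rightarrow> (real \<Rightarrow> 'a::real_vector) \<Rightarrow> real \<Rightarrow> 'a" where
  "initial_part h \<phi> t = indicator {-h..<0} t *\<^sub>R \<phi> t"

text \<open>
  The link between the two integrals: Bochner integrals over the line allow Fubini's theorem, and this lemma returns to
  gauge integrals over an interval, with freedom on null sets.
\<close>

lemma lborel_integral_has_integral_on:
  fixes f g :: "real \<Rightarrow> 'a::euclidean_space"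
  assumes f: "integrable lborel f" and zero: "\<And>x. x \<notin> S \<Longrightarrow> f x = 0"
    and ae: "AE x in lborel. x \<in> S \<longrightarrow> f x = g x"
  shows "(g has_integral (LINT x|lborel. f x)) S"
proof -
  have "(f has_integral (LINT x|lborel. f x)) UNIV"
    by (rule has_integral_integral_lborel[OF f])
  moreover have "f = (\<lambda>x. if x \<in> S then f x else 0)" using zero by auto
  ultimately have "(f has_integral (LINT x|lborel. f x)) S"
    using has_integral_restrict_UNIV[of S f] by simp
  then show ?thesis using has_integral_AE[OF ae] by simp
qed

lemma locally_bounded_causal_part:
  fixes x :: "real \<Rightarrow> 'a::euclidean_space"
  assumes x: "continuous_on {0..} x"
  shows "locally_bounded_causal (causal_part x)"
  unfolding locally_bounded_causal_def
proof (intro conjI allI impI)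
  show "causal_part x \<in> borel_measurable borel"
    unfolding causal_part_def[abs_def]
    by (rule borel_measurable_continuous_on_indicator[OF borel_closed[OF closed_atLeast] x])
  show "causal_part x t = 0" if "t < 0" for t
    using that by (simp add: causal_part_def)
  fix T
  have "compact (x ` {0..T})"
    by (intro compact_continuous_image continuous_on_subset[OF x]) auto
  then obtain M where M: "\<And>t. t \<in> {0..T} \<Longrightarrow> norm (x t) \<le> M"
    by (metis bounded_iff compact_imp_bounded imageI)
  then have "norm (causal_part x t) \<le> \<bar>M\<bar>" if "t \<le> T" for t
    using order_trans[OF M abs_ge_self, of t] that by (auto simp: causal_part_def indicator_def)
  then show "\<exists>M. \<forall>t\<le>T. norm (causal_part x t) \<le> M" by blast
qed

lemma (in delay_system) initial_segment_initial_part: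
  assumes \<phi>: "\<phi> \<in> PC (-h) 0"
  shows "initial_segment (initial_part h \<phi>)"
  unfolding initial_segment_def
proof (intro conjI allI impI)
  show "initial_part h \<phi> \<in> borel_measurable borel"
    unfolding initial_part_def[abs_def] by (rule PC_borel_measurable[OF \<phi>])
  obtain c where "c \<ge> 0" "\<forall>\<theta>\<in>{-h..0}. norm (\<phi> \<theta>) \<le> c"
    using PC_bounded[OF \<phi>] by blast
  then show "\<exists>c. \<forall>\<theta>. norm (initial_part h \<phi> \<theta>) \<le> c"
    by (intro exI[of _ c]) (auto simp: initial_part_def indicator_def)
qed (auto simp: initial_part_def)

text \<open>
  Substituting \<open>r = s + \<theta>\<close> turns the integral over the state into a convolution with the density, and the range of
  integration meets both the causal part and the history.
\<close>

lemma (in delay_system) distributed_delay_integral: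
  fixes f :: "real \<Rightarrow> real^'n^'m"
  assumes \<gamma>: "delay_density h f \<gamma>" and \<phi>: "\<phi> \<in> PC (-h) 0" and x: "continuous_on {0..} x"
    and x_\<phi>: "\<And>\<theta>. \<theta> \<in> {-h..0} \<Longrightarrow> x \<theta> = \<phi> \<theta>" and s: "s \<ge> 0"
  shows "integral {-h..0} (\<lambda>\<theta>. f \<theta> *v x (s + \<theta>)) = vconv \<gamma> (causal_part x) s + vconv \<gamma> (initial_part h \<phi>) s"
proof -
  have \<gamma>_int: "integrable lborel \<gamma>" and \<gamma>_zero: "\<And>t. t \<notin> {0..h} \<Longrightarrow> \<gamma> t = 0"
    and \<gamma>_f: "AE \<theta> in lborel. \<theta> \<in> {-h..0} \<longrightarrow> \<gamma> (-\<theta>) = f \<theta>"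
    using \<gamma> by (auto simp: delay_density_def)
  have \<gamma>_lic: "locally_integrable_causal \<gamma>"
    using \<gamma>_int by (rule locally_integrable_causal_integrable) (simp add: \<gamma>_zero)
  let ?y = "\<lambda>r. causal_part x r + initial_part h \<phi> r"
  have int: "integrable lborel (\<lambda>r. \<gamma> (s - r) *v causal_part x r)" "integrable lborel (\<lambda>r. \<gamma> (s - r) *v initial_part h \<phi> r)"
    using integrable_vconv[OF \<gamma>_lic locally_bounded_causal_part[OF x]]
      integrable_conv_initial[OF \<gamma>_int initial_segment_initial_part[OF \<phi>]] by auto
  have int_y: "integrable lborel (\<lambda>r. \<gamma> (s - r) *v ?y r)"
    using int by (simp add: matrix_vector_right_distrib)
  have "vconv \<gamma> (causal_part x) s + vconv \<gamma> (initial_part h \<phi>) s = (LINT r|lborel. \<gamma> (s - r) *v ?y r)"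
    using int by (simp add: conv_def matrix_vector_right_distrib)
  also have "\<dots> = (LINT \<theta>|lborel. \<gamma> (-\<theta>) *v ?y (s + \<theta>))"
    using lborel_integral_real_affine[of 1 "\<lambda>r. \<gamma> (s - r) *v ?y r" s] by simp
  finally have eq: "vconv \<gamma> (causal_part x) s + vconv \<gamma> (initial_part h \<phi>) s = (LINT \<theta>|lborel. \<gamma> (-\<theta>) *v ?y (s + \<theta>))" .
  have y: "?y (s + \<theta>) = x (s + \<theta>)" if "\<theta> \<in> {-h..0}" for \<theta>
    using that s x_\<phi>[of "s + \<theta>"] by (auto simp: causal_part_def initial_part_def indicator_def)
  have "((\<lambda>\<theta>. f \<theta> *v x (s + \<theta>)) has_integral (LINT \<theta>|lborel. \<gamma> (-\<theta>) *v ?y (s + \<theta>))) {-h..0}"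
  proof (rule lborel_integral_has_integral_on)
    show "integrable lborel (\<lambda>\<theta>. \<gamma> (-\<theta>) *v ?y (s + \<theta>))"
      using lborel_integrable_real_affine[OF int_y, of 1 s] by simp
    show "\<gamma> (-\<theta>) *v ?y (s + \<theta>) = 0" if "\<theta> \<notin> {-h..0}" for \<theta>
      using that \<gamma>_zero[of "-\<theta>"] by auto
    show "AE \<theta> in lborel. \<theta> \<in> {-h..0} \<longrightarrow> \<gamma> (-\<theta>) *v ?y (s + \<theta>) = f \<theta> *v x (s + \<theta>)"
      using \<gamma>_f by eventually_elim (use y in auto)
  qed
  then show ?thesis by (simp add: eq integral_unique)
qed

lemma vconv_heaviside_eq_integral:
  fixes F :: "real \<Rightarrow> real^'n"
  assumes F: "locally_bounded_causal F"
  shows "(F has_integral vconv heaviside F t) {0..t}"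
proof -
  have eq: "heaviside (t - r) *v F r = (if r \<in> {0..t} then F r else 0)" for r
    using locally_bounded_causal_neg[OF F, of r] by (cases "r < 0") (auto simp: heaviside_def)
  show ?thesis
    unfolding conv_def
  proof (rule lborel_integral_has_integral_on)
    show "integrable lborel (\<lambda>r. heaviside (t - r) *v F r)"
      by (intro integrable_vconv locally_bounded_causal_locally_integrable locally_bounded_causal_heaviside F)
  qed (auto simp: eq)
qed

text \<open>
  Inserting the linear control into the system gives a delay system with gains \<open>A + D ** \<Gamma>0\<close>, \<open>B\<close> and
  \<open>\<epsilon> + D ** \<gamma>\<close>, where \<open>\<epsilon>\<close> and \<open>\<gamma>\<close> are densities for the gains of the plant and of the control.
\<close>

locale closed_loop =
  fixes h :: real and A B :: "real^'n^'n" and E :: "real \<Rightarrow> real^'n^'n" and D :: "real^'r^'n"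
    and \<Gamma>0 :: "real^'n^'r" and \<Gamma>1 :: "real \<Rightarrow> real^'n^'r"
    and \<epsilon> :: "real \<Rightarrow> real^'n^'n" and \<gamma> :: "real \<Rightarrow> real^'n^'r"
  assumes h: "h > 0" and \<epsilon>: "delay_density h E \<epsilon>" and \<gamma>: "delay_density h \<Gamma>1 \<gamma>"
begin

abbreviation "closed_loop_gain \<equiv> \<lambda>t. \<epsilon> t + D ** \<gamma> t"

lemma densities:
  shows \<epsilon>_int: "integrable lborel \<epsilon>" and \<epsilon>_neg: "\<And>t. t < 0 \<Longrightarrow> \<epsilon> t = 0"
    and \<gamma>_int: "integrable lborel \<gamma>" and \<gamma>_neg: "\<And>t. t < 0 \<Longrightarrow> \<gamma> t = 0"
  using \<epsilon> \<gamma> by (auto simp: delay_density_def)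

lemma D\<gamma>_int: "integrable lborel (\<lambda>t. D ** \<gamma> t)"
  by (rule integrable_bounded_linear[OF bounded_bilinear.bounded_linear_right[OF bounded_bilinear_matrix_matrix] \<gamma>_int])

sublocale delay_system h "A + D ** \<Gamma>0" B closed_loop_gain
  by unfold_locales (use h D\<gamma>_int in \<open>simp_all add: \<epsilon>_int \<epsilon>_neg \<gamma>_neg\<close>)

abbreviation "control \<equiv> linear_control h \<Gamma>0 \<Gamma>1"

lemma control_eq_output:
  assumes \<phi>: "\<phi> \<in> PC (-h) 0" and x: "continuous_on {0..} x"
    and x_\<phi>: "\<And>\<theta>. \<theta> \<in> {-h..0} \<Longrightarrow> x \<theta> = \<phi> \<theta>" and s: "s \<ge> 0"
  shows "control (state x s) = measured_output \<Gamma>0 \<gamma> (initial_part h \<phi>) (causal_part x) s"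
  using distributed_delay_integral[OF \<gamma> \<phi> x x_\<phi> s] s
  by (simp add: linear_control_def state_def measured_output_def causal_part_def)

lemma delay_rhs_eq:
  assumes \<phi>: "\<phi> \<in> PC (-h) 0" and x: "continuous_on {0..} x"
    and x_\<phi>: "\<And>\<theta>. \<theta> \<in> {-h..0} \<Longrightarrow> x \<theta> = \<phi> \<theta>" and s: "s \<ge> 0"
  shows "delay_rhs h A B E D control (state x s)
    = delay_op (causal_part x) s + initial_forcing (initial_part h \<phi>) s"
proof -
  let ?x = "causal_part x" and ?\<phi> = "initial_part h \<phi>"
  have x_lbc: "locally_bounded_causal ?x" by (rule locally_bounded_causal_part[OF x])
  have \<phi>_seg: "initial_segment ?\<phi>" by (rule initial_segment_initial_part[OF \<phi>])
  have lic: "locally_integrable_causal \<epsilon>" "locally_integrable_causal \<gamma>" "locally_integrable_causal (\<lambda>t. D ** \<gamma> t)"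
    using D\<gamma>_int by (auto intro!: locally_integrable_causal_integrable simp: \<epsilon>_int \<epsilon>_neg \<gamma>_int \<gamma>_neg)
  have gain_x: "vconv closed_loop_gain ?x s = vconv \<epsilon> ?x s + D *v vconv \<gamma> ?x s"
    unfolding conv_def using integrable_vconv[OF lic(1) x_lbc] integrable_vconv[OF lic(2) x_lbc] integrable_vconv[OF lic(3) x_lbc]
    by (simp add: matrix_vector_mult_add_rdistrib flip: integral_matrix_vector_right matrix_vector_mul_assoc)
  have gain_\<phi>: "vconv closed_loop_gain ?\<phi> s = vconv \<epsilon> ?\<phi> s + D *v vconv \<gamma> ?\<phi> s"
    unfolding conv_def using integrable_conv_initial[OF \<epsilon>_int \<phi>_seg] integrable_conv_initial[OF \<gamma>_int \<phi>_seg]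
      integrable_conv_initial[OF D\<gamma>_int \<phi>_seg]
    by (simp add: matrix_vector_mult_add_rdistrib flip: integral_matrix_vector_right matrix_vector_mul_assoc)
  have delayed: "x (s - h) = ?x (s - h) + ?\<phi> (s - h)"
    using s x_\<phi>[of "s - h"] h by (auto simp: causal_part_def initial_part_def indicator_def)
  have E_eq: "integral {-h..0} (\<lambda>\<theta>. E \<theta> *v x (s + \<theta>)) = vconv \<epsilon> ?x s + vconv \<epsilon> ?\<phi> s"
    by (rule distributed_delay_integral[OF \<epsilon> \<phi> x x_\<phi> s])
  have u: "control (state x s) = measured_output \<Gamma>0 \<gamma> ?\<phi> ?x s"
    by (rule control_eq_output[OF \<phi> x x_\<phi> s])
  have x_s: "x s = ?x s" using s by (simp add: causal_part_def)
  have "delay_rhs h A B E D control (state x s) = A *v ?x s + B *v (?x (s - h) + ?\<phi> (s - h))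
      + (vconv \<epsilon> ?x s + vconv \<epsilon> ?\<phi> s) + D *v (\<Gamma>0 *v ?x s + vconv \<gamma> ?x s + vconv \<gamma> ?\<phi> s)"
    unfolding delay_rhs_def u measured_output_def
    using E_eq x_s delayed by (simp add: state_def)
  also have "\<dots> = delay_op ?x s + initial_forcing ?\<phi> s"
    using s by (simp add: delay_op_def initial_forcing_def gain_x gain_\<phi> matrix_vector_right_distrib
        matrix_vector_mult_add_rdistrib matrix_vector_mul_assoc)
  finally show ?thesis .
qed

text \<open>
  The fundamental theorem of calculus in the form that permits finitely many exceptional points on each compact
  interval.
\<close>

lemma solution_is_mild:
  assumes \<phi>: "\<phi> \<in> PC (-h) 0" and sol: "closed_loop_solution h A B E D control \<phi> x"
  shows "mild_solution (\<phi> 0) (initial_forcing (initial_part h \<phi>)) (causal_part x)"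
proof -
  have x_\<phi>: "\<And>\<theta>. \<theta> \<in> {-h..0} \<Longrightarrow> x \<theta> = \<phi> \<theta>" and x: "continuous_on {0..} x"
    using sol by (auto simp: closed_loop_solution_def)
  obtain N where N: "\<And>T. finite (N \<inter> {0..T})"
    and deriv: "\<And>t. t \<in> {0..} - N \<Longrightarrow>
      (x has_vector_derivative delay_rhs h A B E D control (state x t)) (at t within {0..})"
    using sol by (auto simp: closed_loop_solution_def)
  let ?x = "causal_part x" and ?f = "initial_forcing (initial_part h \<phi>)"
  let ?F = "\<lambda>s. delay_op ?x s + ?f s"
  have x_lbc: "locally_bounded_causal ?x" by (rule locally_bounded_causal_part[OF x])
  have F: "locally_bounded_causal ?F"
    by (intro locally_bounded_causal_add locally_bounded_causal_delay_op x_lbc locally_bounded_causal_initial_forcing initial_segment_initial_part \<phi>)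
  have "?x t = heaviside t *v \<phi> 0 + vconv heaviside ?F t" for t
  proof (cases "t < 0")
    case True
    then show ?thesis
      using locally_bounded_causal_neg[OF locally_bounded_causal_vconv[OF
          locally_bounded_causal_locally_integrable[OF locally_bounded_causal_heaviside] F], of t]
      by (simp add: causal_part_def)
  next
    case False
    have FTC: "(?F has_integral (x t - x 0)) {0..t}"
    proof (rule fundamental_theorem_of_calculus_interior_strong[OF N[of t]])
      fix s assume s: "s \<in> {0<..<t} - N \<inter> {0..t}"
      then have s': "s \<in> {0..} - N" "s \<ge> 0" "s \<in> interior {0..}" by auto
      have "delay_rhs h A B E D control (state x s) = ?F s"
        by (rule delay_rhs_eq[OF \<phi> x _ s'(2)]) (rule x_\<phi>)
      with deriv[OF s'(1)] show "(x has_vector_derivative ?F s) (at s)"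
        by (simp only: at_within_interior[OF s'(3)])
    qed (use False continuous_on_subset[OF x] in auto)
    have "?x t = x t" "x 0 = \<phi> 0" "heaviside t *v \<phi> 0 = \<phi> 0"
      using False x_\<phi>[of 0] h by (simp_all add: causal_part_def)
    moreover have "x t = x 0 + (x t - x 0)" by simp
    moreover have "x t - x 0 = vconv heaviside ?F t"
      by (rule has_integral_unique[OF FTC vconv_heaviside_eq_integral[OF F]])
    ultimately show ?thesis by (simp only:)
  qed
  with x_lbc show ?thesis by (simp add: mild_solution_def)
qed

end

section \<open>A square integrable fundamental matrix\<close>

text \<open>
  A piecewise continuous initial function whose history vanishes almost everywhere, so that its trajectory is governed by
  the value \<open>v\<close> alone.
\<close>

definition impulse :: "'a::zero \<Rightarrow> real \<Rightarrow> 'a" where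
  "impulse v \<theta> = (if \<theta> = 0 then v else 0)"

lemma impulse_PC: "h > 0 \<Longrightarrow> impulse (v :: 'a::real_normed_vector) \<in> PC (-h) 0"
proof -
  assume "h > 0"
  have "continuous_on ({-h..0} - {0}) (impulse v)"
    by (rule continuous_on_eq[of _ "\<lambda>_. 0"]) (auto simp: impulse_def)
  moreover have "(impulse v \<longlongrightarrow> 0) (at_left 0)"
    by (rule tendsto_eventually) (auto simp: eventually_at_filter impulse_def)
  ultimately show ?thesis
    unfolding PC_def using \<open>h > 0\<close> by (intro CollectI exI[of _ "{0}"]) auto
qed

lemma initial_part_impulse: "initial_part h (impulse v) = (\<lambda>_. 0)"
  by (auto simp: initial_part_def impulse_def indicator_def)

lemma locally_bounded_causal_sum:
  assumes "finite S" "\<And>i. i \<in> S \<Longrightarrow> locally_bounded_causal (f i)"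
  shows "locally_bounded_causal (\<lambda>t. \<Sum>i\<in>S. f i t)"
  using assms
proof (induction S)
  case empty
  show ?case by (rule locally_bounded_causal_bound[of _ 0]) auto
qed (auto intro: locally_bounded_causal_add)

definition matrix_of_columns :: "('n::finite \<Rightarrow> real^'m) \<Rightarrow> real^'n^'m" where
  "matrix_of_columns c = (\<chi> i j. c j $ i)"

lemma matrix_of_columns_axis: "matrix_of_columns c *v axis j 1 = c j"
  by (simp add: matrix_vector_mult_basis column_def matrix_of_columns_def vec_eq_iff)

lemma norm_matrix_of_columns: "(norm (matrix_of_columns c))\<^sup>2 = (\<Sum>j\<in>UNIV. (norm (c j))\<^sup>2)"
proof -
  have "norm (matrix_of_columns c) = norm (\<chi> j. c j)"
    using norm_transpose[of "matrix_of_columns c"]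
    by (simp add: matrix_of_columns_def transpose_def)
  then show ?thesis
    by (simp add: norm_vec_def L2_set_def sum_nonneg)
qed

lemma locally_bounded_causal_matrix_of_columns:
  fixes c :: "'n::finite \<Rightarrow> real \<Rightarrow> real^'m"
  assumes "\<And>j. locally_bounded_causal (c j)"
  shows "locally_bounded_causal (\<lambda>t. matrix_of_columns (\<lambda>j. c j t))"
proof -
  define col where "col j v = (\<chi> i k. if k = j then v $ i else 0)" for j :: 'n and v :: "real^'m"
  have lin: "bounded_linear (col j)" for j
    by (rule linear_conv_bounded_linear[THEN iffD1], rule linearI) (simp_all add: col_def vec_eq_iff)
  have "locally_bounded_causal (\<lambda>t. \<Sum>j\<in>UNIV. col j (c j t))"
    by (rule locally_bounded_causal_sum[OF finite]) (rule locally_bounded_causal_bounded_linear[OF lin assms])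
  moreover have "(\<Sum>j\<in>UNIV. col j (c j t)) = matrix_of_columns (\<lambda>j. c j t)" for t
    by (simp add: matrix_of_columns_def col_def vec_eq_iff)
  ultimately show ?thesis by simp
qed

lemma matrix_eq_on_axes:
  fixes A B :: "real^'n^'m"
  assumes "\<And>j. A *v axis j 1 = B *v axis j 1"
  shows "A = B"
  using assms by (simp add: matrix_vector_mult_basis column_def vec_eq_iff)

text \<open>
  The matrix equation is checked column by column, i.e. after applying both sides to the unit vectors.
\<close>

lemma (in delay_system) fundamental_matrix_of_columns:
  assumes x: "\<And>j. mild_solution (axis j 1) (\<lambda>_. 0) (x j)"
  shows "fundamental_matrix (\<lambda>t. matrix_of_columns (\<lambda>j. x j t))"
proof -
  let ?K = "\<lambda>t. matrix_of_columns (\<lambda>j. x j t)"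
  have K: "locally_bounded_causal ?K"
    using x unfolding mild_solution_def by (blast intro: locally_bounded_causal_matrix_of_columns)
  have "?K t *v axis j 1 = (heaviside t + mconv heaviside (delay_op_matrix ?K) t) *v axis j 1" for t j
  proof -
    have "delay_op (x j) = (\<lambda>s. delay_op_matrix ?K s *v axis j 1)"
      using delay_op_apply[OF K, of "axis j 1"] by (auto simp: matrix_of_columns_axis)
    then have "vconv heaviside (delay_op (x j)) t = mconv heaviside (delay_op_matrix ?K) t *v axis j 1"
      by (simp add: mconv_apply locally_bounded_causal_locally_integrable locally_bounded_causal_heaviside
          locally_bounded_causal_delay_op_matrix K)
    moreover have "x j t = heaviside t *v axis j 1 + vconv heaviside (delay_op (x j)) t"
      using x[of j] by (simp add: mild_solution_def)
    ultimately show ?thesis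
      by (simp add: matrix_of_columns_axis matrix_vector_mult_add_rdistrib)
  qed
  then have "?K t = heaviside t + mconv heaviside (delay_op_matrix ?K) t" for t
    by (rule matrix_eq_on_axes)
  with K show ?thesis unfolding fundamental_matrix_def by blast
qed

lemma integrable_kernel_form:
  fixes G :: "real \<Rightarrow> real \<Rightarrow> real^'n^'n"
  assumes G: "integrable (lborel \<Otimes>\<^sub>M lborel) (\<lambda>(\<xi>, \<theta>). G \<xi> \<theta>)"
    and \<Phi>[measurable]: "\<Phi> \<in> borel_measurable borel" and c: "\<And>\<theta>. norm (\<Phi> \<theta>) \<le> c"
  shows "integrable (lborel \<Otimes>\<^sub>M lborel) (\<lambda>(\<xi>, \<theta>). \<Phi> \<xi> \<bullet> (G \<xi> \<theta> *v \<Phi> \<theta>))"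
proof (rule Bochner_Integration.integrable_bound)
  have [measurable]: "(\<lambda>(\<xi>, \<theta>). G \<xi> \<theta>) \<in> borel_measurable (lborel \<Otimes>\<^sub>M lborel)"
    using G by (rule borel_measurable_integrable)
  show "integrable (lborel \<Otimes>\<^sub>M lborel) (\<lambda>p. c * (norm (case p of (\<xi>, \<theta>) \<Rightarrow> G \<xi> \<theta>) * c))"
    by (intro integrable_mult_left integrable_mult_right integrable_norm G)
  show "(\<lambda>(\<xi>, \<theta>). \<Phi> \<xi> \<bullet> (G \<xi> \<theta> *v \<Phi> \<theta>)) \<in> borel_measurable (lborel \<Otimes>\<^sub>M lborel)"
    by measurable
  have "norm (\<Phi> \<xi> \<bullet> (G \<xi> \<theta> *v \<Phi> \<theta>)) \<le> \<bar>c * (norm (G \<xi> \<theta>) * c)\<bar>" for \<xi> \<theta>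
  proof -
    have c0: "0 \<le> c" using order_trans[OF norm_ge_zero c] .
    have "norm (\<Phi> \<xi> \<bullet> (G \<xi> \<theta> *v \<Phi> \<theta>)) \<le> norm (\<Phi> \<xi>) * norm (G \<xi> \<theta> *v \<Phi> \<theta>)"
      unfolding real_norm_def by (rule Cauchy_Schwarz_ineq2)
    also have "\<dots> \<le> c * (norm (G \<xi> \<theta>) * c)"
      by (intro mult_mono c order_trans[OF norm_matrix_vector_mult_le] mult_left_mono c0) simp_all
    finally show ?thesis by linarith
  qed
  then show "AE p in lborel \<Otimes>\<^sub>M lborel. norm (case p of (\<xi>, \<theta>) \<Rightarrow> \<Phi> \<xi> \<bullet> (G \<xi> \<theta> *v \<Phi> \<theta>))
      \<le> norm (c * (norm (case p of (\<xi>, \<theta>) \<Rightarrow> G \<xi> \<theta>) * c))"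
    by (intro AE_I2) (simp add: split_beta' del: abs_mult)
qed

lemma running_cost_bounds:
  assumes "symmetric_pos_def Q" "symmetric_pos_def R"
  shows "x t \<bullet> (Q *v x t) \<le> running_cost Q R u x t" "0 \<le> running_cost Q R u x t"
proof -
  have nonneg: "0 \<le> v \<bullet> (M *v v)" if "symmetric_pos_def M" for M :: "real^'k^'k" and v
    using that by (cases "v = 0") (auto simp: symmetric_pos_def_def less_imp_le)
  show "x t \<bullet> (Q *v x t) \<le> running_cost Q R u x t" "0 \<le> running_cost Q R u x t"
    using nonneg[OF assms(1), of "x t"] nonneg[OF assms(2), of "u (state x t)"]
    by (simp_all add: running_cost_def)
qed

context closed_loop
begin

lemma solution_continuous_initial:
  assumes "closed_loop_solution h A B E D control \<phi> x"
  shows "continuous_on {0..} x" "\<theta> \<in> {-h..0} \<Longrightarrow> x \<theta> = \<phi> \<theta>"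
  using assms by (auto simp: closed_loop_solution_def)

lemma impulse_solution_is_mild:
  assumes "closed_loop_solution h A B E D control (impulse v) x"
  shows "mild_solution v (\<lambda>_. 0) (causal_part x)"
proof -
  have "initial_forcing (\<lambda>_. 0) = (\<lambda>_. 0)"
    by (auto simp: initial_forcing_def conv_def)
  then show ?thesis
    using solution_is_mild[OF impulse_PC[OF h] assms]
    by (simp add: initial_part_impulse) (simp add: impulse_def)
qed

text \<open>
  The running cost dominates a multiple of the squared norm of the state.
\<close>

lemma solution_square_integrable:
  assumes Q: "symmetric_pos_def Q" and R: "symmetric_pos_def R"
    and x: "continuous_on {0..} x" and fin: "running_cost Q R control x integrable_on {0..}"
  shows "integrable lborel (\<lambda>t. (norm (causal_part x t))\<^sup>2)"
proof -
  obtain c where c: "c > 0" "\<And>v. c * (norm v)\<^sup>2 \<le> v \<bullet> (Q *v v)"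
    using symmetric_pos_def_lower_bound[OF Q] by blast
  have "running_cost Q R control x absolutely_integrable_on {0..}"
    by (rule nonnegative_absolutely_integrable_1[OF fin]) (rule running_cost_bounds(2)[OF Q R])
  then have int: "integrable lebesgue (\<lambda>t. indicator {0..} t * running_cost Q R control x t)"
    by (simp add: set_integrable_def)
  have [measurable]: "causal_part x \<in> borel_measurable borel"
    using locally_bounded_causal_borel[OF locally_bounded_causal_part[OF x]] .
  have meas: "(\<lambda>t. (norm (causal_part x t))\<^sup>2) \<in> borel_measurable lborel" by measurable
  have "integrable lebesgue (\<lambda>t. (norm (causal_part x t))\<^sup>2)"
  proof (rule Bochner_Integration.integrable_bound[OF integrable_mult_right[OF int, of "1 / c"] measurable_completion[OF meas]])
    have "c * (norm (x t))\<^sup>2 \<le> running_cost Q R control x t" for t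
      using c(2)[of "x t"] running_cost_bounds(1)[OF Q R, of x t control] by linarith
    then have "(norm (x t))\<^sup>2 \<le> running_cost Q R control x t / c" for t
      using c(1) by (simp add: pos_le_divide_eq mult.commute)
    then have "(norm (x t))\<^sup>2 \<le> \<bar>running_cost Q R control x t / c\<bar>" for t
      using order_trans[OF _ abs_ge_self] by blast
    then show "AE t in lebesgue. norm ((norm (causal_part x t))\<^sup>2)
        \<le> norm (1 / c * (indicator {0..} t * running_cost Q R control x t))"
      by (intro AE_I2) (simp add: causal_part_def indicator_def)
  qed
  then show ?thesis using meas by (simp add: integrable_completion)
qed

text \<open>
  The squared Frobenius norm of \<open>K\<close> is the sum of the squared norms of its columns, each of which is the trajectory
  of an impulse.
\<close>

lemma square_integrable_fundamental_matrix:
  assumes ex: "\<And>\<phi>. \<phi> \<in> PC (-h) 0 \<Longrightarrow> \<exists>x. closed_loop_solution h A B E D control \<phi> x"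
    and sq: "\<And>\<phi> x. \<phi> \<in> PC (-h) 0 \<Longrightarrow> closed_loop_solution h A B E D control \<phi> x \<Longrightarrow>
      integrable lborel (\<lambda>t. (norm (causal_part x t))\<^sup>2)"
  obtains K where "fundamental_matrix K" "(\<integral>\<^sup>+t. (ennreal (norm (K t)))\<^sup>2 \<partial>lborel) < \<infinity>"
proof -
  obtain x where x: "\<And>j. closed_loop_solution h A B E D control (impulse (axis j 1)) (x j)"
    using choice[OF allI[OF ex[OF impulse_PC[OF h]]], of "\<lambda>j. axis j 1"] by blast
  let ?K = "\<lambda>t. matrix_of_columns (\<lambda>j. causal_part (x j) t)"
  have K: "fundamental_matrix ?K"
    by (intro fundamental_matrix_of_columns impulse_solution_is_mild x)
  have "integrable lborel (\<lambda>t. (norm (?K t))\<^sup>2)"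
    unfolding norm_matrix_of_columns
    by (intro Bochner_Integration.integrable_sum sq[OF impulse_PC[OF h] x])
  then have "(\<integral>\<^sup>+t. (ennreal (norm (?K t)))\<^sup>2 \<partial>lborel) < \<infinity>"
    by (simp add: integrable_iff_bounded ennreal_power)
  with K show thesis by (rule that)
qed

section \<open>The performance index as a quadratic functional\<close>

text \<open>
  The state and the control are two outputs of the same system.  Their costs have representations with the
  same structure, and the kernels add up.
\<close>

lemma performance_index_representation:
  assumes K: "fundamental_matrix K" and K_L2: "(\<integral>\<^sup>+t. (ennreal (norm (K t)))\<^sup>2 \<partial>lborel) < \<infinity>"
    and Q: "transpose Q = Q" and R: "transpose R = R"
  obtains \<Pi>0 :: "real^'n^'n" and \<Pi>1 :: "real \<Rightarrow> real^'n^'n" and \<Pi>2 :: "real \<Rightarrow> real \<Rightarrow> real^'n^'n"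
  where "transpose \<Pi>0 = \<Pi>0" "integrable lborel \<Pi>1"
    "integrable (lborel \<Otimes>\<^sub>M lborel) (\<lambda>(\<xi>, \<theta>). \<Pi>2 \<xi> \<theta>)"
    "\<And>\<xi> \<theta>. transpose (\<Pi>2 \<xi> \<theta>) = \<Pi>2 \<theta> \<xi>"
    "\<And>\<phi> x. \<phi> \<in> PC (-h) 0 \<Longrightarrow> closed_loop_solution h A B E D control \<phi> x \<Longrightarrow>
      performance_index Q R control x
        = \<phi> 0 \<bullet> (\<Pi>0 *v \<phi> 0) + 2 * (\<phi> 0 \<bullet> (LINT \<theta>|lborel. \<Pi>1 \<theta> *v initial_part h \<phi> \<theta>))
        + (LINT (\<xi>, \<theta>)|(lborel \<Otimes>\<^sub>M lborel). initial_part h \<phi> \<xi> \<bullet> (\<Pi>2 \<xi> \<theta> *v initial_part h \<phi> \<theta>))"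
proof -
  let ?form = "\<lambda>(\<Pi>0::real^'n^'n) \<Pi>1 \<Pi>2 v \<Phi>. v \<bullet> (\<Pi>0 *v v) + 2 * (v \<bullet> (LINT \<theta>|lborel. \<Pi>1 \<theta> *v \<Phi> \<theta>))
        + (LINT (\<xi>, \<theta>)|(lborel \<Otimes>\<^sub>M lborel). \<Phi> \<xi> \<bullet> (\<Pi>2 \<xi> \<theta> *v \<Phi> \<theta>))"
  have state_output: "measured_output (mat 1) (\<lambda>_. 0) \<Phi> y = y" for \<Phi> y :: "real \<Rightarrow> real^'n"
    by (auto simp: measured_output_def conv_def)
  show thesis
  proof (rule output_cost_representation[OF K K_L2, of "\<lambda>_. 0" Q "mat 1", unfolded state_output])
    show "transpose Q = Q" by fact
    fix P0 :: "real^'n^'n" and P1 :: "real \<Rightarrow> real^'n^'n" and P2 :: "real \<Rightarrow> real \<Rightarrow> real^'n^'n"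
    assume P: "transpose P0 = P0" "integrable lborel P1" "integrable (lborel \<Otimes>\<^sub>M lborel) (\<lambda>(\<xi>, \<theta>). P2 \<xi> \<theta>)"
        "\<And>\<xi> \<theta>. transpose (P2 \<xi> \<theta>) = P2 \<theta> \<xi>"
      and P_form: "\<And>v \<Phi> x. initial_segment \<Phi> \<Longrightarrow> mild_solution v (initial_forcing \<Phi>) x \<Longrightarrow>
        integrable lborel (\<lambda>t. indicator {0..} t * (x t \<bullet> (Q *v x t))) \<and>
        (LINT t|lborel. indicator {0..} t * (x t \<bullet> (Q *v x t))) = ?form P0 P1 P2 v \<Phi>"
    show thesis
    proof (rule output_cost_representation[OF K K_L2 \<gamma>_int, of R \<Gamma>0])
      show "t < 0 \<Longrightarrow> \<gamma> t = 0" for t by (rule \<gamma>_neg)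
      show "transpose R = R" by fact
      fix S0 :: "real^'n^'n" and S1 :: "real \<Rightarrow> real^'n^'n" and S2 :: "real \<Rightarrow> real \<Rightarrow> real^'n^'n"
      assume S: "transpose S0 = S0" "integrable lborel S1" "integrable (lborel \<Otimes>\<^sub>M lborel) (\<lambda>(\<xi>, \<theta>). S2 \<xi> \<theta>)"
          "\<And>\<xi> \<theta>. transpose (S2 \<xi> \<theta>) = S2 \<theta> \<xi>"
        and S_form: "\<And>v \<Phi> x. initial_segment \<Phi> \<Longrightarrow> mild_solution v (initial_forcing \<Phi>) x \<Longrightarrow>
          integrable lborel (\<lambda>t. indicator {0..} t * (measured_output \<Gamma>0 \<gamma> \<Phi> x t \<bullet> (R *v measured_output \<Gamma>0 \<gamma> \<Phi> x t))) \<and>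
          (LINT t|lborel. indicator {0..} t * (measured_output \<Gamma>0 \<gamma> \<Phi> x t \<bullet> (R *v measured_output \<Gamma>0 \<gamma> \<Phi> x t)))
            = ?form S0 S1 S2 v \<Phi>"
      show thesis
      proof (rule that[of "P0 + S0" "\<lambda>\<theta>. P1 \<theta> + S1 \<theta>" "\<lambda>\<xi> \<theta>. P2 \<xi> \<theta> + S2 \<xi> \<theta>"])
        have tr: "transpose (X + Y) = transpose X + transpose Y" for X Y :: "real^'n^'n"
          by (simp add: transpose_def vec_eq_iff)
        show "transpose (P0 + S0) = P0 + S0" "transpose (P2 \<xi> \<theta> + S2 \<xi> \<theta>) = P2 \<theta> \<xi> + S2 \<theta> \<xi>" for \<xi> \<theta>
          by (simp_all add: tr P S)
        show "integrable lborel (\<lambda>\<theta>. P1 \<theta> + S1 \<theta>)" using P(2) S(2) by simp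
        show "integrable (lborel \<Otimes>\<^sub>M lborel) (\<lambda>(\<xi>, \<theta>). P2 \<xi> \<theta> + S2 \<xi> \<theta>)"
          using Bochner_Integration.integrable_add[OF P(3) S(3)] by (simp add: split_beta')
        fix \<phi> x assume \<phi>: "\<phi> \<in> PC (-h) 0" and sol: "closed_loop_solution h A B E D control \<phi> x"
        let ?\<Phi> = "initial_part h \<phi>" and ?x = "causal_part x"
        let ?u = "measured_output \<Gamma>0 \<gamma> ?\<Phi> ?x"
        have \<Phi>: "initial_segment ?\<Phi>" by (rule initial_segment_initial_part[OF \<phi>])
        have mild: "mild_solution (\<phi> 0) (initial_forcing ?\<Phi>) ?x" by (rule solution_is_mild[OF \<phi> sol])
        let ?q = "\<lambda>t. indicator {0..} t * (?x t \<bullet> (Q *v ?x t))" and ?r = "\<lambda>t. indicator {0..} t * (?u t \<bullet> (R *v ?u t))"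
        have int: "integrable lborel ?q" "integrable lborel ?r"
          using P_form[OF \<Phi> mild] S_form[OF \<Phi> mild] by auto
        have cost: "?q t + ?r t = running_cost Q R control x t" if "t \<ge> 0" for t
        proof -
          have "control (state x t) = ?u t"
            by (rule control_eq_output[OF \<phi> solution_continuous_initial(1)[OF sol] _ that])
              (rule solution_continuous_initial(2)[OF sol])
          then show ?thesis using that by (simp add: running_cost_def causal_part_def)
        qed
        have "(running_cost Q R control x has_integral (LINT t|lborel. ?q t + ?r t)) {0..}"
          by (rule lborel_integral_has_integral_on)
            (use int cost in \<open>auto intro!: AE_I2 Bochner_Integration.integrable_add simp del: distrib_left_numeral\<close>)
        then have J: "performance_index Q R control x = ?form P0 P1 P2 (\<phi> 0) ?\<Phi> + ?form S0 S1 S2 (\<phi> 0) ?\<Phi>"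
          unfolding performance_index_def using P_form[OF \<Phi> mild] S_form[OF \<Phi> mild] by (simp add: integral_unique)
        obtain c where c: "\<And>\<theta>. norm (?\<Phi> \<theta>) \<le> c" and \<Phi>_meas[measurable]: "?\<Phi> \<in> borel_measurable borel"
          using \<Phi> by (auto simp: initial_segment_def)
        have "integrable lborel (\<lambda>\<theta>. P1 \<theta> *v ?\<Phi> \<theta>)" "integrable lborel (\<lambda>\<theta>. S1 \<theta> *v ?\<Phi> \<theta>)"
          using P(2) S(2) by (auto intro!: integrable_matrix_vector_bounded[OF _ _ c])
        then have one: "(LINT \<theta>|lborel. (P1 \<theta> + S1 \<theta>) *v ?\<Phi> \<theta>) = (LINT \<theta>|lborel. P1 \<theta> *v ?\<Phi> \<theta>) + (LINT \<theta>|lborel. S1 \<theta> *v ?\<Phi> \<theta>)"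
          by (simp add: matrix_vector_mult_add_rdistrib)
        have "integrable (lborel \<Otimes>\<^sub>M lborel) (\<lambda>(\<xi>, \<theta>). ?\<Phi> \<xi> \<bullet> (P2 \<xi> \<theta> *v ?\<Phi> \<theta>))"
            "integrable (lborel \<Otimes>\<^sub>M lborel) (\<lambda>(\<xi>, \<theta>). ?\<Phi> \<xi> \<bullet> (S2 \<xi> \<theta> *v ?\<Phi> \<theta>))"
          by (rule integrable_kernel_form[OF P(3) \<Phi>_meas c], rule integrable_kernel_form[OF S(3) \<Phi>_meas c])
        from Bochner_Integration.integral_add[OF this]
        have two: "(LINT (\<xi>, \<theta>)|(lborel \<Otimes>\<^sub>M lborel). ?\<Phi> \<xi> \<bullet> ((P2 \<xi> \<theta> + S2 \<xi> \<theta>) *v ?\<Phi> \<theta>))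
            = (LINT (\<xi>, \<theta>)|(lborel \<Otimes>\<^sub>M lborel). ?\<Phi> \<xi> \<bullet> (P2 \<xi> \<theta> *v ?\<Phi> \<theta>))
              + (LINT (\<xi>, \<theta>)|(lborel \<Otimes>\<^sub>M lborel). ?\<Phi> \<xi> \<bullet> (S2 \<xi> \<theta> *v ?\<Phi> \<theta>))"
          by (simp add: split_beta' matrix_vector_mult_add_rdistrib inner_add_right)
        show "performance_index Q R control x = ?form (P0 + S0) (\<lambda>\<theta>. P1 \<theta> + S1 \<theta>) (\<lambda>\<xi> \<theta>. P2 \<xi> \<theta> + S2 \<xi> \<theta>) (\<phi> 0) ?\<Phi>"
          unfolding J one two by (simp add: matrix_vector_mult_add_rdistrib inner_add_right algebra_simps)
      qed
    qed
  qed auto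
qed

end

lemma AE_lborel_neq: "AE x in lborel. x \<noteq> (a::real)"
  using AE_lborel_singleton[of a] .

lemma (in delay_system) integral_initial_part:
  fixes G :: "real \<Rightarrow> real^'n^'m"
  assumes G: "integrable lborel G" and \<phi>: "\<phi> \<in> PC (-h) 0"
  shows "(LINT \<theta>|lborel. G \<theta> *v initial_part h \<phi> \<theta>) = integral {-h..0} (\<lambda>\<theta>. G \<theta> *v \<phi> \<theta>)"
proof -
  have \<Phi>: "initial_segment (initial_part h \<phi>)" by (rule initial_segment_initial_part[OF \<phi>])
  obtain c where c: "\<And>\<theta>. norm (initial_part h \<phi> \<theta>) \<le> c" using \<Phi> by (auto simp: initial_segment_def)
  have "((\<lambda>\<theta>. G \<theta> *v \<phi> \<theta>) has_integral (LINT \<theta>|lborel. G \<theta> *v initial_part h \<phi> \<theta>)) {-h..0}"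
  proof (rule lborel_integral_has_integral_on)
    show "integrable lborel (\<lambda>\<theta>. G \<theta> *v initial_part h \<phi> \<theta>)"
      using \<Phi> by (intro integrable_matrix_vector_bounded[OF G _ c]) (simp add: initial_segment_def)
    show "AE \<theta> in lborel. \<theta> \<in> {-h..0} \<longrightarrow> G \<theta> *v initial_part h \<phi> \<theta> = G \<theta> *v \<phi> \<theta>"
      using AE_lborel_neq[of 0] by eventually_elim (auto simp: initial_part_def indicator_def)
  qed (auto simp: initial_part_def)
  then show ?thesis by (simp add: integral_unique)
qed

text \<open>
  For almost every \<open>\<theta>\<close> the inner function of \<open>\<xi>\<close> is integrable and the two kinds of inner integral agree; the
  remaining \<open>\<theta>\<close>, and the point \<open>\<theta> = 0\<close>, do not contribute to the outer integral.
\<close>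

lemma (in delay_system) iterated_integral_initial_part:
  fixes G :: "real \<Rightarrow> real \<Rightarrow> real^'n^'n"
  assumes G: "integrable (lborel \<Otimes>\<^sub>M lborel) (\<lambda>(\<xi>, \<theta>). G \<xi> \<theta>)" and \<phi>: "\<phi> \<in> PC (-h) 0"
  shows "(LINT (\<xi>, \<theta>)|(lborel \<Otimes>\<^sub>M lborel). initial_part h \<phi> \<xi> \<bullet> (G \<xi> \<theta> *v initial_part h \<phi> \<theta>))
    = integral {-h..0} (\<lambda>\<theta>. integral {-h..0} (\<lambda>\<xi>. \<phi> \<xi> \<bullet> (G \<xi> \<theta> *v \<phi> \<theta>)))"
proof -
  let ?\<Phi> = "initial_part h \<phi>"
  let ?F = "\<lambda>\<xi> \<theta>. ?\<Phi> \<xi> \<bullet> (G \<xi> \<theta> *v ?\<Phi> \<theta>)"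
  have \<Phi>: "initial_segment ?\<Phi>" by (rule initial_segment_initial_part[OF \<phi>])
  obtain c where c: "\<And>\<theta>. norm (?\<Phi> \<theta>) \<le> c" using \<Phi> by (auto simp: initial_segment_def)
  have F: "integrable (lborel \<Otimes>\<^sub>M lborel) (\<lambda>(\<xi>, \<theta>). ?F \<xi> \<theta>)"
    by (rule integrable_kernel_form[OF G _ c]) (use \<Phi> in \<open>simp add: initial_segment_def\<close>)
  have \<Phi>_eq: "?\<Phi> \<theta> = \<phi> \<theta>" if "\<theta> \<in> {-h..0}" "\<theta> \<noteq> 0" for \<theta>
    using that by (auto simp: initial_part_def indicator_def)
  have \<Phi>_zero: "?\<Phi> \<theta> = 0" if "\<theta> \<notin> {-h..0}" for \<theta>
    using that by (auto simp: initial_part_def)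
  have "((\<lambda>\<theta>. integral {-h..0} (\<lambda>\<xi>. \<phi> \<xi> \<bullet> (G \<xi> \<theta> *v \<phi> \<theta>))) has_integral
      (LINT \<theta>|lborel. LINT \<xi>|lborel. ?F \<xi> \<theta>)) {-h..0}"
  proof (rule lborel_integral_has_integral_on)
    show "integrable lborel (\<lambda>\<theta>. LINT \<xi>|lborel. ?F \<xi> \<theta>)"
      by (rule lborel_pair.integrable_snd[OF F])
    show "AE \<theta> in lborel. \<theta> \<in> {-h..0} \<longrightarrow>
        (LINT \<xi>|lborel. ?F \<xi> \<theta>) = integral {-h..0} (\<lambda>\<xi>. \<phi> \<xi> \<bullet> (G \<xi> \<theta> *v \<phi> \<theta>))"
      using lborel_pair.AE_integrable_snd[OF F] AE_lborel_neq[of 0]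
    proof eventually_elim
      case (elim \<theta>)
      show ?case
      proof
        assume \<theta>: "\<theta> \<in> {-h..0}"
        have "((\<lambda>\<xi>. \<phi> \<xi> \<bullet> (G \<xi> \<theta> *v \<phi> \<theta>)) has_integral (LINT \<xi>|lborel. ?F \<xi> \<theta>)) {-h..0}"
        proof (rule lborel_integral_has_integral_on)
          show "AE \<xi> in lborel. \<xi> \<in> {-h..0} \<longrightarrow> ?F \<xi> \<theta> = \<phi> \<xi> \<bullet> (G \<xi> \<theta> *v \<phi> \<theta>)"
            using AE_lborel_neq[of 0] by eventually_elim (use \<theta> elim(2) in \<open>simp add: \<Phi>_eq\<close>)
        qed (use elim(1) \<Phi>_zero in auto)
        then show "(LINT \<xi>|lborel. ?F \<xi> \<theta>) = integral {-h..0} (\<lambda>\<xi>. \<phi> \<xi> \<bullet> (G \<xi> \<theta> *v \<phi> \<theta>))"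
          by (simp add: integral_unique)
      qed
    qed
  qed (simp add: \<Phi>_zero)
  then have "integral {-h..0} (\<lambda>\<theta>. integral {-h..0} (\<lambda>\<xi>. \<phi> \<xi> \<bullet> (G \<xi> \<theta> *v \<phi> \<theta>)))
      = (LINT \<theta>|lborel. LINT \<xi>|lborel. ?F \<xi> \<theta>)"
    by (rule integral_unique)
  also have "\<dots> = (LINT (\<xi>, \<theta>)|(lborel \<Otimes>\<^sub>M lborel). ?F \<xi> \<theta>)"
    by (rule lborel_pair.integral_snd[OF F])
  finally show ?thesis by simp
qed

text \<open>
  By continuity the state stays away from \<open>0\<close> on a short interval \<open>{0..d}\<close>, where the running cost is then bounded
  below by a positive constant.
\<close>

lemma performance_index_pos:
  assumes Q: "symmetric_pos_def Q" and R: "symmetric_pos_def R"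
    and x: "continuous_on {0..} x" and x0: "x 0 \<noteq> 0" and fin: "running_cost Q R u x integrable_on {0..}"
  shows "performance_index Q R u x > 0"
proof -
  let ?J = "running_cost Q R u x"
  obtain c where c: "c > 0" "\<And>v. c * (norm v)\<^sup>2 \<le> v \<bullet> (Q *v v)"
    using symmetric_pos_def_lower_bound[OF Q] by blast
  obtain e where e: "e > 0" "\<And>t. t \<ge> 0 \<Longrightarrow> t < e \<Longrightarrow> dist (x t) (x 0) < norm (x 0) / 2"
    using x[unfolded continuous_on_iff, rule_format, of 0 "norm (x 0) / 2"] x0 by (auto simp: dist_real_def)
  define d where "d = e / 2"
  have d: "d > 0" using e by (simp add: d_def)
  have lower: "c * (norm (x 0) / 2)\<^sup>2 \<le> ?J t" if "t \<in> {0..d}" for t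
  proof -
    have "dist (x t) (x 0) < norm (x 0) / 2" using that e d by (intro e(2)) (auto simp: d_def)
    then have "norm (x 0) / 2 \<le> norm (x t)"
      using norm_triangle_ineq2[of "x 0" "x t"] by (simp add: dist_norm norm_minus_commute)
    then have "c * (norm (x 0) / 2)\<^sup>2 \<le> c * (norm (x t))\<^sup>2"
      using c by (intro mult_left_mono power_mono) auto
    then show ?thesis
      using c(2)[of "x t"] running_cost_bounds(1)[OF Q R, of x t u] by linarith
  qed
  have abs: "?J absolutely_integrable_on {0..}"
    by (rule nonnegative_absolutely_integrable_1[OF fin]) (rule running_cost_bounds(2)[OF Q R])
  have sub: "?J integrable_on {0..d}"
    by (rule set_lebesgue_integral_eq_integral(1)[OF set_integrable_subset[OF abs]]) auto
  have "0 < d * (c * (norm (x 0) / 2)\<^sup>2)"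
    using d c x0 by simp
  also have "\<dots> = integral {0..d} (\<lambda>_. c * (norm (x 0) / 2)\<^sup>2)"
    using d by simp
  also have "\<dots> \<le> integral {0..d} ?J"
    by (rule integral_le[OF _ sub]) (use lower in auto)
  also have "\<dots> \<le> integral {0..} ?J"
    by (rule integral_subset_le[OF _ sub fin]) (use running_cost_bounds(2)[OF Q R] in auto)
  finally show ?thesis by (simp add: performance_index_def)
qed

theorem proposition1:
  fixes h :: real
    and A B :: "real^'n^'n"
    and E :: "real \<Rightarrow> real^'n^'n"
    and D :: "real^'r^'n"
    and Q :: "real^'n^'n"
    and R :: "real^'r^'r"
    and \<Gamma>\<^sub>0 :: "real^'n^'r"
    and \<Gamma>\<^sub>1 :: "real \<Rightarrow> real^'n^'r"
  assumes "h > 0"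
    and "CARD('r) \<le> CARD('n)"
    and "continuous_on {-h..0} E"
    and "symmetric_pos_def Q"
    and "symmetric_pos_def R"
    and "\<Gamma>\<^sub>1 absolutely_integrable_on {-h..0}"
    and "admissible h A B E D Q R (linear_control h \<Gamma>\<^sub>0 \<Gamma>\<^sub>1)"
  shows "\<exists>(\<Pi>\<^sub>0 :: real^'n^'n) (\<Pi>\<^sub>1 :: real \<Rightarrow> real^'n^'n) (\<Pi>\<^sub>2 :: real \<Rightarrow> real \<Rightarrow> real^'n^'n).
     symmetric_pos_def \<Pi>\<^sub>0 \<and>
     \<Pi>\<^sub>1 absolutely_integrable_on {-h..0} \<and>
     (\<lambda>(\<xi>, \<theta>). \<Pi>\<^sub>2 \<xi> \<theta>) absolutely_integrable_on ({-h..0} \<times> {-h..0}) \<and>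
     (\<forall>\<xi>\<in>{-h..0}. \<forall>\<theta>\<in>{-h..0}. transpose (\<Pi>\<^sub>2 \<xi> \<theta>) = \<Pi>\<^sub>2 \<theta> \<xi>) \<and>
     (\<forall>\<phi>\<in>PC (-h) 0. \<forall>x. closed_loop_solution h A B E D (linear_control h \<Gamma>\<^sub>0 \<Gamma>\<^sub>1) \<phi> x \<longrightarrow>
        performance_index Q R (linear_control h \<Gamma>\<^sub>0 \<Gamma>\<^sub>1) x =
          \<phi> 0 \<bullet> (\<Pi>\<^sub>0 *v \<phi> 0)
          + 2 * (\<phi> 0 \<bullet> integral {-h..0} (\<lambda>\<theta>. \<Pi>\<^sub>1 \<theta> *v \<phi> \<theta>))
          + integral {-h..0} (\<lambda>\<theta>. integral {-h..0} (\<lambda>\<xi>. \<phi> \<xi> \<bullet> (\<Pi>\<^sub>2 \<xi> \<theta> *v \<phi> \<theta>))))"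
proof -
  let ?u = "linear_control h \<Gamma>\<^sub>0 \<Gamma>\<^sub>1"
  let ?sol = "closed_loop_solution h A B E D ?u"
  note h = \<open>h > 0\<close> and Q = \<open>symmetric_pos_def Q\<close> and R = \<open>symmetric_pos_def R\<close>
  have ex: "\<exists>x. ?sol \<phi> x" if "\<phi> \<in> PC (-h) 0" for \<phi>
    using assms(7) that unfolding admissible_def by blast
  have fin: "running_cost Q R ?u x integrable_on {0..}" if "\<phi> \<in> PC (-h) 0" "?sol \<phi> x" for \<phi> x
    using assms(7) that unfolding admissible_def by blast
  obtain \<epsilon> where \<epsilon>: "delay_density h E \<epsilon>"
    using delay_density_exists[OF absolutely_integrable_continuous_real[OF assms(3)]] by blast
  obtain \<gamma> where \<gamma>: "delay_density h \<Gamma>\<^sub>1 \<gamma>"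
    using delay_density_exists[OF assms(6)] by blast
  interpret closed_loop h A B E D \<Gamma>\<^sub>0 \<Gamma>\<^sub>1 \<epsilon> \<gamma>
    by unfold_locales (fact h \<epsilon> \<gamma>)+
  obtain K where K: "fundamental_matrix K" "(\<integral>\<^sup>+t. (ennreal (norm (K t)))\<^sup>2 \<partial>lborel) < \<infinity>"
  proof (rule square_integrable_fundamental_matrix)
    show "\<exists>x. ?sol \<phi> x" if "\<phi> \<in> PC (-h) 0" for \<phi> using that by (rule ex)
    show "integrable lborel (\<lambda>t. (norm (causal_part x t))\<^sup>2)" if "\<phi> \<in> PC (-h) 0" "?sol \<phi> x" for \<phi> x
      by (rule solution_square_integrable[OF Q R solution_continuous_initial(1)[OF that(2)] fin[OF that]])
  qed
  have QR: "transpose Q = Q" "transpose R = R"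
    using Q R by (simp_all add: symmetric_pos_def_def)
  obtain \<Pi>0 :: "real^'n^'n" and \<Pi>1 :: "real \<Rightarrow> real^'n^'n" and \<Pi>2 :: "real \<Rightarrow> real \<Rightarrow> real^'n^'n"
    where \<Pi>0: "transpose \<Pi>0 = \<Pi>0" and \<Pi>1: "integrable lborel \<Pi>1"
      and \<Pi>2: "integrable (lborel \<Otimes>\<^sub>M lborel) (\<lambda>(\<xi>, \<theta>). \<Pi>2 \<xi> \<theta>)"
      and \<Pi>2_sym: "\<And>\<xi> \<theta>. transpose (\<Pi>2 \<xi> \<theta>) = \<Pi>2 \<theta> \<xi>"
      and J: "\<And>\<phi> x. \<phi> \<in> PC (-h) 0 \<Longrightarrow> ?sol \<phi> x \<Longrightarrow> performance_index Q R ?u x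
        = \<phi> 0 \<bullet> (\<Pi>0 *v \<phi> 0) + 2 * (\<phi> 0 \<bullet> (LINT \<theta>|lborel. \<Pi>1 \<theta> *v initial_part h \<phi> \<theta>))
        + (LINT (\<xi>, \<theta>)|(lborel \<Otimes>\<^sub>M lborel). initial_part h \<phi> \<xi> \<bullet> (\<Pi>2 \<xi> \<theta> *v initial_part h \<phi> \<theta>))"
    by (rule performance_index_representation[OF K QR]) (rule that)
  \<comment> \<open>The cost of the trajectory of an impulse is the value of the quadratic form of \<open>\<Pi>0\<close>.\<close>
  have "symmetric_pos_def \<Pi>0"
    unfolding symmetric_pos_def_def
  proof (intro conjI allI impI)
    fix v :: "real^'n" assume v: "v \<noteq> 0"
    have PC: "impulse v \<in> PC (-h) 0" by (rule impulse_PC[OF h])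
    then obtain x where x: "?sol (impulse v) x" using ex by blast
    have "x 0 = v"
      using solution_continuous_initial(2)[OF x, of 0] h by (simp add: impulse_def)
    then have "performance_index Q R ?u x > 0"
      using v by (intro performance_index_pos[OF Q R solution_continuous_initial(1)[OF x] _ fin[OF PC x]]) simp
    then show "v \<bullet> (\<Pi>0 *v v) > 0"
      using J[OF PC x] by (simp add: initial_part_impulse split_beta') (simp add: impulse_def)
  qed (rule \<Pi>0)
  moreover have "\<Pi>1 absolutely_integrable_on {-h..0}"
    unfolding set_integrable_def
    using \<Pi>1 by (intro integrable_mult_indicator) (simp_all add: integrable_completion)
  moreover have "(\<lambda>(\<xi>, \<theta>). \<Pi>2 \<xi> \<theta>) absolutely_integrable_on ({-h..0} \<times> {-h..0})"
    unfolding set_integrable_def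
    using \<Pi>2 by (intro integrable_mult_indicator)
      (simp_all add: integrable_completion lborel_prod borel_closed closed_Times)
  ultimately show ?thesis
    using \<Pi>2_sym J by (intro exI[of _ \<Pi>0] exI[of _ \<Pi>1] exI[of _ \<Pi>2])
      (simp add: integral_initial_part[OF \<Pi>1] iterated_integral_initial_part[OF \<Pi>2])
qed

end
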